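(* With probability one: (1) for every point $\xi\in K$, $\mu^{\bullet}(\xi)\geq 2$; and (2) for every real number $\mu\geq 2$, $\dim_H(\mathcal{M}^{\bullet}(\mu)\cap K)=\max\left\{\frac{2}{\mu}+\kappa-1,\frac{\kappa}{\mu}\right\}$.
   Context: $\mathbb{T}=\mathbb{R}/\mathbb{Z}$ with quotient distance $d$. $K$ is the image in $\mathbb{T}$ of the middle-third Cantor set, $\kappa=\log2/\log3$. Let $\mathcal{P}$ be the set of integer pairs $(p,q)$ with $0\le p<q$ and $\gcd(p,q)=1$; for $j\ge1$ let $\mathcal{P}^j=\{(p,q)\in\mathcal{P}: 3^j\le q<3^{j+1}\}$, and for $\mathcal{P}'\subseteq\mathcal{P}$ let $\sigma(\mathcal{P}')=\limsup_{j\to\infty}\frac1j\log_3\#(\mathcal{P}'\cap\mathcal{P}^j)$. Fix a subset $\mathcal{P}_K\subseteq\mathcal{P}$ with $\sigma(\mathcal{P}_K)=\kappa$. Let $(Y_{p,q})_{(p,q)\in\mathcal{P}}$ be independent random points of $\mathbb{T}$ such that $Y_{p,q}$ is distributed according to the normalized $\kappa$-dimensional Hausdorff measure restricted to $K$ if $(p,q)\in\mathcal{P}_K$, and according to Lebesgue measure on $\mathbb{T}$ otherwise. For $\mu\ge0$ let $\mathcal{F}(\mu)=\{\xi\in\mathbb{T}: d(\xi,Y_{p,q})<q^{-\mu}\text{ for infinitely many }(p,q)\in\mathcal{P}\}$, let $\mu^{\bullet}(\xi)=\sup\{\mu\ge0:\xi\in\mathcal{F}(\mu)\}$, and $\mathcal{M}^{\bullet}(\mu)=\{\xi\in\mathbb{T}:\mu^{\bullet}(\xi)\ge\mu\}$.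 $\dim_H$ is Hausdorff dimension. *)

theory Defs
  imports "HOL-Probability.Probability"
begin

text \<open>The torus T = R/Z is represented by the fundamental domain {0..<1} of real;
  its quotient distance is the distance of x - y to the nearest integer.
  All notions below are 1-periodic, so this is the torus metric.\<close>

definition torus :: "real set" where
  "torus = {0..<1}"

definition dT :: "real \<Rightarrow> real \<Rightarrow> real" where
  "dT x y = \<bar>(x - y) - of_int (round (x - y))\<bar>"

definition diamT :: "real set \<Rightarrow> real" where
  "diamT U = (if U = {} then 0 else (SUP x\<in>U. SUP y\<in>U. dT x y))"

text \<open>Contribution diam(U)^s of a covering set (with diam(empty)^s = 0 and 0^0 = 1).\<close>
definition hcontrib :: "real \<Rightarrow> real set \<Rightarrow> ennreal" where
  "hcontrib s U = (if U = {} then 0 else if s = 0 then 1 else ennreal (diamT U powr s))"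

definition hausdorff_pre :: "real \<Rightarrow> real \<Rightarrow> real set \<Rightarrow> ennreal" where
  "hausdorff_pre s \<delta> A =
     (INF U \<in> {U :: nat \<Rightarrow> real set. A \<subseteq> (\<Union>i. U i) \<and> (\<forall>i. diamT (U i) \<le> \<delta>)}.
        (\<Sum>i. hcontrib s (U i)))"

definition hausdorffT :: "real \<Rightarrow> real set \<Rightarrow> ennreal" where
  "hausdorffT s A = (SUP \<delta> \<in> {0<..}. hausdorff_pre s \<delta> A)"

definition dimH :: "real set \<Rightarrow> real" where
  "dimH A = Inf {s. s \<ge> 0 \<and> hausdorffT s A = 0}"

fun cantor_step :: "nat \<Rightarrow> real set" where
  "cantor_step 0 = {0..1}"
| "cantor_step (Suc n) = (\<lambda>x. x / 3) ` cantor_step n \<union> (\<lambda>x. 2/3 + x / 3) ` cantor_step n"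

definition cantor_set :: "real set" where
  "cantor_set = (\<Inter>n. cantor_step n)"

definition K :: "real set" where
  "K = frac ` cantor_set"

definition kappa :: real where
  "kappa = ln 2 / ln 3"

definition muK :: "real measure" where
  "muK = measure_of UNIV (sets borel) (\<lambda>A. hausdorffT kappa (A \<inter> K) / hausdorffT kappa K)"

definition lebT :: "real measure" where
  "lebT = density lborel (indicator torus)"

definition Ppairs :: "(nat \<times> nat) set" where
  "Ppairs = {(p, q). p < q \<and> coprime p q}"

definition Pj :: "nat \<Rightarrow> (nat \<times> nat) set" where
  "Pj j = {(p, q) \<in> Ppairs. 3 ^ j \<le> q \<and> q < 3 ^ (j + 1)}"

definition sigmaP :: "(nat \<times> nat) set \<Rightarrow> ereal" where
  "sigmaP S = limsup (\<lambda>j. if card (S \<inter> Pj j) = 0 then - \<infinity>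
                           else ereal (log 3 (real (card (S \<inter> Pj j))) / real j))"

definition Ydist :: "(nat \<times> nat) set \<Rightarrow> nat \<times> nat \<Rightarrow> real measure" where
  "Ydist PK pq = (if pq \<in> PK then muK else lebT)"

definition Omega :: "(nat \<times> nat) set \<Rightarrow> ((nat \<times> nat) \<Rightarrow> real) measure" where
  "Omega PK = PiM Ppairs (Ydist PK)"

definition Fset :: "((nat \<times> nat) \<Rightarrow> real) \<Rightarrow> real \<Rightarrow> real set" where
  "Fset Y \<mu> = {\<xi> \<in> torus. infinite {(p, q) \<in> Ppairs. dT \<xi> (Y (p, q)) < real q powr (- \<mu>)}}"

definition mu_bullet :: "((nat \<times> nat) \<Rightarrow> real) \<Rightarrow> real \<Rightarrow> ereal" where
  "mu_bullet Y \<xi> = Sup {ereal \<mu> | \<mu>. \<mu> \<ge> 0 \<and> \<xi> \<in> Fset Y \<mu>}"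

definition M_bullet :: "((nat \<times> nat) \<Rightarrow> real) \<Rightarrow> real \<Rightarrow> real set" where
  "M_bullet Y \<mu> = {\<xi> \<in> torus. mu_bullet Y \<xi> \<ge> ereal \<mu>}"

end

theory Submission
  imports Defs "HOL-Number_Theory.Totient" "HOL-Real_Asymp.Real_Asymp"
begin

text \<open>Upper bound: with \<open>\<kappa> = kappa\<close>, a Lebesgue point \<open>Y (p, q)\<close> comes within \<open>q powr - \<nu>\<close> of
  \<open>K\<close> with probability about \<open>q powr (- \<nu> * (1 - \<kappa>))\<close>. So the expected \<open>s\<close>-dimensional sum of all
  the balls that meet \<open>K\<close> converges as soon as \<open>s\<close> exceeds both \<open>2 / \<nu> + \<kappa> - 1\<close> (Lebesgue points)
  and \<open>\<kappa> / \<nu>\<close> (points of \<open>K\<close>).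

  Lower bound: by Borel-Cantelli, almost surely, for all large \<open>j\<close> (respectively for all large
  \<open>j\<close> in an infinite set) every Cantor cylinder of a generation \<open>g j\<close> contains a cylinder of
  generation \<open>n j \<approx> j * \<nu>\<close> lying in one of the balls with \<open>(p, q) \<in> Pj j\<close>, where \<open>g j * \<kappa> / n j\<close> is
  arbitrarily close to \<open>2 / \<nu> + \<kappa> - 1\<close> (respectively \<open>\<kappa> / \<nu>\<close>). Along a sparse sequence of such
  \<open>j\<close> one constructs points of the limsup set whose ternary digits are free up to \<open>g j\<close> and forced
  from there up to \<open>n j\<close>. Reading off the free digits is a Hoelder map onto \<open>[0, 1]\<close>, which bounds
  the Hausdorff measure of this set of points from below. The same argument with all digits free
  gives \<open>0 < hausdorffT \<kappa> K\<close>, and with \<open>g j = n j\<close> the Borel-Cantelli step gives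
  \<open>K \<subseteq> Fset Y \<nu>\<close> for \<open>\<nu> < 2\<close>.\<close>

section \<open>Hausdorff measures on the torus\<close>

text \<open>The exponents come from comparing numbers of points with target sizes. Put n =
  \<open>scale \<nu> j\<close>, about j * \<nu>. A Lebesgue point must enter one of the 2^(n - g)
  full ternary intervals of generation n below a given word of length g; there are about 9^j such
  points, so success needs 2 * j + \<kappa> * (n - g) - n to be positive, that is, g * \<kappa> < (2
  - \<nu> * (1 - \<kappa>)) * j. A point of \<open>K\<close> need only enter the cylinder of the
  word itself, since its own later digits lead back to it; 3^(\<kappa> * j) = 2^j points allow any g
  slightly below j. As \<open>sigmaP\<close> is a limsup, the second count holds only on an infinite
  set of j. Two obstacles shape the rest. \<open>muK\<close> is introduced through
  \<open>measure_of\<close>, so its countable additivity and the positivity and finiteness of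
  \<open>hausdorffT kappa K\<close> must be proved before it can be used. And uncountably many \<mu>
  share one almost sure event: exceptional sets are collected for rational exponents only, and
  continuity of the dimension formula gives all other \<mu>.\<close>

lemma dT_le: "dT x y \<le> \<bar>x - y - of_int m\<bar>"
  unfolding dT_def using round_diff_minimal[of "x - y" m] by simp

lemma dT_le_abs: "dT x y \<le> \<bar>x - y\<bar>"
  using dT_le[of x y 0] by simp

lemma dT_nonneg: "0 \<le> dT x y"
  by (simp add: dT_def)

lemma dT_le_half: "dT x y \<le> 1/2"
  unfolding dT_def using of_int_round_abs_le[of "x - y"] by linarith

lemma dT_self [simp]: "dT x x = 0"
  by (simp add: dT_def)

lemma dT_commute: "dT x y = dT y x"
proof -
  have "dT x y \<le> dT y x" for x y
    using dT_le[of x y "- round (y - x)"] by (simp add: dT_def)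
  then show ?thesis by (simp add: antisym)
qed

lemma dT_triangle: "dT x z \<le> dT x y + dT y z"
  using dT_le[of x z "round (x - y) + round (y - z)"] unfolding dT_def by simp

lemma dT_translate [simp]: "dT (t + x) (t + y) = dT x y"
  by (simp add: dT_def)

lemma dT_eq_abs:
  assumes "\<bar>x - y\<bar> \<le> 1/2"
  shows "dT x y = \<bar>x - y\<bar>"
proof -
  have "\<bar>x - y\<bar> \<le> \<bar>x - y - of_int m\<bar>" for m :: int
  proof (cases "m = 0")
    case False
    then have "1 \<le> \<bar>of_int m :: real\<bar>" by linarith
    then show ?thesis using assms by linarith
  qed simp
  from this[of "round (x - y)"] show ?thesis
    using dT_le_abs[of x y] by (simp add: dT_def)
qed

lemma dT_ge:
  assumes "r \<le> \<bar>x - y\<bar>" "\<bar>x - y\<bar> \<le> 1 - r"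
  shows "r \<le> dT x y"
proof -
  have "r \<le> \<bar>x - y - of_int m\<bar>" for m :: int
  proof (cases "m = 0")
    case False
    then have "1 \<le> \<bar>of_int m :: real\<bar>" by linarith
    then show ?thesis using assms by linarith
  qed (use assms in simp)
  then show ?thesis by (simp add: dT_def)
qed

text \<open>Representatives in \<open>{0..1}\<close> differ by at most 1, so only three integer
  shifts compete; a torus ball becomes three intervals on the line.\<close>

lemma dT_lessE:
  assumes "dT x y < r" "x \<in> {0..1}" "y \<in> {0..1}"
  obtains z :: int where "z \<in> {-1..1}" "\<bar>x - y - of_int z\<bar> < r"
proof
  show "round (x - y) \<in> {-1..1}"
    using assms(2,3) round_mono[of "of_int (- 1)" "x - y"] round_mono[of "x - y" "of_int 1"]
    unfolding round_of_int by simp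
  show "\<bar>x - y - of_int (round (x - y))\<bar> < r"
    using assms(1) by (simp add: dT_def)
qed

lemma diamT_ge:
  assumes "x \<in> U" "y \<in> U"
  shows "dT x y \<le> diamT U"
proof -
  \<comment> \<open>\<open>SUP\<close> over the reals is informative only for bounded families; the
    bound 1/2 on all torus distances supplies this.\<close>
  have bdd: "bdd_above ((\<lambda>y. dT x y) ` U)" for x
    by (auto intro!: bdd_aboveI[of _ "1/2"] dT_le_half)
  have "bdd_above ((\<lambda>x. SUP y\<in>U. dT x y) ` U)"
    using assms by (auto intro!: bdd_aboveI[of _ "1/2"] cSUP_least dT_le_half)
  then have "(SUP y\<in>U. dT x y) \<le> (SUP x\<in>U. SUP y\<in>U. dT x y)"
    by (rule cSUP_upper[OF assms(1)])
  moreover have "dT x y \<le> (SUP y\<in>U. dT x y)"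
    by (rule cSUP_upper[OF assms(2) bdd])
  ultimately show ?thesis
    using assms by (auto simp: diamT_def)
qed

lemma diamT_le:
  assumes "\<And>x y. x \<in> U \<Longrightarrow> y \<in> U \<Longrightarrow> dT x y \<le> c" "0 \<le> c"
  shows "diamT U \<le> c"
  using assms by (auto simp: diamT_def intro!: cSUP_least)

lemma diamT_nonneg: "0 \<le> diamT U"
proof (cases "U = {}")
  case False
  then obtain x where "x \<in> U" by blast
  with diamT_ge[of x U x] show ?thesis by simp
qed (simp add: diamT_def)

lemma diamT_le_half: "diamT U \<le> 1/2"
  using dT_le_half by (rule diamT_le) simp

lemma diamT_mono:
  assumes "V \<subseteq> U"
  shows "diamT V \<le> diamT U"
  using assms by (intro diamT_le diamT_ge diamT_nonneg) auto

lemma diamT_empty [simp]: "diamT {} = 0"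
  by (simp add: diamT_def)

lemma hcontrib_empty [simp]: "hcontrib s {} = 0"
  by (simp add: hcontrib_def)

lemma hcontrib_mono:
  assumes "V \<subseteq> U" "0 \<le> s"
  shows "hcontrib s V \<le> hcontrib s U"
  using assms diamT_mono[OF assms(1)] diamT_nonneg[of V]
  by (auto simp: hcontrib_def intro!: ennreal_leI powr_mono2)

lemma hcontrib_le:
  assumes "0 < s" "diamT U \<le> c"
  shows "hcontrib s U \<le> ennreal (c powr s)"
  using assms diamT_nonneg[of U]
  by (auto simp: hcontrib_def intro!: ennreal_leI powr_mono2)

text \<open>Every torus diameter is at most 1/2, so the comparison of powers holds at all scales.
  The separate bound by 1 serves s = 0, where a nonempty set contributes 1 by convention.\<close>

lemma hcontrib_antimono_exponent:
  assumes "0 \<le> s" "s \<le> t"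
  shows "hcontrib t U \<le> hcontrib s U"
proof -
  have "diamT U powr t \<le> diamT U powr s"
    using assms diamT_nonneg[of U] diamT_le_half[of U]
    by (cases "diamT U = 0") (auto intro!: powr_mono')
  moreover have "diamT U powr t \<le> 1"
    using assms diamT_nonneg[of U] diamT_le_half[of U]
    by (intro powr_le1) auto
  ultimately show ?thesis
    using assms by (auto simp: hcontrib_def intro!: ennreal_leI)
qed

section \<open>Hausdorff premeasures and outer measures\<close>

lemma hausdorff_pre_le:
  assumes "A \<subseteq> (\<Union>i. U i)" "\<And>i. diamT (U i) \<le> \<delta>"
  shows "hausdorff_pre s \<delta> A \<le> (\<Sum>i. hcontrib s (U i))"
  unfolding hausdorff_pre_def using assms by (intro INF_lower) auto

lemma hausdorff_pre_greatest:
  assumes "\<And>U. A \<subseteq> (\<Union>i. U i) \<Longrightarrow> (\<And>i. diamT (U i) \<le> \<delta>) \<Longrightarrow> c \<le> (\<Sum>i. hcontrib s (U i))"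
  shows "c \<le> hausdorff_pre s \<delta> A"
  unfolding hausdorff_pre_def using assms by (intro INF_greatest) auto

lemma hausdorff_pre_antimono:
  assumes "\<delta> \<le> \<epsilon>"
  shows "hausdorff_pre s \<epsilon> A \<le> hausdorff_pre s \<delta> A"
  using assms by (intro hausdorff_pre_greatest hausdorff_pre_le) (auto intro: order_trans)

lemma hausdorff_pre_mono:
  assumes "A \<subseteq> B"
  shows "hausdorff_pre s \<delta> A \<le> hausdorff_pre s \<delta> B"
  using assms by (intro hausdorff_pre_greatest hausdorff_pre_le) auto

lemma hausdorff_pre_le_hausdorffT: "0 < \<delta> \<Longrightarrow> hausdorff_pre s \<delta> A \<le> hausdorffT s A"
  unfolding hausdorffT_def by (intro SUP_upper) auto

lemma hausdorffT_mono: "A \<subseteq> B \<Longrightarrow> hausdorffT s A \<le> hausdorffT s B"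
  unfolding hausdorffT_def by (intro SUP_mono) (auto intro: hausdorff_pre_mono)

lemma hausdorffT_empty [simp]: "hausdorffT s {} = 0"
proof -
  have "hausdorff_pre s \<delta> {} \<le> 0" if "0 < \<delta>" for \<delta>
    using hausdorff_pre_le[of "{}" "\<lambda>_. {}" \<delta> s] that by simp
  then show ?thesis
    by (auto simp: hausdorffT_def SUP_eq_const)
qed

lemma hausdorff_pre_countably_subadditive:
  "hausdorff_pre s \<delta> (\<Union>i. A i) \<le> (\<Sum>i. hausdorff_pre s \<delta> (A i))"
proof (rule ennreal_le_epsilon)
  fix e :: real
  assume fin: "(\<Sum>i. hausdorff_pre s \<delta> (A i)) < top" and e: "0 < e"
  have *: "\<exists>U. A i \<subseteq> (\<Union>k. U k) \<and> (\<forall>k. diamT (U k) \<le> \<delta>) \<and>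
      (\<Sum>k. hcontrib s (U k)) \<le> hausdorff_pre s \<delta> (A i) + ennreal (e * (1/2) ^ Suc i)" for i
  proof -
    have "hausdorff_pre s \<delta> (A i) \<noteq> \<infinity>"
      using fin ennreal_suminf_lessD[of "\<lambda>i. hausdorff_pre s \<delta> (A i)" top i] by auto
    from INF_approx_ennreal[OF _ hausdorff_pre_def this, of "e * (1/2) ^ Suc i"] e
    obtain U where "A i \<subseteq> (\<Union>k. U k)" "\<forall>k. diamT (U k) \<le> \<delta>"
      "(\<Sum>k. hcontrib s (U k)) < hausdorff_pre s \<delta> (A i) + ennreal (e * (1/2) ^ Suc i)"
      by auto
    then show ?thesis by (auto intro: less_imp_le)
  qed
  then obtain U where U: "\<And>i. A i \<subseteq> (\<Union>k. U i k)" "\<And>i k. diamT (U i k) \<le> \<delta>"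
    "\<And>i. (\<Sum>k. hcontrib s (U i k)) \<le> hausdorff_pre s \<delta> (A i) + ennreal (e * (1/2) ^ Suc i)"
    by metis
  define V where "V = (\<lambda>n. case prod_decode n of (i, k) \<Rightarrow> U i k)"
  have "(\<Union>i. A i) \<subseteq> (\<Union>n. V n)"
  proof
    fix x assume "x \<in> (\<Union>i. A i)"
    then obtain i k where "x \<in> U i k" using U(1) by blast
    then have "x \<in> V (prod_encode (i, k))" by (simp add: V_def)
    then show "x \<in> (\<Union>n. V n)" by blast
  qed
  then have "hausdorff_pre s \<delta> (\<Union>i. A i) \<le> (\<Sum>n. hcontrib s (V n))"
    using U(2) by (intro hausdorff_pre_le) (auto simp: V_def split: prod.split)
  also have "\<dots> = (\<Sum>n. (\<lambda>(i, k). hcontrib s (U i k)) (prod_decode n))"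
    by (intro suminf_cong) (auto simp: V_def split: prod.split)
  also have "\<dots> = (\<Sum>i. \<Sum>k. hcontrib s (U i k))"
    by (rule suminf_ennreal_2dimen) simp
  also have "\<dots> \<le> (\<Sum>i. hausdorff_pre s \<delta> (A i) + ennreal (e * (1/2) ^ Suc i))"
    by (intro suminf_le U) auto
  also have "\<dots> = (\<Sum>i. hausdorff_pre s \<delta> (A i)) + (\<Sum>i. ennreal (e * (1/2) ^ Suc i))"
    by (rule suminf_add[symmetric]) auto
  also have "(\<Sum>i. ennreal (e * (1/2) ^ Suc i)) = ennreal e"
    using e sums_mult[OF power_half_series, of e]
    by (intro suminf_ennreal_eq) auto
  finally show "hausdorff_pre s \<delta> (\<Union>i. A i) \<le> (\<Sum>i. hausdorff_pre s \<delta> (A i)) + ennreal e" .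
qed

lemma hausdorffT_countably_subadditive:
  "hausdorffT s (\<Union>i. A i) \<le> (\<Sum>i. hausdorffT s (A i))"
proof -
  have "hausdorff_pre s \<delta> (\<Union>i. A i) \<le> (\<Sum>i. hausdorffT s (A i))" if "0 < \<delta>" for \<delta>
    using hausdorff_pre_countably_subadditive
    by (rule order_trans) (intro suminf_le hausdorff_pre_le_hausdorffT that, auto)
  then show ?thesis
    unfolding hausdorffT_def[of s "\<Union>i. A i"] by (intro SUP_least) auto
qed

lemma outer_measure_space_hausdorffT: "outer_measure_space UNIV (hausdorffT s)"
  by (auto simp: outer_measure_space_def positive_def increasing_def countably_subadditive_def
      intro: hausdorffT_mono hausdorffT_countably_subadditive)

lemma hausdorffT_subadditive: "hausdorffT s (A \<union> B) \<le> hausdorffT s A + hausdorffT s B"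
  using hausdorffT_countably_subadditive[of s "binaryset A B"]
  by (simp add: UN_binaryset_eq suminf_binaryset_eq)

text \<open>Once the diameters stay below \<open>d\<close>, no covering set meets both
  \<open>A\<close> and \<open>B\<close>, so a cover of the union splits into covers of the two
  parts. This metric property later yields Borel measurability.\<close>

lemma hausdorffT_separated:
  assumes "0 < d" "\<And>x y. x \<in> A \<Longrightarrow> y \<in> B \<Longrightarrow> d \<le> dT x y" "0 \<le> s"
  shows "hausdorffT s A + hausdorffT s B \<le> hausdorffT s (A \<union> B)"
proof -
  have small: "hausdorff_pre s \<delta> A + hausdorff_pre s \<delta> B \<le> hausdorff_pre s \<delta> (A \<union> B)"
    if "\<delta> < d" for \<delta>
  proof (rule hausdorff_pre_greatest)
    fix U :: "nat \<Rightarrow> real set"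
    assume U: "A \<union> B \<subseteq> (\<Union>i. U i)" "\<And>i. diamT (U i) \<le> \<delta>"
    have diam: "diamT (U i \<inter> C) \<le> \<delta>" for i C
      using diamT_mono[of "U i \<inter> C" "U i"] U(2)[of i] by simp
    have "hausdorff_pre s \<delta> A + hausdorff_pre s \<delta> B
        \<le> (\<Sum>i. hcontrib s (U i \<inter> A)) + (\<Sum>i. hcontrib s (U i \<inter> B))"
      using U(1) by (intro add_mono hausdorff_pre_le diam) auto
    also have "\<dots> = (\<Sum>i. hcontrib s (U i \<inter> A) + hcontrib s (U i \<inter> B))"
      by (rule suminf_add) auto
    also have "\<dots> \<le> (\<Sum>i. hcontrib s (U i))"
    proof (rule suminf_le)
      fix i
      have "U i \<inter> A = {} \<or> U i \<inter> B = {}"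
      proof (rule ccontr)
        assume "\<not> ?thesis"
        then obtain x y where "x \<in> U i" "x \<in> A" "y \<in> U i" "y \<in> B" by blast
        then show False
          using assms(2)[of x y] diamT_ge[of x "U i" y] U(2)[of i] that by linarith
      qed
      then show "hcontrib s (U i \<inter> A) + hcontrib s (U i \<inter> B) \<le> hcontrib s (U i)"
        using hcontrib_mono[of "U i \<inter> A" "U i" s] hcontrib_mono[of "U i \<inter> B" "U i" s] assms(3)
        by auto
    qed auto
    finally show "hausdorff_pre s \<delta> A + hausdorff_pre s \<delta> B \<le> (\<Sum>i. hcontrib s (U i))" .
  qed
  \<comment> \<open>Premeasures grow as \<delta> shrinks, so the two suprema run over a directed
    family and may be taken jointly.\<close>
  have "hausdorffT s A + hausdorffT s B
      = (SUP \<delta>\<in>{0<..}. hausdorff_pre s \<delta> A + hausdorff_pre s \<delta> B)"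
    unfolding hausdorffT_def
  proof (rule SUP_add_directed_ennreal[symmetric])
    fix i j :: real
    assume "i \<in> {0<..}" "j \<in> {0<..}"
    then show "\<exists>k\<in>{0<..}. hausdorff_pre s i A + hausdorff_pre s j B
        \<le> hausdorff_pre s k A + hausdorff_pre s k B"
      by (intro bexI[of _ "min i j"] add_mono hausdorff_pre_antimono) auto
  qed
  also have "\<dots> \<le> hausdorffT s (A \<union> B)"
  proof (rule SUP_least)
    fix \<delta> :: real
    assume "\<delta> \<in> {0<..}"
    let ?m = "min \<delta> (d/2)"
    have "hausdorff_pre s \<delta> A + hausdorff_pre s \<delta> B
        \<le> hausdorff_pre s ?m A + hausdorff_pre s ?m B"
      by (intro add_mono hausdorff_pre_antimono) auto
    also have "\<dots> \<le> hausdorff_pre s ?m (A \<union> B)"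
      using assms(1) by (intro small) auto
    also have "\<dots> \<le> hausdorffT s (A \<union> B)"
      using assms(1) \<open>\<delta> \<in> {0<..}\<close> by (intro hausdorff_pre_le_hausdorffT) auto
    finally show "hausdorff_pre s \<delta> A + hausdorff_pre s \<delta> B \<le> hausdorffT s (A \<union> B)" .
  qed
  finally show ?thesis .
qed

lemma diamT_translate [simp]: "diamT ((+) t ` U) = diamT U"
  by (simp add: diamT_def image_comp comp_def)

lemma hcontrib_translate [simp]: "hcontrib s ((+) t ` U) = hcontrib s U"
  by (simp add: hcontrib_def)

lemma hausdorffT_translate: "hausdorffT s ((+) t ` A) = hausdorffT s A"
proof -
  have le: "hausdorff_pre s \<delta> ((+) t ` A) \<le> hausdorff_pre s \<delta> A" for \<delta> t A
  proof (rule hausdorff_pre_greatest)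
    fix U :: "nat \<Rightarrow> real set"
    assume U: "A \<subseteq> (\<Union>i. U i)" "\<And>i. diamT (U i) \<le> \<delta>"
    have "hausdorff_pre s \<delta> ((+) t ` A) \<le> (\<Sum>i. hcontrib s ((+) t ` U i))"
      using U by (intro hausdorff_pre_le) (force, simp)
    then show "hausdorff_pre s \<delta> ((+) t ` A) \<le> (\<Sum>i. hcontrib s (U i))" by simp
  qed
  have "hausdorff_pre s \<delta> ((+) t ` A) = hausdorff_pre s \<delta> A" for \<delta>
    using le[of \<delta> t A] le[of \<delta> "-t" "(+) t ` A"]
    by (simp add: image_comp comp_def)
  then show ?thesis by (simp add: hausdorffT_def)
qed

lemma hausdorffT_le_finite_covers:
  assumes "\<And>\<delta>. 0 < \<delta> \<Longrightarrow> \<exists>F. finite F \<and> A \<subseteq> \<Union>F \<and> (\<forall>U\<in>F. diamT U \<le> \<delta>) \<and> (\<Sum>U\<in>F. hcontrib s U) \<le> c"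
  shows "hausdorffT s A \<le> c"
  unfolding hausdorffT_def
proof (rule SUP_least)
  fix \<delta> :: real
  assume d: "\<delta> \<in> {0<..}"
  with assms obtain F where F: "finite F" "A \<subseteq> \<Union>F" "\<forall>U\<in>F. diamT U \<le> \<delta>"
    "(\<Sum>U\<in>F. hcontrib s U) \<le> c" by (metis greaterThan_iff)
  obtain e where e: "bij_betw e {..<card F} F"
    using ex_bij_betw_nat_finite[OF F(1)] by (auto simp: atLeast0LessThan)
  define V where "V i = (if i < card F then e i else {})" for i
  have "\<Union>F \<subseteq> (\<Union>i. V i)"
  proof
    fix x assume "x \<in> \<Union>F"
    then obtain i where "i < card F" "x \<in> e i"
      using e by (auto simp: bij_betw_def)
    then have "x \<in> V i" by (simp add: V_def)
    then show "x \<in> (\<Union>i. V i)" by blast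
  qed
  moreover have "diamT (V i) \<le> \<delta>" for i
    using F(3) d bij_betwE[OF e] by (auto simp: V_def)
  ultimately have "hausdorff_pre s \<delta> A \<le> (\<Sum>i. hcontrib s (V i))"
    using F(2) by (intro hausdorff_pre_le) auto
  also have "\<dots> = (\<Sum>i<card F. hcontrib s (V i))"
    by (rule suminf_finite) (auto simp: V_def)
  also have "\<dots> = (\<Sum>U\<in>F. hcontrib s U)"
    using sum.reindex_bij_betw[OF e, of "hcontrib s"] by (simp add: V_def)
  finally show "hausdorff_pre s \<delta> A \<le> c" using F(4) by simp
qed

text \<open>Every tail of the sequence covers \<open>A\<close>. Convergence also forces the tail
  diameters down to \<delta>, because one larger set would alone contribute at least
  \<open>\<delta> powr s\<close>.\<close>

lemma hausdorffT_limsup_eq_0: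
  assumes "(\<Sum>i. hcontrib s (U i)) < \<infinity>" "0 < s"
    and A: "\<And>x. x \<in> A \<Longrightarrow> infinite {i. x \<in> U i}"
  shows "hausdorffT s A = 0"
proof -
  have tail: "(\<lambda>n. \<Sum>i. hcontrib s (U (i + n))) \<longlonglongrightarrow> 0"
  proof -
    have "hcontrib s (U i) \<noteq> top" for i
      by (simp add: hcontrib_def)
    then have "\<exists>r. \<forall>i. hcontrib s (U i) = ennreal (r i) \<and> 0 \<le> r i"
      by (intro choice allI) (metis ennreal_enn2real less_top enn2real_nonneg)
    then obtain r where r: "\<And>i. hcontrib s (U i) = ennreal (r i)" "\<And>i. 0 \<le> r i" by blast
    have sm: "summable r"
      using assms(1) r by (intro summable_suminf_not_top) auto
    have "(\<lambda>n. \<Sum>i. r (i + n)) \<longlonglongrightarrow> 0"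
      by (rule suminf_exist_split2[OF sm])
    then have "(\<lambda>n. ennreal (\<Sum>i. r (i + n))) \<longlonglongrightarrow> ennreal 0"
      by (rule tendsto_ennrealI)
    moreover have "(\<Sum>i. hcontrib s (U (i + n))) = ennreal (\<Sum>i. r (i + n))" for n
      using sm r by (simp add: suminf_ennreal2 summable_ignore_initial_segment)
    ultimately show ?thesis by simp
  qed
  have "hausdorff_pre s \<delta> A \<le> 0" if d: "0 < \<delta>" for \<delta>
  proof (rule LIMSEQ_le_const[OF tail])
    have "0 < ennreal (\<delta> powr s)" using d by simp
    from order_tendstoD(2)[OF tail this]
    obtain N where N: "\<And>n. N \<le> n \<Longrightarrow> (\<Sum>i. hcontrib s (U (i + n))) < ennreal (\<delta> powr s)"
      by (auto simp: eventually_sequentially)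
    have "hausdorff_pre s \<delta> A \<le> (\<Sum>i. hcontrib s (U (i + n)))" if n: "N \<le> n" for n
    proof (rule hausdorff_pre_le)
      show "A \<subseteq> (\<Union>i. U (i + n))"
      proof
        fix x assume "x \<in> A"
        then have "infinite {i. x \<in> U i}" by (rule A)
        then obtain i where "n \<le> i" "x \<in> U i"
          by (metis infinite_nat_iff_unbounded_le mem_Collect_eq)
        then have "x \<in> U (i - n + n)" by simp
        then show "x \<in> (\<Union>i. U (i + n))" by blast
      qed
      show "diamT (U (i + n)) \<le> \<delta>" for i
      proof (rule ccontr)
        assume "\<not> diamT (U (i + n)) \<le> \<delta>"
        then have lt: "\<delta> < diamT (U (i + n))" by simp
        then have "ennreal (\<delta> powr s) \<le> hcontrib s (U (i + n))"
          using d assms(2) by (auto simp: hcontrib_def intro!: ennreal_leI powr_mono2)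
        also have "\<dots> \<le> (\<Sum>i. hcontrib s (U (i + n)))"
          using sum_le_suminf[of "\<lambda>i. hcontrib s (U (i + n))" "{i}"] by auto
        finally show False using N[OF n] by simp
      qed
    qed
    then show "\<exists>N. \<forall>n\<ge>N. hausdorff_pre s \<delta> A \<le> (\<Sum>i. hcontrib s (U (i + n)))" by blast
  qed
  then show ?thesis by (simp add: hausdorffT_def SUP_eq_const)
qed

text \<open>This plays the role of the mass distribution principle: a cover of the image of
  \<open>X\<close> under \<open>g\<close> is carried to intervals covering \<open>{0..1}\<close>,
  and subadditivity of Lebesgue measure bounds the sum from below. Working on codes in
  \<open>X\<close> makes \<open>h\<close> a function even where two codes name the same
  point.\<close>

lemma hausdorffT_pos_Hoelder:
  fixes g h :: "'a \<Rightarrow> real"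
  assumes s: "0 < s" and C: "0 < C"
    and hoelder: "\<And>b b'. b \<in> X \<Longrightarrow> b' \<in> X \<Longrightarrow> \<bar>h b - h b'\<bar> \<le> C * dT (g b) (g b') powr s"
    and surj: "{0..1} \<subseteq> h ` X"
  shows "0 < hausdorffT s (g ` X)"
proof -
  have "ennreal (1 / (2 * C)) \<le> hausdorff_pre s 1 (g ` X)"
  proof (rule hausdorff_pre_greatest)
    fix U :: "nat \<Rightarrow> real set"
    assume U: "g ` X \<subseteq> (\<Union>i. U i)"
    define V where "V i = {b \<in> X. g b \<in> U i}" for i
    \<comment> \<open>Centre of the interval: the \<open>h\<close>-value of an arbitrary code whose
      point lies in \<open>U i\<close>; the others lie within \<open>C * diamT (U i) powr s\<close>
      of it.\<close>
    define c where "c i = h (SOME b. b \<in> V i)" for i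
    define J where "J i = (if V i = {} then {} else
      {c i - C * diamT (U i) powr s .. c i + C * diamT (U i) powr s})" for i
    have hV: "h ` V i \<subseteq> J i" for i
    proof
      fix y assume "y \<in> h ` V i"
      then obtain b where b: "b \<in> V i" "y = h b" by blast
      have b0: "(SOME b. b \<in> V i) \<in> V i" using b(1) by (rule someI)
      then have "\<bar>h b - c i\<bar> \<le> C * dT (g b) (g (SOME b. b \<in> V i)) powr s"
        unfolding c_def using b(1) by (intro hoelder) (auto simp: V_def)
      also have "\<dots> \<le> C * diamT (U i) powr s"
        using b b0 C s
        by (intro mult_left_mono powr_mono2 diamT_ge dT_nonneg) (auto simp: V_def)
      finally show "y \<in> J i" using b by (auto simp: J_def)
    qed
    have "{0..1} \<subseteq> (\<Union>i. J i)"
    proof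
      fix y :: real assume "y \<in> {0..1}"
      then obtain b where b: "b \<in> X" "y = h b" using surj by blast
      then obtain i where "g b \<in> U i" using U by blast
      then have "y \<in> h ` V i" using b by (auto simp: V_def)
      then show "y \<in> (\<Union>i. J i)" using hV[of i] by blast
    qed
    then have "emeasure lborel {0..1::real} \<le> emeasure lborel (\<Union>i. J i)"
      by (intro emeasure_mono) (auto simp: J_def)
    also have "\<dots> \<le> (\<Sum>i. emeasure lborel (J i))"
      by (intro emeasure_subadditive_countably) (auto simp: J_def)
    also have "\<dots> \<le> (\<Sum>i. ennreal (2 * C) * hcontrib s (U i))"
    proof (rule suminf_le)
      fix i
      show "emeasure lborel (J i) \<le> ennreal (2 * C) * hcontrib s (U i)"
      proof (cases "V i = {}")
        case False
        then have "U i \<noteq> {}" by (auto simp: V_def)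
        then have "ennreal (2 * C) * hcontrib s (U i) = ennreal (2 * C * diamT (U i) powr s)"
          using s C by (simp add: hcontrib_def ennreal_mult)
        moreover have "emeasure lborel (J i) = ennreal (2 * C * diamT (U i) powr s)"
          using False C by (simp add: J_def mult_ac)
        ultimately show ?thesis by simp
      qed (simp add: J_def)
    qed auto
    also have "\<dots> = ennreal (2 * C) * (\<Sum>i. hcontrib s (U i))" by simp
    finally have "1 \<le> ennreal (2 * C) * (\<Sum>i. hcontrib s (U i))" by simp
    then have "ennreal (1 / (2 * C)) * 1
        \<le> ennreal (1 / (2 * C)) * (ennreal (2 * C) * (\<Sum>i. hcontrib s (U i)))"
      by (rule mult_left_mono) simp
    also have "\<dots> = (\<Sum>i. hcontrib s (U i))"
      using C by (simp add: mult.assoc[symmetric] ennreal_mult[symmetric])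
    finally show "ennreal (1 / (2 * C)) \<le> (\<Sum>i. hcontrib s (U i))" by simp
  qed
  moreover have "0 < ennreal (1 / (2 * C))" using C by simp
  ultimately have "0 < hausdorff_pre s 1 (g ` X)" by (rule less_le_trans[rotated])
  then show ?thesis
    using hausdorff_pre_le_hausdorffT[of 1 s "g ` X"] by simp
qed

lemma hausdorffT_antimono_exponent:
  assumes "0 \<le> s" "s \<le> t"
  shows "hausdorffT t A \<le> hausdorffT s A"
  unfolding hausdorffT_def
proof (rule SUP_mono)
  fix \<delta> :: real
  assume d: "\<delta> \<in> {0<..}"
  have "hausdorff_pre t \<delta> A \<le> hausdorff_pre s \<delta> A"
  proof (rule hausdorff_pre_greatest)
    fix U :: "nat \<Rightarrow> real set"
    assume "A \<subseteq> (\<Union>i. U i)" "\<And>i. diamT (U i) \<le> \<delta>"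
    then have "hausdorff_pre t \<delta> A \<le> (\<Sum>i. hcontrib t (U i))"
      by (rule hausdorff_pre_le)
    also have "\<dots> \<le> (\<Sum>i. hcontrib s (U i))"
      by (intro suminf_le hcontrib_antimono_exponent assms) auto
    finally show "hausdorff_pre t \<delta> A \<le> (\<Sum>i. hcontrib s (U i))" .
  qed
  then show "\<exists>\<epsilon>\<in>{0<..}. hausdorff_pre t \<delta> A \<le> hausdorff_pre s \<epsilon> A"
    using d by blast
qed

lemma dimH_eqI:
  assumes "0 \<le> d"
    and zero: "\<And>s. d < s \<Longrightarrow> hausdorffT s A = 0"
    and pos: "\<And>s. 0 \<le> s \<Longrightarrow> s < d \<Longrightarrow> 0 < hausdorffT s A"
  shows "dimH A = d"
  unfolding dimH_def
proof (rule cInf_eq)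
  fix s assume "s \<in> {s. 0 \<le> s \<and> hausdorffT s A = 0}"
  then show "d \<le> s" using pos[of s] by force
next
  fix y assume *: "\<And>s. s \<in> {s. 0 \<le> s \<and> hausdorffT s A = 0} \<Longrightarrow> y \<le> s"
  show "y \<le> d"
  proof (rule dense_ge)
    fix s assume "d < s"
    then show "y \<le> s" using assms(1) zero[of s] by (intro *) auto
  qed
qed

section \<open>Digit expansions and the Cantor set\<close>

text \<open>Allowing only the digits 0 and \<open>\<beta> - 1\<close> makes one definition serve
  twice: base 2 gives all of \<open>{0..1}\<close>, base 3 the Cantor set. The Hoelder map reads in
  base 2 the free digits of a base 3 code.\<close>

definition expansion :: "real \<Rightarrow> (nat \<Rightarrow> bool) \<Rightarrow> real" where
  "expansion \<beta> b = (\<Sum>i. (if b i then \<beta> - 1 else 0) / \<beta> ^ Suc i)"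

definition prefix_word :: "nat \<Rightarrow> (nat \<Rightarrow> bool) \<Rightarrow> bool list" where
  "prefix_word n b = map b [0..<n]"

lemma length_prefix_word [simp]: "length (prefix_word n b) = n"
  by (simp add: prefix_word_def)

lemma prefix_word_0 [simp]: "prefix_word 0 b = []"
  by (simp add: prefix_word_def)

lemma prefix_word_Suc: "prefix_word (Suc n) b = b 0 # prefix_word n (b \<circ> Suc)"
  unfolding prefix_word_def by (simp add: map_upt_Suc del: upt_Suc)

lemma prefix_word_eq_iff: "prefix_word n b = prefix_word n b' \<longleftrightarrow> (\<forall>i<n. b i = b' i)"
  by (auto simp: prefix_word_def)

lemma prefix_word_eq_mono:
  "prefix_word n b = prefix_word n b' \<Longrightarrow> m \<le> n \<Longrightarrow> prefix_word m b = prefix_word m b'"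
  by (auto simp: prefix_word_eq_iff)

lemma prefix_word_nth: "prefix_word (length w) (\<lambda>i. i < length w \<and> w ! i) = w"
  by (rule nth_equalityI) (auto simp: prefix_word_def)

context
  fixes \<beta> :: real
  assumes \<beta>: "1 < \<beta>"
begin

lemma sums_geometric_expansion: "(\<lambda>i. (\<beta> - 1) / \<beta> ^ Suc i) sums 1"
proof -
  have "(\<lambda>i. (1 / \<beta>) ^ i) sums (1 / (1 - 1 / \<beta>))"
    using \<beta> by (intro geometric_sums) auto
  from sums_mult[OF this, of "(\<beta> - 1) / \<beta>"] show ?thesis
    using \<beta> by (simp add: field_simps power_divide)
qed

lemma summable_expansion: "summable (\<lambda>i. (if b i then \<beta> - 1 else 0) / \<beta> ^ Suc i)"
  using \<beta> by (intro summable_comparison_test'[OF sums_summable[OF sums_geometric_expansion]]) auto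

lemma expansion_nonneg: "0 \<le> expansion \<beta> b"
  unfolding expansion_def using \<beta> by (intro suminf_nonneg summable_expansion) auto

lemma expansion_le_1: "expansion \<beta> b \<le> 1"
proof -
  have "expansion \<beta> b \<le> (\<Sum>i. (\<beta> - 1) / \<beta> ^ Suc i)"
    unfolding expansion_def using \<beta>
    by (intro suminf_le summable_expansion sums_summable[OF sums_geometric_expansion])
       (auto intro!: divide_right_mono)
  then show ?thesis using sums_unique[OF sums_geometric_expansion] by simp
qed

lemma expansion_Suc: "expansion \<beta> b = ((if b 0 then \<beta> - 1 else 0) + expansion \<beta> (b \<circ> Suc)) / \<beta>"
proof -
  have "expansion \<beta> b = (if b 0 then \<beta> - 1 else 0) / \<beta>
      + (\<Sum>i. (if b (Suc i) then \<beta> - 1 else 0) / \<beta> ^ Suc (Suc i))"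
    unfolding expansion_def by (subst suminf_split_head[OF summable_expansion]) simp
  also have "(\<Sum>i. (if b (Suc i) then \<beta> - 1 else 0) / \<beta> ^ Suc (Suc i)) = expansion \<beta> (b \<circ> Suc) / \<beta>"
    unfolding expansion_def using suminf_divide[OF summable_expansion, of "b \<circ> Suc" \<beta>]
    by (simp add: mult_ac)
  finally show ?thesis by (simp add: add_divide_distrib)
qed

lemma expansion_diff_le:
  "prefix_word n b = prefix_word n b' \<Longrightarrow> \<bar>expansion \<beta> b - expansion \<beta> b'\<bar> \<le> 1 / \<beta> ^ n"
proof (induction n arbitrary: b b')
  case 0
  show ?case
    using expansion_nonneg[of b] expansion_le_1[of b] expansion_nonneg[of b'] expansion_le_1[of b']
    by simp
next
  case (Suc n)
  then have "b 0 = b' 0" "prefix_word n (b \<circ> Suc) = prefix_word n (b' \<circ> Suc)"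
    by (auto simp: prefix_word_Suc)
  then have "expansion \<beta> b - expansion \<beta> b'
      = (expansion \<beta> (b \<circ> Suc) - expansion \<beta> (b' \<circ> Suc)) / \<beta>"
    by (simp only: expansion_Suc[of b] expansion_Suc[of b'] diff_divide_distrib[symmetric]
        \<open>b 0 = b' 0\<close> add_diff_cancel_left)
  then have "\<bar>expansion \<beta> b - expansion \<beta> b'\<bar>
      = \<bar>expansion \<beta> (b \<circ> Suc) - expansion \<beta> (b' \<circ> Suc)\<bar> / \<beta>"
    using \<beta> by (simp only: abs_divide)
  also have "\<dots> \<le> (1 / \<beta> ^ n) / \<beta>"
    using \<beta> by (intro divide_right_mono Suc.IH \<open>prefix_word n _ = _\<close>) simp
  finally show ?case by (simp add: mult.commute)
qed

text \<open>An inverse digit map that keeps \<open>S\<close> invariant can be iterated to read off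
  digits; the remainder after n steps is at most \<open>1 / \<beta> ^ n\<close>. Used with the unit
  interval in base 2 and the Cantor set in base 3.\<close>

lemma expansion_exists:
  assumes S: "S \<subseteq> {0..1}"
    and step: "\<And>x. x \<in> S \<Longrightarrow> \<exists>c::bool. \<exists>x'\<in>S. x = ((if c then \<beta> - 1 else 0) + x') / \<beta>"
    and x: "x \<in> S"
  shows "x \<in> range (expansion \<beta>)"
proof -
  from step obtain dg nx where
    nx: "\<And>x. x \<in> S \<Longrightarrow> nx x \<in> S \<and> x = ((if dg x then \<beta> - 1 else 0) + nx x) / \<beta>"
    by metis
  define b where "b i = dg ((nx ^^ i) x)" for i
  have it: "(nx ^^ n) x \<in> S" for n
    by (induction n) (use x nx in auto)
  have part: "(\<Sum>i<n. (if b i then \<beta> - 1 else 0) / \<beta> ^ Suc i) = x - (nx ^^ n) x / \<beta> ^ n" for n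
  proof (induction n)
    case (Suc n)
    have "(nx ^^ n) x / \<beta> ^ n = ((if b n then \<beta> - 1 else 0) + (nx ^^ Suc n) x) / \<beta> / \<beta> ^ n"
      using nx[OF it[of n]] by (simp add: b_def)
    also have "\<dots> = (if b n then \<beta> - 1 else 0) / \<beta> ^ Suc n + (nx ^^ Suc n) x / \<beta> ^ Suc n"
      by (simp add: add_divide_distrib)
    finally show ?case using Suc by simp
  qed simp
  have lim: "(\<lambda>n. 1 / \<beta> ^ n) \<longlonglongrightarrow> 0"
    using \<beta> LIMSEQ_realpow_zero[of "1 / \<beta>"] by (simp add: power_divide)
  have "(\<lambda>n. (nx ^^ n) x / \<beta> ^ n) \<longlonglongrightarrow> 0"
  proof (rule tendsto_sandwich[OF _ _ tendsto_const lim])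
    show "\<forall>\<^sub>F n in sequentially. 0 \<le> (nx ^^ n) x / \<beta> ^ n"
      using it S \<beta> by (intro always_eventually allI divide_nonneg_nonneg) fastforce+
    show "\<forall>\<^sub>F n in sequentially. (nx ^^ n) x / \<beta> ^ n \<le> 1 / \<beta> ^ n"
      using it S \<beta> by (intro always_eventually allI divide_right_mono) fastforce+
  qed
  then have "(\<lambda>n. x - (nx ^^ n) x / \<beta> ^ n) \<longlonglongrightarrow> x - 0"
    by (intro tendsto_intros)
  then have "(\<lambda>i. (if b i then \<beta> - 1 else 0) / \<beta> ^ Suc i) sums x"
    by (simp only: sums_def part diff_zero)
  then have "expansion \<beta> b = x" by (simp add: expansion_def sums_iff)
  then show ?thesis by blast
qed

end

lemma expansion_2_surj: "range (expansion 2) = {0..1}"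
proof
  show "range (expansion 2) \<subseteq> {0..1}"
    using expansion_nonneg[of 2] expansion_le_1[of 2] by auto
  show "{0..1} \<subseteq> range (expansion 2)"
  proof
    fix x :: real assume x: "x \<in> {0..1}"
    show "x \<in> range (expansion 2)"
    proof (rule expansion_exists[OF _ order_refl _ x])
      fix x :: real assume x: "x \<in> {0..1}"
      show "\<exists>c. \<exists>x'\<in>{0..1}. x = ((if c then 2 - 1 else 0) + x') / 2"
      proof (cases "x \<le> 1/2")
        case True
        then show ?thesis using x by (intro exI[of _ False] bexI[of _ "2 * x"]) auto
      next
        case False
        then show ?thesis using x by (intro exI[of _ True] bexI[of _ "2 * x - 1"]) auto
      qed
    qed simp
  qed
qed

section \<open>Cylinders of the Cantor set\<close>

text \<open>The composite of the two Cantor contractions along the word, outermost letter first, so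
  that prefixes give enclosing cylinders.\<close>

primrec branch :: "bool list \<Rightarrow> real \<Rightarrow> real" where
  "branch [] x = x"
| "branch (c # w) x = (if c then 2/3 else 0) + branch w x / 3"

lemma branch_append: "branch (u @ v) x = branch u (branch v x)"
  by (induction u) auto

lemma branch_affine: "branch w x = branch w 0 + x / 3 ^ length w"
proof (induction w)
  case (Cons c w)
  then have "branch w x / 3 = branch w 0 / 3 + x / 3 ^ length (c # w)"
    by (simp only: add_divide_distrib) simp
  then show ?case by simp
qed simp

lemma branch_in_unit: "x \<in> {0..1} \<Longrightarrow> branch w x \<in> {0..1}"
  by (induction w) auto

lemma branch_image_unit: "branch w ` {0..1} = {branch w 0 .. branch w 0 + 1 / 3 ^ length w}"
proof -
  have "branch w ` {0..1} = (\<lambda>x. (1 / 3 ^ length w) * x + branch w 0) ` {0..1}"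
    by (rule image_cong) (simp, subst branch_affine, simp)
  also have "\<dots> = {branch w 0 .. branch w 0 + 1 / 3 ^ length w}"
    by (subst image_affinity_atLeastAtMost) (auto simp: add.commute)
  finally show ?thesis .
qed

lemma branch_diff_le:
  assumes "x \<in> {0..1}" "y \<in> {0..1}"
  shows "\<bar>branch w x - branch w y\<bar> \<le> 1 / 3 ^ length w"
proof -
  have "\<bar>branch w x - branch w y\<bar> = \<bar>x - y\<bar> / 3 ^ length w"
    using branch_affine[of w x] branch_affine[of w y]
    by (simp add: diff_divide_distrib[symmetric])
  also have "\<dots> \<le> 1 / 3 ^ length w"
    using assms by (intro divide_right_mono) auto
  finally show ?thesis .
qed

text \<open>At the first letter where the words differ, a removed middle third separates the images;
  it has length \<open>1 / 3 ^ Suc k\<close> when \<open>k\<close> letters agree, hence at least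
  \<open>1 / 3 ^ length w\<close>.\<close>

lemma branch_separated:
  assumes "x \<in> {0..1}" "y \<in> {0..1}"
  shows "length w = length v \<Longrightarrow> w \<noteq> v \<Longrightarrow> 1 / 3 ^ length w \<le> \<bar>branch w x - branch v y\<bar>"
proof (induction w v rule: list_induct2')
  case (4 c w d v)
  have *: "branch w x \<in> {0..1}" "branch v y \<in> {0..1}"
    using assms by (blast intro: branch_in_unit)+
  have le: "1 / (3 * 3 ^ length w) \<le> (1/3::real)" by (simp add: field_simps)
  show ?case
  proof (cases "c = d")
    case True
    then have "1 / 3 ^ length w \<le> \<bar>branch w x - branch v y\<bar>" using 4 by auto
    then have "1 / (3 * 3 ^ length w) \<le> \<bar>branch w x - branch v y\<bar> / 3"
      by (simp add: field_simps)
    moreover have "\<bar>branch w x - branch v y\<bar> / 3 = \<bar>branch (c # w) x - branch (d # v) y\<bar>"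
    proof -
      have "branch (c # w) x - branch (d # v) y = (branch w x - branch v y) / 3"
        by (simp add: True diff_divide_distrib)
      then show ?thesis by (simp only: abs_divide)
    qed
    ultimately show ?thesis by simp
  next
    case False
    then have "1/3 \<le> \<bar>branch (c # w) x - branch (d # v) y\<bar>"
      using * by (cases c; cases d) auto
    moreover have "1 / 3 ^ length (c # w) \<le> (1/3::real)" using le by simp
    ultimately show ?thesis by linarith
  qed
qed auto

lemma cantor_step_eq: "cantor_step n = (\<Union>w\<in>{w. length w = n}. branch w ` {0..1})"
proof (induction n)
  case (Suc n)
  show ?case
  proof
    show "cantor_step (Suc n) \<subseteq> (\<Union>w\<in>{w. length w = Suc n}. branch w ` {0..1})"
    proof
      fix x assume "x \<in> cantor_step (Suc n)"
      then obtain y where y: "y \<in> cantor_step n" and "x = y / 3 \<or> x = 2/3 + y / 3"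
        by auto
      then obtain c where x: "x = (if c then 2/3 else 0) + y / 3"
        by (metis add_0)
      from y obtain w t where w: "length w = n" "t \<in> {0..1}" "y = branch w t"
        unfolding Suc by blast
      with x have "length (c # w) = Suc n" "x = branch (c # w) t" by simp_all
      then show "x \<in> (\<Union>w\<in>{w. length w = Suc n}. branch w ` {0..1})"
        using w(2) by blast
    qed
    show "(\<Union>w\<in>{w. length w = Suc n}. branch w ` {0..1}) \<subseteq> cantor_step (Suc n)"
    proof
      fix x assume "x \<in> (\<Union>w\<in>{w. length w = Suc n}. branch w ` {0..1})"
      then obtain w t where w: "length w = Suc n" "t \<in> {0..1}" "x = branch w t" by blast
      then obtain c v where v: "w = c # v" "length v = n" by (cases w) auto
      then have "branch v t \<in> cantor_step n" using Suc w(2) by blast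
      then show "x \<in> cantor_step (Suc n)"
        using v w(3) by (cases c) simp_all
    qed
  qed
qed simp

lemma cantor_step_subset: "cantor_step n \<subseteq> {0..1}"
  unfolding cantor_step_eq by (intro UN_least image_subsetI branch_in_unit)

lemma cantor_set_subset: "cantor_set \<subseteq> {0..1}"
  unfolding cantor_set_def by (rule INF_lower2[of 0]) simp_all

lemma expansion_3_branch:
  "expansion 3 b = branch (prefix_word n b) (expansion 3 (\<lambda>i. b (i + n)))"
proof (induction n arbitrary: b)
  case (Suc n)
  have "expansion 3 b = (if b 0 then 2/3 else 0) + expansion 3 (b \<circ> Suc) / 3"
    by (subst expansion_Suc) (auto simp: add_divide_distrib)
  also have "expansion 3 (b \<circ> Suc) = branch (prefix_word n (b \<circ> Suc)) (expansion 3 (\<lambda>i. b (Suc (i + n))))"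
    by (subst Suc) (simp add: comp_def)
  finally show ?case by (simp add: prefix_word_Suc)
qed simp

lemma expansion_unit: "expansion 3 b \<in> {0..1}"
  using expansion_nonneg[of 3 b] expansion_le_1[of 3 b] by simp

lemma cantor_set_eq_range: "cantor_set = range (expansion 3)"
proof
  show "range (expansion 3) \<subseteq> cantor_set"
  proof clarify
    fix b
    have "expansion 3 b \<in> cantor_step n" for n
      using expansion_3_branch[of b n] expansion_unit by (force simp: cantor_step_eq)
    then show "expansion 3 b \<in> cantor_set" by (simp add: cantor_set_def)
  qed
  show "cantor_set \<subseteq> range (expansion 3)"
  proof
    fix x assume x: "x \<in> cantor_set"
    show "x \<in> range (expansion 3)"
    proof (rule expansion_exists[OF _ cantor_set_subset _ x])
      fix x assume "x \<in> cantor_set"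
      then have step: "x \<in> cantor_step (Suc n)" for n by (simp only: cantor_set_def INT_iff UNIV_I)
      have cases: "\<exists>y\<in>cantor_step n. x = y / 3 \<or> x = 2/3 + y / 3" for n
        using step[of n] by auto
      show "\<exists>c. \<exists>x'\<in>cantor_set. x = ((if c then 3 - 1 else 0) + x') / 3"
      \<comment> \<open>The side of 1/3 on which \<open>x\<close> lies selects the branch for all
        \<open>n\<close> at once, so one and the same preimage lies in every
        \<open>cantor_step n\<close>.\<close>
      proof (cases "x \<le> 1/3")
        case True
        have "3 * x \<in> cantor_step n" for n
        proof -
          from cases[of n] obtain y where y: "y \<in> cantor_step n" "x = y / 3 \<or> x = 2/3 + y / 3" by blast
          with True cantor_step_subset[of n] have "3 * x = y" by force
          then show ?thesis using y True by auto
        qed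
        then show ?thesis
          by (intro exI[of _ False] bexI[of _ "3 * x"]) (auto simp: cantor_set_def)
      next
        case False
        have "3 * x - 2 \<in> cantor_step n" for n
        proof -
          from cases[of n] obtain y where y: "y \<in> cantor_step n" "x = y / 3 \<or> x = 2/3 + y / 3" by blast
          then have "y \<le> 1" using cantor_step_subset[of n] by auto
          with y False have "3 * x - 2 = y" by auto
          then show ?thesis using y by simp
        qed
        then show ?thesis
          by (intro exI[of _ True] bexI[of _ "3 * x - 2"]) (auto simp: cantor_set_def)
      qed
    qed simp
  qed
qed

lemma expansion_in_cantor_set: "expansion 3 b \<in> cantor_set"
  by (simp add: cantor_set_eq_range)

lemma branch_cantor_set: "x \<in> cantor_set \<Longrightarrow> branch w x \<in> cantor_set"
proof (induction w)
  case (Cons c w)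
  then obtain b where b: "branch w x = expansion 3 b" by (auto simp: cantor_set_eq_range)
  have "expansion 3 (case_nat c b) = (if c then 2/3 else 0) + expansion 3 b / 3"
    by (subst expansion_Suc) (auto simp: add_divide_distrib comp_def)
  then show ?case using b expansion_in_cantor_set[of "case_nat c b"] by simp
qed simp

lemma cantor_set_eq_UN_branch: "cantor_set = (\<Union>w\<in>{w. length w = n}. branch w ` cantor_set)"
proof
  show "cantor_set \<subseteq> (\<Union>w\<in>{w. length w = n}. branch w ` cantor_set)"
  proof
    fix x assume "x \<in> cantor_set"
    then obtain b where "x = expansion 3 b" by (auto simp: cantor_set_eq_range)
    then have "x = branch (prefix_word n b) (expansion 3 (\<lambda>i. b (i + n)))"
      using expansion_3_branch by simp
    then show "x \<in> (\<Union>w\<in>{w. length w = n}. branch w ` cantor_set)"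
      using expansion_in_cantor_set length_prefix_word by blast
  qed
  show "(\<Union>w\<in>{w. length w = n}. branch w ` cantor_set) \<subseteq> cantor_set"
    using branch_cantor_set by blast
qed


lemma cantor_set_close_branch:
  assumes "x \<in> cantor_set" "y \<in> cantor_set" "\<bar>x - y\<bar> < 1 / 3 ^ n"
    and "x \<in> branch w ` cantor_set" "length w = n"
  shows "y \<in> branch w ` cantor_set"
proof -
  obtain v where v: "length v = n" "y \<in> branch v ` cantor_set"
    using subsetD[OF equalityD1[OF cantor_set_eq_UN_branch[of n]] assms(2)] by blast
  obtain s t where st: "s \<in> cantor_set" "t \<in> cantor_set" "x = branch w s" "y = branch v t"
    using assms(4) v by blast
  have "w = v"
  proof (rule ccontr)
    assume "w \<noteq> v"
    then have "1 / 3 ^ length w \<le> \<bar>branch w s - branch v t\<bar>"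
      using st cantor_set_subset v(1) assms(5) by (intro branch_separated) auto
    then show False using assms(3,5) st by simp
  qed
  then show ?thesis using v by simp
qed

lemma prefix_word_eqI:
  assumes "\<bar>expansion 3 b - expansion 3 b'\<bar> < 1 / 3 ^ n"
  shows "prefix_word n b = prefix_word n b'"
proof (rule ccontr)
  assume "\<not> ?thesis"
  then have "1 / 3 ^ length (prefix_word n b) \<le> \<bar>expansion 3 b - expansion 3 b'\<bar>"
    unfolding expansion_3_branch[of b n] expansion_3_branch[of b' n]
    by (intro branch_separated expansion_unit) auto
  then show False using assms by simp
qed

lemma compact_cantor_set: "compact cantor_set"
proof -
  have "compact (cantor_step n)" for n
    by (induction n) (auto intro!: compact_Un compact_continuous_image continuous_intros)
  then show ?thesis unfolding cantor_set_def
    by (intro compact_Inter) auto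
qed

lemma sets_branch_cantor_set [measurable]: "branch w ` cantor_set \<in> sets borel"
proof -
  have "continuous_on cantor_set (branch w)"
    by (rule continuous_on_eq[of _ "\<lambda>x. branch w 0 + x / 3 ^ length w"])
       (intro continuous_intros, simp_all flip: branch_affine)
  then show ?thesis
    using compact_cantor_set by (intro borel_compact compact_continuous_image)
qed

lemma card_words: "card {w :: bool list. length w = n} = 2 ^ n"
  using card_lists_length_eq[of "UNIV :: bool set" n] by simp

lemma finite_words [simp]: "finite {w :: bool list. length w = n}"
  using finite_lists_length_eq[of "UNIV :: bool set" n] by simp

text \<open>\<open>frac\<close> fixes the Cantor set apart from the endpoint 1, which it sends to
  the point 0 already present.\<close>

lemma K_eq: "K = cantor_set - {1}"
proof -
  have 0: "0 \<in> cantor_set"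
    using expansion_in_cantor_set[of "\<lambda>_. False"] by (simp add: expansion_def)
  show ?thesis
  proof (intro set_eqI iffI)
    fix x assume "x \<in> K"
    then obtain y where y: "y \<in> cantor_set" "x = frac y" by (auto simp: K_def)
    show "x \<in> cantor_set - {1}"
    proof (cases "y = 1")
      case False
      then have "frac y = y" using y cantor_set_subset by (subst frac_eq) fastforce
      then show ?thesis using y False by simp
    qed (use y 0 in simp)
  next
    fix x assume x: "x \<in> cantor_set - {1}"
    then have "frac x = x" using cantor_set_subset by (subst frac_eq) fastforce
    then show "x \<in> K" using x by (force simp: K_def)
  qed
qed

lemma K_subset_torus: "K \<subseteq> torus"
  using cantor_set_subset by (fastforce simp: K_eq torus_def)

section \<open>The Hausdorff measure on the Cantor set\<close>

lemma kappa_pos: "0 < kappa" and kappa_less_1: "kappa < 1"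
  by (simp_all add: kappa_def)

lemma powr_3_kappa: "3 powr (kappa * x) = 2 powr x"
  by (simp add: powr_def kappa_def)

lemma inverse_3_power_powr_kappa: "(1 / 3 ^ n) powr kappa = 1 / 2 ^ n"
proof -
  have "(1 / 3 ^ n :: real) powr kappa = 3 powr (kappa * - real n)"
    by (simp add: powr_minus_divide powr_divide powr_powr mult.commute flip: powr_realpow)
  also have "\<dots> = 1 / 2 ^ n"
    by (simp only: powr_3_kappa) (simp add: powr_minus_divide powr_realpow)
  finally show ?thesis .
qed

text \<open>\<open>G\<close> turns free digits \<open>b\<close> into the ternary code of a point,
  and \<open>m\<close> digits of the code must determine \<open>r\<close> free ones. The inequality
  then says \<open>1 / 2 ^ r \<le> 2 * (1 / 3 ^ m) powr s\<close>, a Hoelder estimate of exponent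
  \<open>s\<close>; the \<open>+ 1\<close> is paid by the factor 2. A first digit 0 keeps all points
  in \<open>{0..1/3}\<close>, where the torus metric is the ordinary one.\<close>

lemma hausdorffT_pos_coded:
  assumes s: "0 < s"
    and code: "\<And>m. \<exists>r. s * real m \<le> kappa * (real r + 1) \<and>
      (\<forall>b b'. prefix_word m (G b) = prefix_word m (G b') \<longrightarrow> prefix_word r b = prefix_word r b')"
    and G0: "\<And>b. \<not> G b 0"
  shows "0 < hausdorffT s (range (\<lambda>b. expansion 3 (G b)))"
proof (rule hausdorffT_pos_Hoelder)
  show "{0..1} \<subseteq> range (expansion 2)" using expansion_2_surj by simp
  fix b b' :: "nat \<Rightarrow> bool"
  define D where "D = \<bar>expansion 3 (G b) - expansion 3 (G b')\<bar>"
  have third: "expansion 3 (G b) \<in> {0..1/3}" for b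
    using expansion_unit[of "G b \<circ> Suc"] expansion_Suc[of 3 "G b"] G0[of b] by simp
  have D: "D \<le> 1/3" "0 \<le> D"
    using third[of b] third[of b'] unfolding D_def atLeastAtMost_iff by linarith+
  then have dT: "dT (expansion 3 (G b)) (expansion 3 (G b')) = D"
    unfolding D_def by (intro dT_eq_abs) auto
  have key: "\<bar>expansion 2 b - expansion 2 b'\<bar> \<le> 2 * (1 / 3 ^ m) powr s" if "D < 1 / 3 ^ m" for m
  proof -
    have "prefix_word m (G b) = prefix_word m (G b')"
      using that by (intro prefix_word_eqI) (simp add: D_def)
    with code[of m] obtain r where r: "s * real m \<le> kappa * (real r + 1)"
      "prefix_word r b = prefix_word r b'" by blast
    have "\<bar>expansion 2 b - expansion 2 b'\<bar> \<le> 1 / 2 ^ r"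
      using r(2) by (intro expansion_diff_le) auto
    also have "1 / 2 ^ r = 2 * 2 powr - (real r + 1)"
      by (simp add: powr_add powr_minus_divide powr_realpow powr_diff)
    also have "2 powr - (real r + 1) = 3 powr (kappa * - (real r + 1))"
      by (simp only: powr_3_kappa)
    also have "\<dots> \<le> 3 powr - (s * real m)"
      using r(1) by (intro powr_mono) (auto simp: algebra_simps)
    also have "\<dots> = (1 / 3 ^ m) powr s"
      by (simp add: powr_minus_divide powr_divide powr_powr mult.commute flip: powr_realpow)
    finally show ?thesis by simp
  qed
  show "\<bar>expansion 2 b - expansion 2 b'\<bar>
      \<le> (2 * 3 powr s) * dT (expansion 3 (G b)) (expansion 3 (G b')) powr s"
  proof (cases "D = 0")
    case True
    \<comment> \<open>Two codes of the same point: \<open>key\<close> applies for every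
      \<open>m\<close>, and the limit shows that their binary values coincide.\<close>
    have "(\<lambda>m. 2 * (1 / 3 ^ m :: real) powr s) \<longlonglongrightarrow> 2 * 0 powr s"
      using LIMSEQ_realpow_zero[of "1/3 :: real"] s
      by (intro tendsto_intros) (auto simp: power_divide)
    then have "\<bar>expansion 2 b - expansion 2 b'\<bar> \<le> 2 * 0 powr s"
      by (rule LIMSEQ_le_const) (use key True in auto)
    then show ?thesis using True dT by simp
  next
    case False
    then have "0 < D" using D by simp
    then obtain k0 where k0: "(1 / 3) ^ k0 < D" using real_arch_pow_inv[of D "1/3"] by auto
    \<comment> \<open>The least \<open>k\<close> exists and is positive because
      \<open>0 < D \<le> 1/3\<close>; with \<open>m = k - 1\<close> one gets
      \<open>1 / 3 ^ Suc m \<le> D < 1 / 3 ^ m\<close>, whence the constant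
      \<open>3 powr s\<close>.\<close>
    define k where "k = (LEAST k. 1 / 3 ^ k \<le> D)"
    have k: "1 / 3 ^ k \<le> D"
      unfolding k_def by (rule LeastI[of _ k0]) (use k0 in \<open>simp add: power_divide\<close>)
    have "k \<noteq> 0" using k D by (intro notI) simp
    then obtain m where m: "k = Suc m" by (cases k) auto
    have "\<not> 1 / 3 ^ m \<le> D"
      using not_less_Least[of m "\<lambda>k. 1 / 3 ^ k \<le> D"] m by (simp add: k_def)
    then have "\<bar>expansion 2 b - expansion 2 b'\<bar> \<le> 2 * (1 / 3 ^ m) powr s"
      by (intro key) simp
    also have "\<dots> \<le> 2 * (3 * D) powr s"
      using k s by (intro mult_left_mono powr_mono2) (auto simp: m)
    finally show ?thesis using D by (simp add: dT powr_mult)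
  qed
qed (use s in auto)

text \<open>The forced first digit costs one place, exactly the loss that the \<open>+ 1\<close> in
  \<open>hausdorffT_pos_coded\<close> tolerates.\<close>

lemma hausdorffT_kappa_K_pos: "0 < hausdorffT kappa K"
proof -
  have "0 < hausdorffT kappa (range (\<lambda>b. expansion 3 (case_nat False b)))"
  proof (rule hausdorffT_pos_coded[OF kappa_pos])
    fix m
    have "prefix_word (m - 1) b = prefix_word (m - 1) b'"
      if "prefix_word m (case_nat False b) = prefix_word m (case_nat False b')" for b b'
      using that by (cases m) (auto simp: prefix_word_Suc comp_def)
    then show "\<exists>r. kappa * real m \<le> kappa * (real r + 1) \<and>
       (\<forall>b b'. prefix_word m (case_nat False b) = prefix_word m (case_nat False b') \<longrightarrow>
          prefix_word r b = prefix_word r b')"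
      using kappa_pos by (intro exI[of _ "m - 1"] conjI allI impI mult_left_mono) (blast | simp)+
  qed simp
  also have "\<dots> \<le> hausdorffT kappa K"
  proof (rule hausdorffT_mono)
    show "range (\<lambda>b. expansion 3 (case_nat False b)) \<subseteq> K"
    proof clarify
      fix b
      have "expansion 3 (case_nat False b) \<le> 1/3"
        using expansion_unit[of b] by (subst expansion_Suc) (simp_all add: comp_def)
      then show "expansion 3 (case_nat False b) \<in> K"
        using expansion_in_cantor_set[of "case_nat False b"] by (simp add: K_eq)
    qed
  qed
  finally show ?thesis .
qed

lemma diamT_branch_le:
  assumes "X \<subseteq> {0..1}"
  shows "diamT (branch w ` X) \<le> 1 / 3 ^ length w"
proof (rule diamT_le)
  fix x y assume "x \<in> branch w ` X" "y \<in> branch w ` X"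
  then obtain s t where "s \<in> {0..1}" "t \<in> {0..1}" "x = branch w s" "y = branch w t"
    using assms by blast
  then show "dT x y \<le> 1 / 3 ^ length w"
    using branch_diff_le[of s t w] dT_le_abs[of x y] by simp
qed simp

lemma ex_inverse_3_power_le:
  assumes "0 < (\<delta>::real)"
  shows "\<exists>m. \<forall>n\<ge>m. 1 / 3 ^ n \<le> \<delta>"
proof -
  obtain m where m: "(1/3) ^ m < \<delta>" using real_arch_pow_inv[OF assms, of "1/3"] by auto
  have "1 / 3 ^ n \<le> \<delta>" if "m \<le> n" for n
    using power_decreasing[OF that, of "1/3::real"] m by (simp add: power_divide)
  then show ?thesis by blast
qed

text \<open>Refining by \<open>m\<close> generations multiplies the number of pieces by
  \<open>2 ^ m\<close> and divides the bound on each contribution by \<open>2 ^ m\<close>, as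
  \<open>3 powr kappa = 2\<close>; so arbitrarily fine covers obey the same total bound.\<close>

lemma hausdorffT_kappa_branch_le:
  "hausdorffT kappa (branch w ` cantor_set) \<le> ennreal (1 / 2 ^ length w)"
proof (rule hausdorffT_le_finite_covers)
  fix \<delta> :: real assume "0 < \<delta>"
  then obtain m where m: "\<And>n. m \<le> n \<Longrightarrow> 1 / 3 ^ n \<le> \<delta>" using ex_inverse_3_power_le by blast
  define I where "I = {v :: bool list. length v = m}"
  define F where "F = (\<lambda>v. branch (w @ v) ` cantor_set) ` I"
  have I: "finite I" "card I = 2 ^ m" by (simp_all add: I_def card_words)
  have diam: "diamT (branch (w @ v) ` cantor_set) \<le> 1 / 3 ^ (length w + m)" if "v \<in> I" for v
    using that diamT_branch_le[OF cantor_set_subset, of "w @ v"] by (simp add: I_def)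
  have "branch w ` cantor_set = \<Union>F"
  proof -
    have "branch w ` cantor_set = branch w ` (\<Union>v\<in>I. branch v ` cantor_set)"
      unfolding I_def by (subst cantor_set_eq_UN_branch[of m]) (rule refl)
    then show ?thesis by (simp add: F_def image_UN image_comp comp_def branch_append)
  qed
  moreover have "(\<Sum>U\<in>F. hcontrib kappa U) \<le> ennreal (1 / 2 ^ length w)"
  proof -
    have "(\<Sum>U\<in>F. hcontrib kappa U) \<le> (\<Sum>v\<in>I. hcontrib kappa (branch (w @ v) ` cantor_set))"
      unfolding F_def using I(1) sum_image_le[of I "hcontrib kappa" "\<lambda>v. branch (w @ v) ` cantor_set"]
      by (simp add: comp_def)
    also have "\<dots> \<le> (\<Sum>v\<in>I. ennreal ((1 / 3 ^ (length w + m)) powr kappa))"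
      by (intro sum_mono hcontrib_le kappa_pos diam)
    also have "\<dots> = (\<Sum>v\<in>I. ennreal (1 / 2 ^ (length w + m)))"
      by (simp only: inverse_3_power_powr_kappa)
    also have "\<dots> = ennreal (real (card I)) * ennreal (1 / 2 ^ (length w + m))"
      by (simp add: ennreal_of_nat_eq_real_of_nat)
    also have "\<dots> = ennreal (2 ^ m * (1 / 2 ^ (length w + m)))"
      by (subst ennreal_mult[symmetric]) (simp_all add: I)
    also have "2 ^ m * (1 / 2 ^ (length w + m)) = (1 / 2 ^ length w :: real)"
      by (simp add: power_add)
    finally show ?thesis .
  qed
  ultimately show "\<exists>F. finite F \<and> branch w ` cantor_set \<subseteq> \<Union>F \<and> (\<forall>U\<in>F. diamT U \<le> \<delta>) \<and>
      (\<Sum>U\<in>F. hcontrib kappa U) \<le> ennreal (1 / 2 ^ length w)"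
    using I(1) order_trans[OF diam m[OF le_add2]]
    by (intro exI[of _ F] conjI) (simp_all add: F_def)
qed

text \<open>A set of spread below \<open>1 / 3 ^ n\<close> cannot reach across a gap between
  cylinders of generation \<open>n\<close>, so it lies in a single one.\<close>

lemma hausdorffT_kappa_small:
  assumes "S \<subseteq> cantor_set" "\<And>x y. x \<in> S \<Longrightarrow> y \<in> S \<Longrightarrow> \<bar>x - y\<bar> < 1 / 3 ^ n"
  shows "hausdorffT kappa S \<le> ennreal (1 / 2 ^ n)"
proof (cases "S = {}")
  case False
  then obtain x where x: "x \<in> S" by blast
  then obtain w where w: "length w = n" "x \<in> branch w ` cantor_set"
    using assms(1) subsetD[OF equalityD1[OF cantor_set_eq_UN_branch[of n]], of x] by blast
  have "S \<subseteq> branch w ` cantor_set"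
    using cantor_set_close_branch[OF _ _ assms(2)[OF x] w(2,1)] assms(1) x by blast
  then have "hausdorffT kappa S \<le> hausdorffT kappa (branch w ` cantor_set)"
    by (rule hausdorffT_mono)
  then show ?thesis using hausdorffT_kappa_branch_le[of w] w(1) by simp
qed simp

lemma hausdorffT_kappa_K_finite: "hausdorffT kappa K < \<infinity>"
proof -
  have "hausdorffT kappa K \<le> hausdorffT kappa (branch [] ` cantor_set)"
    by (rule hausdorffT_mono) (auto simp: K_eq)
  also have "\<dots> \<le> 1" using hausdorffT_kappa_branch_le[of "[]"] by simp
  finally show ?thesis by (simp add: order_le_less_trans)
qed

lemma hausdorffT_singleton: "0 < s \<Longrightarrow> hausdorffT s {x} = 0"
  by (rule hausdorffT_limsup_eq_0[of s "\<lambda>_. {x}"]) (auto simp: hcontrib_def diamT_def)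

lemma outer_measure_space_restrict:
  assumes "outer_measure_space UNIV f"
  shows "outer_measure_space UNIV (\<lambda>A. f (A \<inter> S))"
  unfolding outer_measure_space_def positive_def increasing_def countably_subadditive_def
proof (intro conjI ballI allI impI)
  show "f ({} \<inter> S) = 0" using assms by (simp add: outer_measure_space_def positive_def)
next
  fix A B :: "'a set" assume "A \<subseteq> B"
  then have "A \<inter> S \<subseteq> B \<inter> S" by blast
  then show "f (A \<inter> S) \<le> f (B \<inter> S)"
    using assms unfolding outer_measure_space_def increasing_def by blast
next
  fix A :: "nat \<Rightarrow> 'a set" assume "disjoint_family A"
  then have "disjoint_family (\<lambda>i. A i \<inter> S)" by (auto simp: disjoint_family_on_def)
  then have "f (\<Union>i. A i \<inter> S) \<le> (\<Sum>i. f (A i \<inter> S))"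
    using assms by (simp add: outer_measure_space_def countably_subadditive_def del: UN_simps)
  then show "f ((\<Union>i. A i) \<inter> S) \<le> (\<Sum>i. f (A i \<inter> S))" by simp
qed

text \<open>Away from a neighbourhood of \<open>a\<close> and of the gluing point \<open>1 = 0\<close>, the parts of \<open>K\<close> to the
  left and to the right of \<open>a\<close> have positive distance; both neighbourhoods have small measure.\<close>

lemma hausdorffT_kappa_split:
  "hausdorffT kappa ({..<a} \<inter> A \<inter> K) + hausdorffT kappa (- {..<a} \<inter> A \<inter> K)
    \<le> hausdorffT kappa (A \<inter> K)" (is "?L + ?R \<le> ?T")
proof (rule ennreal_le_epsilon)
  fix e :: real
  assume e: "0 < e"
  have "0 < e / 2" using e by simp
  obtain n where n: "1 / 2 ^ n < e / 2"
    using real_arch_pow_inv[OF \<open>0 < e / 2\<close>, of "1/2"] by (auto simp: power_divide)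
  define d :: real where "d = 1 / 3 ^ n"
  have d: "0 < d" by (simp add: d_def)
  define L where "L = {x \<in> A \<inter> K. x < a - d}"
  define R where "R = {x \<in> A \<inter> K. a \<le> x \<and> x < 1 - d}"
  define L' where "L' = {x \<in> K. a - d \<le> x \<and> x < a}"
  define R' where "R' = {x \<in> K. 1 - d \<le> x \<and> x < 1}"
  have K: "0 \<le> x" "x < 1" "x \<in> cantor_set" if "x \<in> K" for x
    using that K_subset_torus by (auto simp: torus_def K_eq)
  have "?L \<le> hausdorffT kappa (L \<union> L')"
    by (rule hausdorffT_mono) (auto simp: L_def L'_def)
  also have "\<dots> \<le> hausdorffT kappa L + hausdorffT kappa L'" by (rule hausdorffT_subadditive)
  also have "hausdorffT kappa L' \<le> ennreal (1 / 2 ^ n)"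
    using K by (intro hausdorffT_kappa_small) (auto simp: L'_def d_def abs_if)
  finally have L: "?L \<le> hausdorffT kappa L + ennreal (1 / 2 ^ n)" by (simp add: add_left_mono)
  have "?R \<le> hausdorffT kappa (R \<union> R')"
    using K(2) by (intro hausdorffT_mono) (auto simp: R_def R'_def)
  also have "\<dots> \<le> hausdorffT kappa R + hausdorffT kappa R'" by (rule hausdorffT_subadditive)
  also have "hausdorffT kappa R' \<le> ennreal (1 / 2 ^ n)"
    using K by (intro hausdorffT_kappa_small) (auto simp: R'_def d_def abs_if)
  finally have R: "?R \<le> hausdorffT kappa R + ennreal (1 / 2 ^ n)" by (simp add: add_left_mono)
  have "hausdorffT kappa L + hausdorffT kappa R \<le> hausdorffT kappa (L \<union> R)"
  proof (rule hausdorffT_separated[OF d])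
    fix x y assume "x \<in> L" "y \<in> R"
    then show "d \<le> dT x y" using K(1)[of x] K(1)[of y] by (intro dT_ge) (auto simp: L_def R_def)
  qed (use kappa_pos in simp)
  also have "\<dots> \<le> ?T" by (rule hausdorffT_mono) (auto simp: L_def R_def)
  finally have LR: "hausdorffT kappa L + hausdorffT kappa R \<le> ?T" .
  have "?L + ?R \<le> (hausdorffT kappa L + ennreal (1 / 2 ^ n)) + (hausdorffT kappa R + ennreal (1 / 2 ^ n))"
    by (rule add_mono[OF L R])
  also have "\<dots> = (hausdorffT kappa L + hausdorffT kappa R) + (ennreal (1 / 2 ^ n) + ennreal (1 / 2 ^ n))"
    by (simp only: ac_simps)
  also have "\<dots> \<le> ?T + ennreal e"
    using n by (intro add_mono LR) (auto simp flip: ennreal_plus intro!: ennreal_leI)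
  finally show "?L + ?R \<le> ?T + ennreal e" .
qed

text \<open>\<open>measure_of\<close> returns the zero measure unless its function is countably
  additive, so this is what gives \<open>muK\<close> content. By Caratheodory, only the generating
  half-lines have to split every set additively.\<close>

lemma measure_space_hausdorffT_K:
  "measure_space UNIV (sets borel) (\<lambda>A. hausdorffT kappa (A \<inter> K))"
proof -
  let ?f = "\<lambda>A. hausdorffT kappa (A \<inter> K)"
  let ?L = "lambda_system UNIV UNIV ?f"
  have "sigma_algebra (UNIV :: real set) UNIV"
    using sigma_algebra_Pow[of "UNIV :: real set"] by simp
  from sigma_algebra.caratheodory_lemma[OF this
      outer_measure_space_restrict[OF outer_measure_space_hausdorffT]]
  have L: "measure_space UNIV ?L ?f" .
  have "range lessThan \<subseteq> ?L"
  proof clarsimp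
    fix a :: real
    have "hausdorffT kappa (A \<inter> K)
        \<le> hausdorffT kappa ({..<a} \<inter> A \<inter> K) + hausdorffT kappa (- {..<a} \<inter> A \<inter> K)" for A
    proof -
      have "A \<inter> K = ({..<a} \<inter> A \<inter> K) \<union> (- {..<a} \<inter> A \<inter> K)" by blast
      then show ?thesis using hausdorffT_subadditive by metis
    qed
    then show "{..<a} \<in> ?L"
      using hausdorffT_kappa_split by (auto simp: lambda_system_def Compl_eq_Diff_UNIV intro!: antisym)
  qed
  then have "sigma_sets UNIV (range lessThan) \<subseteq> ?L"
    using L by (intro sigma_algebra.sigma_sets_subset) (simp_all add: measure_space_def)
  moreover have "sets borel = sigma_sets UNIV (range (lessThan :: real \<Rightarrow> real set))"
    by (subst borel_Iio) simp
  ultimately show ?thesis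
    using sets.sigma_algebra_axioms[of "borel :: real measure"]
    by (intro measure_down[OF L]) simp_all
qed

section \<open>The normalized measure \<open>muK\<close>\<close>

lemma sets_muK [measurable_cong, simp]: "sets muK = sets borel"
  unfolding muK_def using sets.sigma_sets_eq[of "borel :: real measure"] by (simp add: sets_measure_of)

lemma space_muK [simp]: "space muK = UNIV"
  by (simp add: muK_def space_measure_of_conv)

lemma emeasure_muK:
  assumes "A \<in> sets borel"
  shows "emeasure muK A = hausdorffT kappa (A \<inter> K) / hausdorffT kappa K"
  unfolding muK_def
proof (rule emeasure_measure_of_sigma)
  show "sigma_algebra UNIV (sets (borel :: real measure))"
    using sets.sigma_algebra_axioms[of "borel :: real measure"] by simp
  show "positive (sets borel) (\<lambda>A. hausdorffT kappa (A \<inter> K) / hausdorffT kappa K)"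
    by (simp add: positive_def)
  show "countably_additive (sets borel) (\<lambda>A. hausdorffT kappa (A \<inter> K) / hausdorffT kappa K)"
    using measure_space_hausdorffT_K
    by (auto simp: measure_space_def countably_additive_def divide_ennreal_def)
qed (rule assms)

lemma prob_space_muK: "prob_space muK"
proof
  show "emeasure muK (space muK) = 1"
    using hausdorffT_kappa_K_pos hausdorffT_kappa_K_finite by (simp add: emeasure_muK)
qed

interpretation muK: prob_space muK
  by (rule prob_space_muK)

text \<open>Cylinders of one generation are translates of each other. Passing to \<open>K\<close>
  removes at most the point 1, which is null.\<close>

lemma emeasure_muK_branch_eq:
  assumes "length w = length v"
  shows "emeasure muK (branch w ` cantor_set) = emeasure muK (branch v ` cantor_set)"
proof -
  have "hausdorffT kappa (branch w ` cantor_set \<inter> K)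
      = hausdorffT kappa ((\<lambda>x. x / 3 ^ length w) ` cantor_set)" for w
  proof -
    have sub: "branch w ` cantor_set \<subseteq> (branch w ` cantor_set \<inter> K) \<union> {1}"
      using branch_cantor_set by (auto simp: K_eq)
    have "hausdorffT kappa (branch w ` cantor_set)
        \<le> hausdorffT kappa (branch w ` cantor_set \<inter> K) + hausdorffT kappa {1}"
      using hausdorffT_mono[OF sub] hausdorffT_subadditive by (rule order_trans)
    then have "hausdorffT kappa (branch w ` cantor_set)
        \<le> hausdorffT kappa (branch w ` cantor_set \<inter> K)"
      by (simp add: hausdorffT_singleton[OF kappa_pos])
    then have "hausdorffT kappa (branch w ` cantor_set \<inter> K) = hausdorffT kappa (branch w ` cantor_set)"
      by (intro antisym hausdorffT_mono[OF Int_lower1])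
    moreover have "branch w ` cantor_set = (+) (branch w 0) ` (\<lambda>x. x / 3 ^ length w) ` cantor_set"
      unfolding image_comp comp_def by (intro image_cong refl branch_affine)
    ultimately show ?thesis by (simp only: hausdorffT_translate)
  qed
  then show ?thesis using assms by (simp add: emeasure_muK)
qed

text \<open>Total mass 1 is shared equally by the disjoint cylinders of one generation.\<close>

lemma measure_muK_branch: "measure muK (branch w ` cantor_set) = 1 / 2 ^ length w"
proof -
  let ?I = "{v :: bool list. length v = length w}"
  have "measure muK cantor_set = 1"
  proof -
    have "cantor_set \<inter> K = UNIV \<inter> K" by (auto simp: K_eq)
    then have "emeasure muK cantor_set = emeasure muK (space muK)"
      using borel_compact[OF compact_cantor_set] by (simp add: emeasure_muK)
    then show ?thesis using muK.prob_space by (simp add: measure_def)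
  qed
  also have "measure muK cantor_set = measure muK (\<Union>v\<in>?I. branch v ` cantor_set)"
    by (subst cantor_set_eq_UN_branch[of "length w"]) (rule refl)
  also have "\<dots> = (\<Sum>v\<in>?I. measure muK (branch v ` cantor_set))"
  proof (rule muK.finite_measure_finite_Union)
    show "disjoint_family_on (\<lambda>v. branch v ` cantor_set) ?I"
      unfolding disjoint_family_on_def
    proof (intro ballI impI)
      fix u v assume uv: "u \<in> ?I" "v \<in> ?I" "u \<noteq> v"
      show "branch u ` cantor_set \<inter> branch v ` cantor_set = {}"
      proof (rule ccontr)
        assume "\<not> ?thesis"
        then obtain s t where st: "s \<in> cantor_set" "t \<in> cantor_set" "branch u s = branch v t" by blast
        then have "1 / 3 ^ length u \<le> \<bar>branch u s - branch v t\<bar>"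
          using uv cantor_set_subset by (intro branch_separated) auto
        moreover have "0 < 1 / (3::real) ^ length u" by simp
        ultimately show False using st by linarith
      qed
    qed
  qed auto
  also have "\<dots> = (\<Sum>v\<in>?I. measure muK (branch w ` cantor_set))"
  proof (rule sum.cong[OF refl])
    fix v assume "v \<in> ?I"
    then show "measure muK (branch v ` cantor_set) = measure muK (branch w ` cantor_set)"
      using emeasure_muK_branch_eq[of v w] by (simp add: measure_def)
  qed
  also have "\<dots> = 2 ^ length w * measure muK (branch w ` cantor_set)"
    by (simp add: card_words)
  finally show ?thesis by (simp add: field_simps)
qed

section \<open>Counting reduced fractions\<close>

lemma card_multiples_le: "card {n \<in> {1..N}. d dvd n} \<le> N div d"
proof -
  have "{n \<in> {1..N}. d dvd n} \<subseteq> (\<lambda>k. d * k) ` {1..N div d}"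
  proof
    fix n assume n: "n \<in> {n \<in> {1..N}. d dvd n}"
    then obtain k where k: "n = d * k" by auto
    then have "0 < k" "0 < d" using n by (auto intro: ccontr)
    moreover have "k \<le> N div d" using n k \<open>0 < d\<close> by (simp add: less_eq_div_iff_mult_less_eq mult.commute)
    ultimately show "n \<in> (\<lambda>k. d * k) ` {1..N div d}" using k by auto
  qed
  then have "card {n \<in> {1..N}. d dvd n} \<le> card ((\<lambda>k. d * k) ` {1..N div d})"
    by (intro card_mono) auto
  also have "\<dots> \<le> N div d" using card_image_le[of "{1..N div d}" "\<lambda>k. d * k"] by simp
  finally show ?thesis .
qed

text \<open>Gauss's identity, that the totients of the divisors of n sum to n, is added up over n
  \<le> \<open>N\<close> and rearranged by divisor. The average of \<open>totient d / d\<close> is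
  therefore at least 1/2.\<close>

lemma sum_totient_div_ge:
  assumes "0 < N"
  shows "(real N + 1) / 2 \<le> (\<Sum>d=1..N. real (totient d) / real d)"
proof -
  have "real N * (real N + 1) / 2 = (\<Sum>n=1..N. real n)"
    by (induction N) (auto simp: field_simps)
  also have "\<dots> = (\<Sum>n=1..N. \<Sum>d | d \<in> {1..N} \<and> d dvd n. real (totient d))"
  proof (rule sum.cong[OF refl])
    fix n assume n: "n \<in> {1..N}"
    then have "{d. d dvd n} = {d. d \<in> {1..N} \<and> d dvd n}"
      by (auto dest: dvd_imp_le dvd_pos_nat)
    then show "real n = (\<Sum>d | d \<in> {1..N} \<and> d dvd n. real (totient d))"
      using totient_divisor_sum[of n] by (metis of_nat_sum)
  qed
  also have "\<dots> = (\<Sum>d=1..N. \<Sum>n | n \<in> {1..N} \<and> d dvd n. real (totient d))"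
    by (rule sum.swap_restrict) auto
  also have "\<dots> = (\<Sum>d=1..N. real (card {n \<in> {1..N}. d dvd n}) * real (totient d))"
    by simp
  also have "\<dots> \<le> (\<Sum>d=1..N. (real N / real d) * real (totient d))"
  proof (intro sum_mono mult_right_mono)
    fix d assume "d \<in> {1..N}"
    have "real (card {n \<in> {1..N}. d dvd n}) \<le> real (N div d)"
      using card_multiples_le by (rule of_nat_mono)
    also have "\<dots> \<le> real N / real d" by (rule of_nat_div_le_of_nat)
    finally show "real (card {n \<in> {1..N}. d dvd n}) \<le> real N / real d" .
  qed simp
  also have "\<dots> = real N * (\<Sum>d=1..N. real (totient d) / real d)"
    by (simp add: sum_distrib_left field_simps)
  finally have "real N * ((real N + 1) / 2) \<le> real N * (\<Sum>d=1..N. real (totient d) / real d)"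
    by simp
  then show ?thesis using assms by (simp only: mult_le_cancel_left_pos of_nat_0_less_iff)
qed

lemma Pj_eq: "Pj j = (\<lambda>(q, p). (p, q)) ` (SIGMA q:{3 ^ j..<3 ^ (j + 1)}. {p. p < q \<and> coprime p q})"
  by (auto simp: Pj_def Ppairs_def image_iff)

lemma finite_Pj [simp]: "finite (Pj j)"
  unfolding Pj_eq by (intro finite_imageI finite_SigmaI) auto

lemma card_Pj: "card (Pj j) = (\<Sum>q\<in>{3 ^ j..<3 ^ (j + 1)::nat}. card {p. p < q \<and> coprime p q})"
  unfolding Pj_eq by (subst card_image) (auto simp: inj_on_def card_SigmaI)

lemma card_Pj_le: "card (Pj j) \<le> 9 ^ (j + 1)"
proof -
  have "card (Pj j) \<le> (\<Sum>q\<in>{3 ^ j..<3 ^ (j + 1)::nat}. 3 ^ (j + 1))"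
    unfolding card_Pj
  proof (rule sum_mono)
    fix q :: nat assume q: "q \<in> {3 ^ j..<3 ^ (j + 1)}"
    have "card {p. p < q \<and> coprime p q} \<le> card {..<q}" by (intro card_mono) auto
    then show "card {p. p < q \<and> coprime p q} \<le> 3 ^ (j + 1)" using q by simp
  qed
  also have "\<dots> \<le> 3 ^ (j + 1) * 3 ^ (j + 1)" by simp
  also have "\<dots> = (9 ^ (j + 1) :: nat)" by (simp add: power_mult_distrib[symmetric])
  finally show ?thesis .
qed

lemma totient_le_card_coprime: "0 < q \<Longrightarrow> totient q \<le> card {p. p < q \<and> coprime p q}"
proof (cases "q = 1")
  \<comment> \<open>\<open>totatives q\<close> lies in \<open>{1..q}\<close> and the counted set in
    \<open>{0..<q}\<close>; they differ only for \<open>q = 1\<close>, where 0 replaces 1.\<close>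
  case True
  then show ?thesis by simp
next
  case False
  assume "0 < q"
  then have "totatives q \<subseteq> {p. p < q \<and> coprime p q}"
    using False totatives_less[of _ q] by (auto simp: in_totatives_iff)
  then show ?thesis unfolding totient_def by (intro card_mono) auto
qed

text \<open>With \<open>Q = 3 ^ j\<close>, the sum of \<open>totient d / d\<close> over d < 3 *
  \<open>Q\<close> is at least 3 * \<open>Q\<close> / 2, and the terms with d < \<open>Q\<close>
  account for less than \<open>Q\<close> of it. Since the block spans a factor 3 > 2, a positive
  share remains.\<close>

lemma card_Pj_ge: "9 ^ j / 2 \<le> real (card (Pj j))"
proof -
  define Q :: nat where "Q = 3 ^ j"
  have Q: "0 < Q" by (simp add: Q_def)
  let ?f = "\<lambda>d. real (totient d) / real d"
  have "3 * real Q / 2 \<le> (\<Sum>d=1..3 * Q - 1. ?f d)"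
    using sum_totient_div_ge[of "3 * Q - 1"] Q by (simp add: of_nat_diff)
  also have "{1..3 * Q - 1} = {1..<Q} \<union> {Q..<3 * Q}" using Q by auto
  also have "(\<Sum>d\<in>{1..<Q} \<union> {Q..<3 * Q}. ?f d) = (\<Sum>d\<in>{1..<Q}. ?f d) + (\<Sum>d\<in>{Q..<3 * Q}. ?f d)"
    by (rule sum.union_disjoint) auto
  also have "(\<Sum>d\<in>{1..<Q}. ?f d) \<le> (\<Sum>d\<in>{1..<Q}. 1)"
    using totient_le by (intro sum_mono) (auto simp: divide_le_eq)
  also have "(\<Sum>d\<in>{Q..<3 * Q}. ?f d) \<le> (\<Sum>d\<in>{Q..<3 * Q}. real (totient d) / real Q)"
    using Q by (intro sum_mono divide_left_mono) auto
  also have "\<dots> = (\<Sum>d\<in>{Q..<3 * Q}. real (totient d)) / real Q"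
    by (simp add: sum_divide_distrib)
  finally have "real Q / 2 \<le> (\<Sum>d\<in>{Q..<3 * Q}. real (totient d)) / real Q"
    using Q by (simp add: of_nat_diff)
  then have "real Q * real Q / 2 \<le> (\<Sum>d\<in>{Q..<3 * Q}. real (totient d))"
    using Q by (simp add: field_simps)
  also have "\<dots> \<le> (\<Sum>d\<in>{Q..<3 * Q}. real (card {p. p < d \<and> coprime p d}))"
    using Q by (intro sum_mono of_nat_mono totient_le_card_coprime) auto
  also have "\<dots> = real (card (Pj j))" by (simp add: card_Pj Q_def)
  finally show ?thesis by (simp add: Q_def power_mult_distrib[symmetric])
qed

section \<open>Independent points\<close>

lemma sets_lebT [measurable_cong, simp]: "sets lebT = sets borel"
  by (simp add: lebT_def)

lemma sets_torus [measurable]: "torus \<in> sets borel"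
  by (simp add: torus_def)

lemma emeasure_lebT: "A \<in> sets borel \<Longrightarrow> emeasure lebT A = emeasure lborel (A \<inter> torus)"
  unfolding lebT_def by (subst emeasure_restricted) (simp_all add: Int_commute)

lemma prob_space_lebT: "prob_space lebT"
proof
  show "emeasure lebT (space lebT) = 1"
    using emeasure_lebT[of UNIV] by (simp add: lebT_def torus_def)
qed

lemma prob_space_Ydist: "prob_space (Ydist PK i)"
  by (simp add: Ydist_def prob_space_lebT prob_space_muK)

lemma sets_Ydist [measurable_cong, simp]: "sets (Ydist PK i) = sets borel"
  by (simp add: Ydist_def)

lemma space_Ydist [simp]: "space (Ydist PK i) = UNIV"
  using sets_eq_imp_space_eq[OF sets_Ydist] by simp

lemma product_prob_space_Ydist: "product_prob_space (Ydist PK)"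
proof -
  interpret prob_space "Ydist PK i" for i by (rule prob_space_Ydist)
  show ?thesis by unfold_locales
qed

lemma prob_space_Omega: "prob_space (Omega PK)"
  unfolding Omega_def by (rule prob_space_PiM) (rule prob_space_Ydist)

lemma measurable_Omega_component [measurable]: "i \<in> Ppairs \<Longrightarrow> (\<lambda>Y. Y i) \<in> borel_measurable (Omega PK)"
  unfolding Omega_def using measurable_component_singleton[of i Ppairs "Ydist PK"]
  by (simp cong: measurable_cong_sets)

lemma emeasure_Omega_component:
  assumes "i \<in> Ppairs" "A \<in> sets borel"
  shows "emeasure (Omega PK) {Y \<in> space (Omega PK). Y i \<in> A} = emeasure (Ydist PK i) A"
proof -
  interpret product_prob_space "Ydist PK" Ppairs by (rule product_prob_space_Ydist)
  show ?thesis unfolding Omega_def using assms by (intro emeasure_PiM_Collect_single) auto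
qed

text \<open>Independence turns the event into a product, and \<open>1 - p \<le> exp (- p)\<close>
  makes the bound exponential in \<open>card Q * p\<close>.\<close>

lemma measure_Omega_all_miss:
  assumes Q: "Q \<subseteq> Ppairs" "finite Q" and B: "B \<in> sets borel"
    and p: "\<And>i. i \<in> Q \<Longrightarrow> p \<le> measure (Ydist PK i) B" "0 \<le> p"
  shows "measure (Omega PK) {Y \<in> space (Omega PK). \<forall>i\<in>Q. Y i \<notin> B} \<le> exp (- (real (card Q) * p))"
proof -
  interpret product_prob_space "Ydist PK" Ppairs by (rule product_prob_space_Ydist)
  have "emeasure (Omega PK) {Y \<in> space (Omega PK). \<forall>i\<in>Q. Y i \<in> - B}
      = (\<Prod>i\<in>Q. emeasure (Ydist PK i) (- B))"
    unfolding Omega_def using Q B by (intro emeasure_PiM_Collect) auto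
  also have "\<dots> = (\<Prod>i\<in>Q. ennreal (measure (Ydist PK i) (- B)))"
    by (simp add: M.emeasure_eq_measure)
  also have "\<dots> = ennreal (\<Prod>i\<in>Q. measure (Ydist PK i) (- B))"
    by (rule prod_ennreal) simp
  finally have "measure (Omega PK) {Y \<in> space (Omega PK). \<forall>i\<in>Q. Y i \<in> - B}
      = (\<Prod>i\<in>Q. measure (Ydist PK i) (- B))"
    by (simp add: measure_def prod_nonneg)
  also have "\<dots> \<le> (\<Prod>i\<in>Q. exp (- p))"
  proof (rule prod_mono)
    fix i assume i: "i \<in> Q"
    have "measure (Ydist PK i) (- B) = 1 - measure (Ydist PK i) B"
      using M.prob_compl[of B i] B by (simp add: Compl_eq_Diff_UNIV)
    also have "\<dots> \<le> 1 - p" using p(1)[OF i] by simp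
    also have "\<dots> \<le> exp (- p)" using exp_ge_add_one_self[of "- p"] by simp
    finally show "0 \<le> measure (Ydist PK i) (- B) \<and> measure (Ydist PK i) (- B) \<le> exp (- p)" by simp
  qed
  also have "\<dots> = exp (- (real (card Q) * p))"
    by (simp add: exp_of_nat_mult[symmetric])
  finally show ?thesis by simp
qed

text \<open>The union bound runs over \<open>2 ^ g j\<close> words, at most exponentially many in j,
  while each failure has probability at most \<open>exp (- (3 powr (\<epsilon> * real j)))\<close>,
  which is doubly exponentially small. So all words are served simultaneously and Borel-Cantelli
  applies. \<open>J\<close> accommodates counts that are large only along a subsequence.\<close>

lemma AE_hitting:
  fixes Q :: "nat \<Rightarrow> (nat \<times> nat) set" and B :: "nat \<Rightarrow> bool list \<Rightarrow> real set"
    and g :: "nat \<Rightarrow> nat" and p :: "nat \<Rightarrow> real"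
  assumes Q: "\<And>j. Q j \<subseteq> Ppairs" "\<And>j. finite (Q j)"
    and B: "\<And>j w. B j w \<in> sets borel"
    and p: "\<And>j w i. length w = g j \<Longrightarrow> i \<in> Q j \<Longrightarrow> p j \<le> measure (Ydist PK i) (B j w)" "\<And>j. 0 \<le> p j"
    and \<epsilon>: "0 < \<epsilon>" and many: "\<forall>\<^sub>F j in sequentially. j \<in> J \<longrightarrow> 3 powr (\<epsilon> * real j) \<le> real (card (Q j)) * p j"
    and c: "0 < c" and g: "\<forall>\<^sub>F j in sequentially. real (g j) \<le> c * real j"
  shows "AE Y in Omega PK. \<forall>\<^sub>F j in sequentially. j \<in> J \<longrightarrow>
    (\<forall>w. length w = g j \<longrightarrow> (\<exists>i\<in>Q j. Y i \<in> B j w))"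
proof -
  interpret prob_space "Omega PK" by (rule prob_space_Omega)
  define miss where "miss j w = {Y \<in> space (Omega PK). \<forall>i\<in>Q j. Y i \<notin> B j w}" for j w
  \<comment> \<open>Outside \<open>J\<close> the bad event is empty, so one summable series covers
    all \<open>j\<close>.\<close>
  define A where "A j = (if j \<in> J then \<Union>w\<in>{w. length w = g j}. miss j w else {})" for j
  have miss [measurable]: "miss j w \<in> sets (Omega PK)" for j w
  proof -
    have "{Y \<in> space (Omega PK). Y i \<notin> B j w} \<in> sets (Omega PK)" if "i \<in> Q j" for i
    proof -
      have [measurable]: "B j w \<in> sets borel" by (rule B)
      have [measurable]: "(\<lambda>Y. Y i) \<in> borel_measurable (Omega PK)"
        using Q(1) that by (intro measurable_Omega_component) auto
      show ?thesis by measurable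
    qed
    then show ?thesis unfolding miss_def using Q(2) by (intro sets.sets_Collect_finite_All) auto
  qed
  have A [measurable]: "A j \<in> sets (Omega PK)" for j
    unfolding A_def by (auto intro!: sets.finite_UN)
  have bound: "\<forall>\<^sub>F j in sequentially. measure (Omega PK) (A j) \<le> 2 powr (c * real j) * exp (- (3 powr (\<epsilon> * real j)))"
    using many g
  proof eventually_elim
    case (elim j)
    show ?case
    proof (cases "j \<in> J")
      case True
      have "measure (Omega PK) (A j) \<le> (\<Sum>w\<in>{w. length w = g j}. measure (Omega PK) (miss j w))"
        unfolding A_def using True by (auto intro!: measure_UNION_le)
      also have "\<dots> \<le> (\<Sum>w\<in>{w :: bool list. length w = g j}. exp (- (3 powr (\<epsilon> * real j))))"
      proof (rule sum_mono)
        fix w :: "bool list" assume w: "w \<in> {w. length w = g j}"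
        have "measure (Omega PK) (miss j w) \<le> exp (- (real (card (Q j)) * p j))"
          unfolding miss_def using w by (intro measure_Omega_all_miss Q B p) auto
        also have "\<dots> \<le> exp (- (3 powr (\<epsilon> * real j)))" using elim True by simp
        finally show "measure (Omega PK) (miss j w) \<le> exp (- (3 powr (\<epsilon> * real j)))" .
      qed
      also have "\<dots> = 2 powr real (g j) * exp (- (3 powr (\<epsilon> * real j)))"
        by (simp add: card_words powr_realpow)
      also have "\<dots> \<le> 2 powr (c * real j) * exp (- (3 powr (\<epsilon> * real j)))"
        using elim by (intro mult_right_mono powr_mono) auto
      finally show ?thesis .
    qed (simp add: A_def)
  qed
  have "(\<lambda>j. 2 powr (c * real j) * exp (- (3 powr (\<epsilon> * real j)))) \<in> O(\<lambda>j. 1 / real j ^ 2)"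
    using \<epsilon> c by real_asymp
  then have "summable (\<lambda>j. 2 powr (c * real j) * exp (- (3 powr (\<epsilon> * real j))))"
    by (rule summable_comparison_test_bigo[rotated]) (use inverse_power_summable[of 2] in \<open>simp add: field_simps\<close>)
  then have "summable (\<lambda>j. measure (Omega PK) (A j))"
    by (rule summable_comparison_test_ev[rotated]) (use bound in simp)
  then have "AE Y in Omega PK. \<forall>\<^sub>F j in sequentially. Y \<in> space (Omega PK) - A j"
    by (intro borel_cantelli_AE1) (auto simp: less_top[symmetric])
  then show ?thesis
  proof eventually_elim
    case (elim Y)
    then show ?case
    proof eventually_elim
      case (elim j)
      then show ?case by (auto simp: A_def miss_def)
    qed
  qed
qed

section \<open>Free and forced digits\<close>

text \<open>Digits up to \<open>g j\<close> are free and those up to \<open>n j\<close> are forced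
  by \<open>R j\<close>; \<sigma> picks the generations in use. \<open>t\<close> bounds the
  \<kappa>-weighted proportion of free digits from below, and the gap \<open>t - s\<close> pays for
  digits already spent: sparseness makes \<kappa> times the previous level at most
  \<open>t - s\<close> times the next one.\<close>

locale tree_selection =
  fixes g n \<sigma> :: "nat \<Rightarrow> nat" and R :: "nat \<Rightarrow> (nat \<Rightarrow> bool) \<Rightarrow> nat \<Rightarrow> bool" and s t :: real
  assumes s: "0 < s" "s < t"
    and g_le_n: "\<And>j. g j \<le> n j"
    and ratio: "\<And>k. t * real (n (\<sigma> k)) \<le> kappa * real (g (\<sigma> k))"
    and sparse_0: "1 < n (\<sigma> 0)" "kappa \<le> (t - s) * real (n (\<sigma> 0))"
    and sparse_Suc: "\<And>k. n (\<sigma> k) < n (\<sigma> (Suc k))"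
      "\<And>k. kappa * real (n (\<sigma> k)) \<le> (t - s) * real (n (\<sigma> (Suc k)))"
    and R: "\<And>j b. prefix_word (g j) (R j b) = prefix_word (g j) b"
begin

text \<open>At stage \<open>k\<close>, the first \<open>level k\<close> digits have been fixed and \<open>free k\<close> of them were chosen
  freely; the digits of \<open>b\<close> at positions from \<open>level k\<close> up to \<open>g (\<sigma> k)\<close> are free again, those
  from there up to \<open>level (Suc k)\<close> are forced by \<open>R\<close>.\<close>

definition level :: "nat \<Rightarrow> nat" where
  "level k = (case k of 0 \<Rightarrow> 1 | Suc k \<Rightarrow> n (\<sigma> k))"

primrec free :: "nat \<Rightarrow> nat" where
  "free 0 = 0"
| "free (Suc k) = free k + (g (\<sigma> k) - level k)"

primrec stage :: "nat \<Rightarrow> (nat \<Rightarrow> bool) \<Rightarrow> nat \<Rightarrow> bool" where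
  "stage 0 b = case_nat False b"
| "stage (Suc k) b = (\<lambda>i. if i < n (\<sigma> k) then R (\<sigma> k) (stage k b) i
     else b (free (Suc k) + (i - n (\<sigma> k))))"

text \<open>Diagonal choice: position \<open>i\<close> lies below \<open>level i\<close>, so no
  stage after \<open>i\<close> alters it.\<close>

definition limit_seq :: "(nat \<Rightarrow> bool) \<Rightarrow> nat \<Rightarrow> bool" where
  "limit_seq b i = stage i b i"

lemma level_0 [simp]: "level 0 = 1" and level_Suc [simp]: "level (Suc k) = n (\<sigma> k)"
  by (simp_all add: level_def)

lemma level_less_Suc: "level k < level (Suc k)"
  using sparse_0(1) sparse_Suc(1) by (cases k) auto

lemma less_level: "k < level k"
proof (induction k)
  case (Suc k)
  then show ?case using level_less_Suc[of k] by linarith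
qed simp

lemma level_gap: "kappa * real (level k) \<le> (t - s) * real (level (Suc k))"
  using sparse_0(2) sparse_Suc(2) by (cases k) auto

text \<open>A stage alters only digits from \<open>g (\<sigma> k)\<close> on, so this is why digits
  fixed at earlier stages survive.\<close>

lemma level_le_g: "level k \<le> g (\<sigma> k)"
proof -
  have "kappa * real (level k) \<le> (t - s) * real (n (\<sigma> k))"
    using level_gap[of k] by simp
  also have "\<dots> \<le> t * real (n (\<sigma> k))"
    using s by (intro mult_right_mono) auto
  also have "\<dots> \<le> kappa * real (g (\<sigma> k))" by (rule ratio)
  finally show ?thesis using kappa_pos by simp
qed

lemma stage_free: "level k \<le> i \<Longrightarrow> stage k b i = b (free k + (i - level k))"
  by (cases k) (auto split: nat.split)

lemma stage_Suc_forced: "i < level (Suc k) \<Longrightarrow> stage (Suc k) b i = R (\<sigma> k) (stage k b) i"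
  by simp

lemma stage_Suc_eq: "i < g (\<sigma> k) \<Longrightarrow> stage (Suc k) b i = stage k b i"
  using R[of "\<sigma> k" "stage k b"] g_le_n[of "\<sigma> k"] by (auto simp: prefix_word_eq_iff)

lemma stage_stable: "i < level k \<Longrightarrow> k \<le> l \<Longrightarrow> stage l b i = stage k b i"
proof (induction l)
  case (Suc l)
  show ?case
  proof (cases "k = Suc l")
    case False
    with Suc have "k \<le> l" by simp
    moreover have "level k \<le> level l"
      by (rule lift_Suc_mono_le[of level]) (use level_less_Suc less_imp_le \<open>k \<le> l\<close> in blast)+
    ultimately have "i < g (\<sigma> l)" using Suc.prems level_le_g[of l] by linarith
    then have "stage (Suc l) b i = stage l b i" by (rule stage_Suc_eq)
    then show ?thesis using Suc.IH[OF Suc.prems(1) \<open>k \<le> l\<close>] by simp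
  qed simp
qed simp

lemma limit_seq_stage: "i < level k \<Longrightarrow> limit_seq b i = stage k b i"
  unfolding limit_seq_def
  using stage_stable[of i i k b] stage_stable[of i k i b] less_level[of i] by (cases "i \<le> k") auto

lemma prefix_limit_seq_forced:
  "prefix_word (n (\<sigma> k)) (limit_seq b) = prefix_word (n (\<sigma> k)) (R (\<sigma> k) (stage k b))"
  using limit_seq_stage[of _ "Suc k" b] stage_Suc_forced[of _ k b]
  by (simp add: prefix_word_eq_iff del: stage.simps)

lemma limit_seq_0: "\<not> limit_seq b 0"
  by (simp add: limit_seq_def)

lemma decode_free:
  assumes dec: "prefix_word (level k) (stage k b) = prefix_word (level k) (stage k b')
      \<Longrightarrow> prefix_word (free k) b = prefix_word (free k) b'"
    and m: "level k \<le> m" and eq: "prefix_word m (stage k b) = prefix_word m (stage k b')"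
  shows "prefix_word (free k + (m - level k)) b = prefix_word (free k + (m - level k)) b'"
  unfolding prefix_word_eq_iff
proof (intro allI impI)
  fix i assume i: "i < free k + (m - level k)"
  show "b i = b' i"
  proof (cases "i < free k")
    case True
    then show ?thesis
      using dec prefix_word_eq_mono[OF eq m] by (simp add: prefix_word_eq_iff)
  next
    case False
    define l where "l = level k + (i - free k)"
    have "l < m" "level k \<le> l" using i False by (auto simp: l_def)
    then have "stage k b l = stage k b' l" using eq by (simp add: prefix_word_eq_iff)
    moreover have "free k + (l - level k) = i" using False by (simp add: l_def)
    ultimately show ?thesis using stage_free[OF \<open>level k \<le> l\<close>] by metis
  qed
qed

text \<open>The free digits are recovered block by block: below \<open>g (\<sigma> k)\<close> the
  stages \<open>k\<close> and \<open>Suc k\<close> agree, and these digits already carry the first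
  \<open>free (Suc k)\<close> digits of \<open>b\<close>. Forced digits are never consulted.\<close>

lemma decode_stage:
  "prefix_word (level k) (stage k b) = prefix_word (level k) (stage k b')
    \<Longrightarrow> prefix_word (free k) b = prefix_word (free k) b'"
proof (induction k)
  case (Suc k)
  have "prefix_word (g (\<sigma> k)) (stage (Suc k) c) = prefix_word (g (\<sigma> k)) (stage k c)" for c
    using stage_Suc_eq by (simp add: prefix_word_eq_iff del: stage.simps)
  then have "prefix_word (g (\<sigma> k)) (stage k b) = prefix_word (g (\<sigma> k)) (stage k b')"
    using prefix_word_eq_mono[OF Suc.prems, of "g (\<sigma> k)"] g_le_n[of "\<sigma> k"] by simp
  then show ?case
    using decode_free[OF Suc.IH level_le_g] by simp
qed simp

lemma t_le_kappa: "t \<le> kappa"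
proof -
  have "t * real (n (\<sigma> 0)) \<le> kappa * real (g (\<sigma> 0))" by (rule ratio)
  also have "\<dots> \<le> kappa * real (n (\<sigma> 0))"
    using g_le_n kappa_pos by (intro mult_left_mono) auto
  finally show ?thesis using sparse_0(1) by simp
qed

text \<open>The sparseness loss \<open>(t - s) * n\<close> is subtracted from the guaranteed
  \<open>t * n\<close>.\<close>

lemma free_block: "s * real (n (\<sigma> k)) \<le> kappa * real (g (\<sigma> k) - level k)"
  using ratio[of k] level_gap[of k] level_le_g[of k]
  by (simp add: of_nat_diff algebra_simps)

lemma free_ge: "s * real (level k) \<le> kappa * (real (free k) + 1)"
proof (cases k)
  case 0
  then show ?thesis using t_le_kappa s by simp
next
  case (Suc l)
  have "kappa * real (g (\<sigma> l) - level l) \<le> kappa * (real (free k) + 1)"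
    using kappa_pos by (intro mult_left_mono) (auto simp: Suc)
  then show ?thesis using free_block[of l] Suc by simp
qed

lemma hausdorffT_limit_seq_pos: "0 < hausdorffT s (range (\<lambda>b. expansion 3 (limit_seq b)))"
proof (rule hausdorffT_pos_coded[where G = limit_seq])
  fix m
  show "\<exists>r. s * real m \<le> kappa * (real r + 1) \<and>
      (\<forall>b b'. prefix_word m (limit_seq b) = prefix_word m (limit_seq b') \<longrightarrow>
        prefix_word r b = prefix_word r b')"
  proof (cases "m = 0")
    case True
    then show ?thesis using kappa_pos by (intro exI[of _ 0]) simp
  next
    case False
    define k' where "k' = (LEAST k. m < level k)"
    have k': "m < level k'" unfolding k'_def by (rule LeastI[of _ m]) (rule less_level)
    have "k' \<noteq> 0" using k' False by (intro notI) simp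
    then obtain k where k: "k' = Suc k" by (cases k') auto
    have "\<not> m < level k" using not_less_Least[of k "\<lambda>k. m < level k"] k by (simp add: k'_def)
    then have lev: "level k \<le> m" "m \<le> level (Suc k)" using k' k by auto
    define m' where "m' = min m (g (\<sigma> k))"
    have m': "level k \<le> m'" "m' \<le> m" "m' \<le> g (\<sigma> k)" using lev level_le_g[of k] by (auto simp: m'_def)
    define r where "r = free k + (m' - level k)"
    have "prefix_word r b = prefix_word r b'"
      if eq: "prefix_word m (limit_seq b) = prefix_word m (limit_seq b')" for b b'
    proof -
      have "prefix_word m' (limit_seq c) = prefix_word m' (stage k c)" for c
        using limit_seq_stage[of _ "Suc k" c] stage_Suc_eq[of _ k c] m' lev
        by (simp add: prefix_word_eq_iff del: stage.simps)
      then have "prefix_word m' (stage k b) = prefix_word m' (stage k b')"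
        using prefix_word_eq_mono[OF eq m'(2)] by simp
      then show ?thesis unfolding r_def
        by (intro decode_free[OF _ m'(1)] decode_stage)
    qed
    moreover have "s * real m \<le> kappa * (real r + 1)"
    proof (cases "m \<le> g (\<sigma> k)")
      case True
      then have "m' = m" by (simp add: m'_def)
      \<comment> \<open>Within the free range each further digit of the point is a new free digit,
        and its gain \<kappa> exceeds the required \<open>s\<close>.\<close>
      have "s * real m = s * real (level k) + s * real (m - level k)"
        using lev by (simp add: of_nat_diff algebra_simps)
      also have "\<dots> \<le> kappa * (real (free k) + 1) + kappa * real (m - level k)"
        using t_le_kappa s by (intro add_mono free_ge mult_right_mono) auto
      also have "\<dots> = kappa * (real r + 1)"
        using \<open>m' = m\<close> by (simp add: r_def algebra_simps)
      finally show ?thesis .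
    next
      case False
      then have "m' = g (\<sigma> k)" by (simp add: m'_def)
      \<comment> \<open>In the forced range no information is gained, so the requirement is hardest
        at the end \<open>m = n (\<sigma> k)\<close>, where \<open>free_block\<close> meets
        it.\<close>
      have "s * real m \<le> s * real (n (\<sigma> k))" using lev s by simp
      also have "\<dots> \<le> kappa * real (g (\<sigma> k) - level k)" by (rule free_block)
      also have "\<dots> \<le> kappa * (real r + 1)"
        using kappa_pos \<open>m' = g (\<sigma> k)\<close> by (intro mult_left_mono) (auto simp: r_def)
      finally show ?thesis .
    qed
    ultimately show ?thesis by blast
  qed
qed (use s(1) limit_seq_0 in auto)

end

text \<open>The extension property supplies the data of \<open>tree_selection\<close>:
  \<open>R\<close> by choice, and \<sigma> inside \<open>J\<close> so sparse that earlier digits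
  become negligible. Every resulting point lies in \<open>Z (\<sigma> k)\<close> for all k.\<close>

lemma hausdorffT_limsup_pos:
  fixes g n :: "nat \<Rightarrow> nat"
  assumes s: "0 < s" "s < t"
    and J: "infinite J"
    and g_le_n: "\<And>j. g j \<le> n j"
    and n_lim: "filterlim n at_top sequentially"
    and ratio: "\<forall>\<^sub>F j in sequentially. t * real (n j) \<le> kappa * real (g j)"
    and ext: "\<And>j b. j \<in> J \<Longrightarrow> \<exists>c. prefix_word (g j) c = prefix_word (g j) b \<and>
      (\<forall>c'. prefix_word (n j) c' = prefix_word (n j) c \<longrightarrow> expansion 3 c' \<in> Z j)"
  shows "0 < hausdorffT s {x \<in> K. infinite {j \<in> J. x \<in> Z j}}"
proof -
  define next_ok where "next_ok L j \<longleftrightarrow> j \<in> J \<and> t * real (n j) \<le> kappa * real (g j) \<and> L < n j \<and>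
    kappa * real L \<le> (t - s) * real (n j)" for L j
  have ex: "\<exists>j>i. next_ok L j" for i L
  proof -
    have "\<forall>\<^sub>F j in sequentially. max (Suc L) (nat \<lceil>kappa * real L / (t - s)\<rceil>) \<le> n j"
      using n_lim unfolding filterlim_at_top by blast
    with ratio have "\<forall>\<^sub>F j in sequentially. t * real (n j) \<le> kappa * real (g j) \<and>
        max (Suc L) (nat \<lceil>kappa * real L / (t - s)\<rceil>) \<le> n j" by eventually_elim simp
    then obtain N where N: "\<And>j. N \<le> j \<Longrightarrow> t * real (n j) \<le> kappa * real (g j) \<and>
        max (Suc L) (nat \<lceil>kappa * real L / (t - s)\<rceil>) \<le> n j"
      by (auto simp: eventually_sequentially)
    obtain j where j: "j \<in> J" "max N (Suc i) \<le> j"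
      using J by (metis infinite_nat_iff_unbounded_le)
    have "kappa * real L / (t - s) \<le> real (n j)"
      using N[of j] j by linarith
    then have "kappa * real L \<le> (t - s) * real (n j)"
      using s by (simp add: field_simps)
    then show ?thesis using j N[of j] by (intro exI[of _ j]) (auto simp: next_ok_def)
  qed
  obtain \<sigma> where \<sigma>: "\<And>k. k = 0 \<Longrightarrow> next_ok 1 (\<sigma> k)"
    "\<And>k. \<sigma> k < \<sigma> (Suc k) \<and> next_ok (n (\<sigma> k)) (\<sigma> (Suc k))"
    using dependent_nat_choice[of "\<lambda>k j. k = 0 \<longrightarrow> next_ok 1 j" "\<lambda>k i j. i < j \<and> next_ok (n i) j"] ex
    by (metis nat.distinct(1))
  have ok: "next_ok (case k of 0 \<Rightarrow> 1 | Suc l \<Rightarrow> n (\<sigma> l)) (\<sigma> k)" for k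
    using \<sigma> by (cases k) auto
  have "\<exists>R. \<forall>j b. prefix_word (g j) (R j b) = prefix_word (g j) b \<and>
      (j \<in> J \<longrightarrow> (\<forall>c'. prefix_word (n j) c' = prefix_word (n j) (R j b) \<longrightarrow> expansion 3 c' \<in> Z j))"
  proof (intro choice allI)
    fix j b
    show "\<exists>c. prefix_word (g j) c = prefix_word (g j) b \<and>
      (j \<in> J \<longrightarrow> (\<forall>c'. prefix_word (n j) c' = prefix_word (n j) c \<longrightarrow> expansion 3 c' \<in> Z j))"
      using ext[of j b] by (cases "j \<in> J") auto
  qed
  then obtain R where sel: "\<And>j b. prefix_word (g j) (R j b) = prefix_word (g j) b"
    "\<And>j b c'. j \<in> J \<Longrightarrow> prefix_word (n j) c' = prefix_word (n j) (R j b) \<Longrightarrow> expansion 3 c' \<in> Z j"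
    by blast
  interpret tree_selection g n \<sigma> R s t
  proof
    show "t * real (n (\<sigma> k)) \<le> kappa * real (g (\<sigma> k))" for k
      using ok[of k] by (simp add: next_ok_def)
    show "1 < n (\<sigma> 0)" "kappa \<le> (t - s) * real (n (\<sigma> 0))"
      using ok[of 0] by (simp_all add: next_ok_def)
    show "n (\<sigma> k) < n (\<sigma> (Suc k))"
      "kappa * real (n (\<sigma> k)) \<le> (t - s) * real (n (\<sigma> (Suc k)))" for k
      using ok[of "Suc k"] by (simp_all add: next_ok_def)
  qed (use s g_le_n sel(1) in auto)
  have J_\<sigma>: "\<sigma> k \<in> J" for k using ok[of k] by (simp add: next_ok_def)
  have "strict_mono \<sigma>" using \<sigma>(2) by (simp add: strict_mono_Suc_iff)
  have "range (\<lambda>b. expansion 3 (limit_seq b)) \<subseteq> {x \<in> K. infinite {j \<in> J. x \<in> Z j}}"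
  proof clarify
    fix b
    have "expansion 3 (limit_seq b) \<le> 1/3"
      using expansion_unit[of "limit_seq b \<circ> Suc"] limit_seq_0[of b] by (subst expansion_Suc) simp_all
    then have "expansion 3 (limit_seq b) \<in> K"
      using expansion_in_cantor_set[of "limit_seq b"] by (auto simp: K_eq)
    moreover have "range \<sigma> \<subseteq> {j \<in> J. expansion 3 (limit_seq b) \<in> Z j}"
      using J_\<sigma> sel(2)[OF J_\<sigma> prefix_limit_seq_forced] by blast
    moreover have "infinite (range \<sigma>)"
      using \<open>strict_mono \<sigma>\<close> by (simp add: range_inj_infinite strict_mono_imp_inj_on)
    ultimately show "expansion 3 (limit_seq b) \<in> K \<and>
        infinite {j \<in> J. expansion 3 (limit_seq b) \<in> Z j}"
      using finite_subset by blast
  qed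
  then show ?thesis
    using hausdorffT_limit_seq_pos hausdorffT_mono less_le_trans by blast
qed

section \<open>Almost sure lower bounds\<close>

lemma sigmaP_eventually_le:
  assumes "sigmaP PK = ereal \<sigma>" "0 < \<epsilon>"
  shows "\<forall>\<^sub>F j in sequentially. real (card (PK \<inter> Pj j)) \<le> 3 powr ((\<sigma> + \<epsilon>) * real j)"
proof -
  let ?f = "\<lambda>j. if card (PK \<inter> Pj j) = 0 then - \<infinity> else ereal (log 3 (real (card (PK \<inter> Pj j))) / real j)"
  have "limsup ?f < ereal (\<sigma> + \<epsilon>)"
    using assms by (simp add: sigmaP_def)
  then have "\<forall>\<^sub>F j in sequentially. ?f j < ereal (\<sigma> + \<epsilon>)"
    by (rule Limsup_lessD)
  then show ?thesis
    using eventually_gt_at_top[of 0]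
  proof eventually_elim
    case (elim j)
    show ?case
    proof (cases "card (PK \<inter> Pj j) = 0")
      case False
      then have "log 3 (real (card (PK \<inter> Pj j))) / real j < \<sigma> + \<epsilon>" using elim(1) by simp
      then have "log 3 (real (card (PK \<inter> Pj j))) \<le> (\<sigma> + \<epsilon>) * real j"
        using elim(2) by (simp add: field_simps)
      moreover have "0 < real (card (PK \<inter> Pj j))" using False by (simp only: of_nat_0_less_iff neq0_conv)
      ultimately show ?thesis by (subst (asm) log_le_iff) auto
    qed simp
  qed
qed

lemma sigmaP_infinite_ge:
  assumes "sigmaP PK = ereal \<sigma>" "0 < \<epsilon>"
  shows "infinite {j. 3 powr ((\<sigma> - \<epsilon>) * real j) \<le> real (card (PK \<inter> Pj j))}"
proof
  let ?f = "\<lambda>j. if card (PK \<inter> Pj j) = 0 then - \<infinity> else ereal (log 3 (real (card (PK \<inter> Pj j))) / real j)"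
  assume "finite {j. 3 powr ((\<sigma> - \<epsilon>) * real j) \<le> real (card (PK \<inter> Pj j))}"
  then have "\<forall>\<^sub>F j in sequentially. \<not> 3 powr ((\<sigma> - \<epsilon>) * real j) \<le> real (card (PK \<inter> Pj j))"
    by (simp add: eventually_cofinite flip: cofinite_eq_sequentially)
  then have "\<forall>\<^sub>F j in sequentially. ?f j \<le> ereal (\<sigma> - \<epsilon>)"
    using eventually_gt_at_top[of 0]
  proof eventually_elim
    case (elim j)
    show ?case
    proof (cases "card (PK \<inter> Pj j) = 0")
      case False
      then have "0 < real (card (PK \<inter> Pj j))" by (simp only: of_nat_0_less_iff neq0_conv)
      then have "log 3 (real (card (PK \<inter> Pj j))) \<le> (\<sigma> - \<epsilon>) * real j"
        using elim(1) by (subst log_le_iff) auto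
      then show ?thesis using elim(2) False by (simp add: field_simps)
    qed simp
  qed
  then have "limsup ?f \<le> ereal (\<sigma> - \<epsilon>)" by (rule Limsup_bounded)
  then show False using assms by (simp add: sigmaP_def)
qed

text \<open>Because \<open>kappa < 1\<close>, the pairs of \<open>PK\<close> in a block eventually
  number at most \<open>3 ^ j\<close>, negligible against \<open>9 ^ j / 2\<close> reduced
  fractions; one ninth of \<open>9 ^ j\<close> is a convenient remainder.\<close>

lemma eventually_card_Pj_diff_ge:
  assumes "sigmaP PK = ereal kappa"
  shows "\<forall>\<^sub>F j in sequentially. 3 powr (2 * real j - 2) \<le> real (card (Pj j - PK))"
proof -
  have "\<forall>\<^sub>F j in sequentially. real (card (PK \<inter> Pj j)) \<le> 3 powr (1 * real j)"
    using sigmaP_eventually_le[OF assms, of "1 - kappa"] kappa_less_1 by simp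
  moreover have "\<forall>\<^sub>F j in sequentially. 3 powr (2 * real j - 2) \<le> 9 ^ j / 2 - 3 powr (1 * real j)"
    using eventually_ge_at_top[of 1]
  proof eventually_elim
    case (elim j)
    define x :: real where "x = 3 ^ j"
    have "3 \<le> x" using power_increasing[OF elim, of "3 :: real"] by (simp add: x_def)
    then have "x * 3 \<le> x * x" by (intro mult_left_mono) auto
    then have "x * x / 9 \<le> x * x / 2 - x" using \<open>3 \<le> x\<close> by linarith
    moreover have "3 powr (2 * real j - 2) = x * x / 9"
      by (simp add: powr_diff x_def powr_realpow[symmetric] flip: powr_add)
    moreover have "9 ^ j = x * x" by (simp add: x_def flip: power_mult_distrib)
    ultimately show ?case by (simp add: powr_realpow x_def)
  qed
  ultimately show ?thesis
  proof eventually_elim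
    case (elim j)
    have "real (card (Pj j - PK)) = real (card (Pj j)) - real (card (PK \<inter> Pj j))"
      by (simp add: card_Diff_subset_Int Int_commute of_nat_diff card_mono)
    then show ?case using elim card_Pj_ge[of j] by simp
  qed
qed

lemma measure_lebT_branch:
  assumes "finite W" "\<And>w. w \<in> W \<Longrightarrow> length w = n"
  shows "measure lebT (\<Union>w\<in>W. branch w ` {0..1}) = real (card W) / 3 ^ n"
proof -
  interpret prob_space lebT by (rule prob_space_lebT)
  have one: "measure lebT (branch w ` {0..1}) = 1 / 3 ^ length w" for w
  proof -
    have "branch w ` {0..1} \<subseteq> {0..1}" by (rule image_subsetI) (rule branch_in_unit)
    then have "branch w ` {0..1} \<inter> torus = branch w ` {0..1} - {1}"
      by (force simp: torus_def)
    then have "emeasure lebT (branch w ` {0..1}) = emeasure lborel ({branch w 0 .. branch w 0 + 1 / 3 ^ length w} - {1})"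
      unfolding branch_image_unit by (simp add: emeasure_lebT)
    also have "\<dots> = emeasure lborel {branch w 0 .. branch w 0 + 1 / 3 ^ length w}"
      by (rule emeasure_Diff_null_set) auto
    finally show ?thesis by (simp add: measure_def)
  qed
  have "measure lebT (\<Union>w\<in>W. branch w ` {0..1}) = (\<Sum>w\<in>W. measure lebT (branch w ` {0..1}))"
  proof (rule finite_measure_finite_Union)
    show "(\<lambda>w. branch w ` {0..1}) ` W \<subseteq> sets lebT" by (auto simp: branch_image_unit)
    show "disjoint_family_on (\<lambda>w. branch w ` {0..1}) W"
      unfolding disjoint_family_on_def
    proof (intro ballI impI)
      fix u v assume uv: "u \<in> W" "v \<in> W" "u \<noteq> v"
      show "branch u ` {0..1} \<inter> branch v ` {0..1} = {}"
      proof (rule ccontr)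
        assume "\<not> ?thesis"
        then obtain s t where st: "s \<in> {0..1}" "t \<in> {0..1}" "branch u s = branch v t" by blast
        then have "1 / 3 ^ length u \<le> \<bar>branch u s - branch v t\<bar>"
          using uv assms(2) by (intro branch_separated) auto
        moreover have "0 < 1 / (3::real) ^ length u" by simp
        ultimately show False using st by linarith
      qed
    qed
  qed (rule assms)
  also have "\<dots> = (\<Sum>w\<in>W. 1 / 3 ^ n)" using assms(2) one by (intro sum.cong) auto
  finally show ?thesis by simp
qed

text \<open>Full ternary intervals replace their Cantor parts, which are Lebesgue null; a point of
  such an interval is still within its length of every Cantor point there.\<close>

definition subtree :: "bool list \<Rightarrow> nat \<Rightarrow> real set" where
  "subtree w m = (\<Union>u\<in>(@) w ` {v. length v = m}. branch u ` {0..1})"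

lemma measure_lebT_subtree: "measure lebT (subtree w m) = 2 ^ m / 3 ^ (length w + m)"
  unfolding subtree_def
  by (subst measure_lebT_branch[of _ "length w + m"]) (auto simp: card_image inj_on_def card_words)

lemma sets_subtree: "subtree w m \<in> sets borel"
  unfolding subtree_def by (intro sets.finite_UN) (auto simp: branch_image_unit)

text \<open>Balls of radius \<open>q powr - \<nu>\<close> with \<open>q < 3 ^ (j + 1)\<close> contain the cylinders of this
  generation that they meet.\<close>

definition scale :: "real \<Rightarrow> nat \<Rightarrow> nat" where
  "scale \<nu> j = nat \<lceil>(real j + 1) * \<nu>\<rceil> + 1"

lemma scale_bounds:
  assumes "0 < \<nu>"
  shows "(real j + 1) * \<nu> < real (scale \<nu> j)" "real (scale \<nu> j) \<le> (real j + 1) * \<nu> + 2"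
proof -
  have "0 \<le> (real j + 1) * \<nu>" using assms by simp
  then show "(real j + 1) * \<nu> < real (scale \<nu> j)" "real (scale \<nu> j) \<le> (real j + 1) * \<nu> + 2"
    unfolding scale_def by linarith+
qed

lemma scale_lim:
  assumes "0 < \<nu>"
  shows "filterlim (scale \<nu>) at_top sequentially"
proof -
  have "filterlim (\<lambda>j. (real j + 1) * \<nu>) at_top sequentially" using assms by real_asymp
  then have "filterlim (\<lambda>j. real (scale \<nu> j)) at_top sequentially"
    by (rule filterlim_at_top_mono) (use scale_bounds(1)[OF assms] less_imp_le in \<open>auto intro!: always_eventually\<close>)
  then show ?thesis by (simp add: filterlim_sequentially_iff_filterlim_real)
qed

text \<open>A pair belongs to only finitely many blocks \<open>Pj j\<close>, so infinitely many good
  generations force infinitely many good pairs. The strict excess of \<open>scale \<nu> j\<close>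
  over \<open>(j + 1) * \<nu>\<close> turns the weak bound into the strict inequality of
  \<open>Fset\<close>.\<close>

lemma Fset_memI:
  assumes "x \<in> torus" "0 < \<nu>"
    and inf: "infinite {j. \<exists>i\<in>Pj j. \<bar>x - Y i\<bar> \<le> 1 / 3 ^ scale \<nu> j}"
  shows "x \<in> Fset Y \<nu>"
proof -
  define S where "S = {(p, q) \<in> Ppairs. dT x (Y (p, q)) < real q powr (- \<nu>)}"
  have "infinite S"
  proof
    assume "finite S"
    moreover have "finite {j. i \<in> Pj j}" for i
    proof (rule finite_subset)
      show "{j. i \<in> Pj j} \<subseteq> {..snd i}"
      proof
        fix j assume "j \<in> {j. i \<in> Pj j}"
        then have "3 ^ j \<le> snd i" by (auto simp: Pj_def)
        moreover have "j < 3 ^ j" by (rule power_gt_expt) simp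
        ultimately show "j \<in> {..snd i}" by simp
      qed
    qed simp
    ultimately have "finite (\<Union>i\<in>S. {j. i \<in> Pj j})" by blast
    moreover have "{j. \<exists>i\<in>Pj j. \<bar>x - Y i\<bar> \<le> 1 / 3 ^ scale \<nu> j} \<subseteq> (\<Union>i\<in>S. {j. i \<in> Pj j})"
    proof clarify
      fix j p q assume pq: "(p, q) \<in> Pj j" and le: "\<bar>x - Y (p, q)\<bar> \<le> 1 / 3 ^ scale \<nu> j"
      have q: "0 < q" "q < 3 ^ (j + 1)" "(p, q) \<in> Ppairs" using pq by (auto simp: Pj_def Ppairs_def)
      have "dT x (Y (p, q)) \<le> 1 / 3 ^ scale \<nu> j" using dT_le_abs le by (rule order_trans)
      also have "\<dots> = 3 powr - real (scale \<nu> j)" by (simp add: powr_minus_divide powr_realpow)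
      also have "\<dots> < 3 powr - ((real j + 1) * \<nu>)"
        using scale_bounds(1)[OF assms(2)] by (intro powr_less_mono) auto
      also have "\<dots> = (3 ^ (j + 1)) powr - \<nu>"
      proof -
        have "(3 ^ (j + 1)) powr - \<nu> = (3 powr real (j + 1)) powr - \<nu>"
          by (simp only: powr_realpow zero_less_numeral)
        also have "\<dots> = 3 powr (real (j + 1) * - \<nu>)" by (rule powr_powr)
        finally show ?thesis by (simp add: add.commute)
      qed
      also have "\<dots> \<le> real q powr - \<nu>"
      proof (rule powr_mono2')
        have "real q \<le> real (3 ^ (j + 1))" using q(2) by (intro of_nat_mono) simp
        then show "real q \<le> 3 ^ (j + 1)" by simp
      qed (use q(1) assms(2) in auto)
      finally show "j \<in> (\<Union>i\<in>S. {j. i \<in> Pj j})"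
        using q(3) pq by (auto simp: S_def)
    qed
    ultimately show False using inf finite_subset by blast
  qed
  then show ?thesis using assms(1) by (simp add: Fset_def S_def)
qed

lemma eventually_affine_le:
  fixes a b c :: real
  assumes "a < c"
  shows "\<forall>\<^sub>F j in sequentially. a * real j + b \<le> c * real j"
proof -
  have "\<forall>\<^sub>F j in sequentially. nat \<lceil>b / (c - a)\<rceil> \<le> j" by (rule eventually_ge_at_top)
  then show ?thesis
  proof eventually_elim
    case (elim j)
    then have "b / (c - a) \<le> real j" by linarith
    then show ?case using assms by (simp add: field_simps)
  qed
qed

lemma hausdorffT_Fset_pos:
  assumes s: "0 < s" "s < t" and \<nu>: "0 < \<nu>" and J: "infinite J"
    and g: "\<And>j. g j \<le> scale \<nu> j"
    and ratio: "\<forall>\<^sub>F j in sequentially. t * real (scale \<nu> j) \<le> kappa * real (g j)"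
    and ext: "\<forall>\<^sub>F j in sequentially. j \<in> J \<longrightarrow> (\<forall>b. \<exists>c. \<exists>i\<in>Pj j. prefix_word (g j) c = prefix_word (g j) b \<and>
      (\<forall>c'. prefix_word (scale \<nu> j) c' = prefix_word (scale \<nu> j) c \<longrightarrow>
        \<bar>expansion 3 c' - Y i\<bar> \<le> 1 / 3 ^ scale \<nu> j))"
  shows "0 < hausdorffT s (Fset Y \<nu> \<inter> K)"
proof -
  obtain N where N: "\<And>j b. N \<le> j \<Longrightarrow> j \<in> J \<Longrightarrow> \<exists>c. \<exists>i\<in>Pj j. prefix_word (g j) c = prefix_word (g j) b \<and>
      (\<forall>c'. prefix_word (scale \<nu> j) c' = prefix_word (scale \<nu> j) c \<longrightarrow>
        \<bar>expansion 3 c' - Y i\<bar> \<le> 1 / 3 ^ scale \<nu> j)"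
    using ext unfolding eventually_sequentially by blast
  define J' where "J' = J \<inter> {N..}"
  define Z where "Z j = {x. \<exists>i\<in>Pj j. \<bar>x - Y i\<bar> \<le> 1 / 3 ^ scale \<nu> j}" for j
  have "infinite J'"
  proof
    assume "finite J'"
    then have "finite (J' \<union> {..N})" by simp
    moreover have "J \<subseteq> J' \<union> {..N}" by (auto simp: J'_def)
    ultimately show False using J finite_subset by blast
  qed
  have "0 < hausdorffT s {x \<in> K. infinite {j \<in> J'. x \<in> Z j}}"
  proof (rule hausdorffT_limsup_pos[OF s \<open>infinite J'\<close> g scale_lim[OF \<nu>] ratio])
    fix j b assume "j \<in> J'"
    then show "\<exists>c. prefix_word (g j) c = prefix_word (g j) b \<and>
      (\<forall>c'. prefix_word (scale \<nu> j) c' = prefix_word (scale \<nu> j) c \<longrightarrow> expansion 3 c' \<in> Z j)"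
      using N[of j b] unfolding Z_def J'_def by blast
  qed
  also have "\<dots> \<le> hausdorffT s (Fset Y \<nu> \<inter> K)"
  proof (rule hausdorffT_mono, rule subsetI)
    fix x assume x: "x \<in> {x \<in> K. infinite {j \<in> J'. x \<in> Z j}}"
    have "{j \<in> J'. x \<in> Z j} \<subseteq> {j. \<exists>i\<in>Pj j. \<bar>x - Y i\<bar> \<le> 1 / 3 ^ scale \<nu> j}"
      by (auto simp: Z_def)
    then have "infinite {j. \<exists>i\<in>Pj j. \<bar>x - Y i\<bar> \<le> 1 / 3 ^ scale \<nu> j}"
      using x infinite_super by blast
    then show "x \<in> Fset Y \<nu> \<inter> K"
      using x K_subset_torus \<nu> by (auto intro!: Fset_memI)
  qed
  finally show ?thesis .
qed

section \<open>Hitting cylinders almost surely\<close>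

context
  fixes PK :: "(nat \<times> nat) set"
  assumes PK: "PK \<subseteq> Ppairs" and sigma: "sigmaP PK = ereal kappa"
begin

lemma Pj_subset: "Pj j \<subseteq> Ppairs"
  by (auto simp: Pj_def)

lemma AE_hit_subtree:
  assumes \<nu>: "0 < \<nu>" and g: "\<And>j. g j \<le> scale \<nu> j"
    and rate: "\<forall>\<^sub>F j in sequentially. real (g j) * kappa \<le> a * real j" "a < 2 - \<nu> * (1 - kappa)"
  shows "AE Y in Omega PK. \<forall>\<^sub>F j in sequentially. \<forall>w. length w = g j \<longrightarrow>
    (\<exists>i\<in>Pj j. Y i \<in> subtree w (scale \<nu> j - g j))"
proof -
  \<comment> \<open>Half of the exponential margin. The other half absorbs the factor 1/9 in the
    count of points and the rounding in \<open>scale\<close>.\<close>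
  define \<epsilon> where "\<epsilon> = (2 - \<nu> * (1 - kappa) - a) / 2"
  have \<epsilon>: "0 < \<epsilon>" using rate(2) by (simp add: \<epsilon>_def)
  have \<epsilon>_j: "2 * (\<epsilon> * real j) = 2 * real j - \<nu> * (1 - kappa) * real j - a * real j" for j
  proof -
    have "2 * \<epsilon> = 2 - \<nu> * (1 - kappa) - a" by (simp add: \<epsilon>_def)
    from arg_cong[OF this, of "\<lambda>z. z * real j"] show ?thesis by (simp add: algebra_simps)
  qed
  have "\<forall>\<^sub>F j in sequentially. \<epsilon> * real j + (2 + (1 - kappa) * (\<nu> + 2)) \<le> (2 * \<epsilon>) * real j"
    using \<epsilon> by (intro eventually_affine_le) auto
  with eventually_card_Pj_diff_ge[OF sigma] rate(1)
  have many: "\<forall>\<^sub>F j in sequentially. j \<in> UNIV \<longrightarrow>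
      3 powr (\<epsilon> * real j) \<le> real (card (Pj j - PK)) * (2 ^ (scale \<nu> j - g j) / 3 ^ scale \<nu> j)"
  proof eventually_elim
    case (elim j)
    have "(1 - kappa) * real (scale \<nu> j) \<le> (1 - kappa) * ((real j + 1) * \<nu> + 2)"
      using scale_bounds[OF \<nu>] kappa_less_1 by (intro mult_left_mono) auto
    then have "\<epsilon> * real j \<le> 2 * real j - 2 + (kappa * real (scale \<nu> j - g j) - real (scale \<nu> j))"
      using elim(2,3) g[of j] \<epsilon>_j[of j] by (simp add: of_nat_diff algebra_simps)
    then have "3 powr (\<epsilon> * real j)
        \<le> 3 powr (2 * real j - 2 + (kappa * real (scale \<nu> j - g j) - real (scale \<nu> j)))"
      by (intro powr_mono) auto
    also have "\<dots> = 3 powr (2 * real j - 2) * (2 ^ (scale \<nu> j - g j) / 3 ^ scale \<nu> j)"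
      unfolding powr_add powr_diff[of 3 "kappa * _"] powr_3_kappa by (simp add: powr_realpow)
    also have "\<dots> \<le> real (card (Pj j - PK)) * (2 ^ (scale \<nu> j - g j) / 3 ^ scale \<nu> j)"
      using elim(1) by (intro mult_right_mono) auto
    finally show ?case by simp
  qed
  have "AE Y in Omega PK. \<forall>\<^sub>F j in sequentially. j \<in> UNIV \<longrightarrow> (\<forall>w. length w = g j \<longrightarrow>
    (\<exists>i\<in>Pj j - PK. Y i \<in> subtree w (scale \<nu> j - g j)))"
  proof (rule AE_hitting[where p = "\<lambda>j. 2 ^ (scale \<nu> j - g j) / 3 ^ scale \<nu> j", OF _ _ sets_subtree _ _ \<epsilon> many])
    show "2 ^ (scale \<nu> j - g j) / 3 ^ scale \<nu> j \<le> measure (Ydist PK i) (subtree w (scale \<nu> j - g j))"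
      if "length w = g j" "i \<in> Pj j - PK" for j w i
      using that g[of j] by (simp add: Ydist_def measure_lebT_subtree)
    show "0 < max 1 (a / kappa)" by simp
    show "\<forall>\<^sub>F j in sequentially. real (g j) \<le> max 1 (a / kappa) * real j"
      using rate(1)
    proof eventually_elim
      case (elim j)
      then have "real (g j) \<le> (a / kappa) * real j" using kappa_pos by (simp add: field_simps)
      also have "\<dots> \<le> max 1 (a / kappa) * real j" by (intro mult_right_mono) auto
      finally show "real (g j) \<le> max 1 (a / kappa) * real j" .
    qed
  qed (use Pj_subset in auto)
  then show ?thesis
    by eventually_elim (auto elim!: eventually_mono)
qed

lemma AE_K_subset_Fset:
  assumes \<nu>: "0 < \<nu>" "\<nu> < 2"
  shows "AE Y in Omega PK. K \<subseteq> Fset Y \<nu>"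
proof -
  \<comment> \<open>Midpoint between the rate \<open>kappa * \<nu>\<close> needed for
    \<open>g = scale \<nu>\<close> and the admissible limit; the two differ by
    \<open>2 - \<nu>\<close>, so this is where \<open>\<nu> < 2\<close> enters.\<close>
  define a where "a = (\<nu> * kappa + (2 - \<nu> * (1 - kappa))) / 2"
  have a: "kappa * \<nu> < a" "a < 2 - \<nu> * (1 - kappa)"
    using \<nu> by (simp_all add: a_def field_simps)
  have "\<forall>\<^sub>F j in sequentially. (kappa * \<nu>) * real j + kappa * (\<nu> + 2) \<le> a * real j"
    by (rule eventually_affine_le) (rule a)
  then have "\<forall>\<^sub>F j in sequentially. real (scale \<nu> j) * kappa \<le> a * real j"
  proof eventually_elim
    case (elim j)
    have "kappa * real (scale \<nu> j) \<le> kappa * ((real j + 1) * \<nu> + 2)"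
      using scale_bounds[OF \<nu>(1)] kappa_pos by (intro mult_left_mono) auto
    then show ?case using elim by (simp add: algebra_simps)
  qed
  from AE_hit_subtree[OF \<nu>(1) order_refl this a(2)]
  show ?thesis
  proof eventually_elim
    case (elim Y)
    then obtain N where N: "\<And>j w. N \<le> j \<Longrightarrow> length w = scale \<nu> j \<Longrightarrow> \<exists>i\<in>Pj j. Y i \<in> subtree w 0"
      by (auto simp: eventually_sequentially)
    show ?case
    proof
      fix x assume x: "x \<in> K"
      then obtain b where b: "x = expansion 3 b" by (auto simp: K_eq cantor_set_eq_range)
      have "\<exists>i\<in>Pj j. \<bar>x - Y i\<bar> \<le> 1 / 3 ^ scale \<nu> j" if "N \<le> j" for j
      proof -
        define w where "w = prefix_word (scale \<nu> j) b"
        have w: "length w = scale \<nu> j" by (simp add: w_def)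
        from N[OF that w] obtain i y where i: "i \<in> Pj j" "Y i = branch w y" "y \<in> {0..1}"
          by (auto simp: subtree_def)
        have "x = branch w (expansion 3 (\<lambda>k. b (k + scale \<nu> j)))"
          unfolding b w_def by (rule expansion_3_branch)
        then have "\<bar>x - Y i\<bar> \<le> 1 / 3 ^ length w"
          using i branch_diff_le[OF expansion_unit i(3)] by simp
        then show ?thesis using i(1) w by auto
      qed
      then have "{N..} \<subseteq> {j. \<exists>i\<in>Pj j. \<bar>x - Y i\<bar> \<le> 1 / 3 ^ scale \<nu> j}" by auto
      then have "infinite {j. \<exists>i\<in>Pj j. \<bar>x - Y i\<bar> \<le> 1 / 3 ^ scale \<nu> j}"
        using infinite_Ici infinite_super by blast
      then show "x \<in> Fset Y \<nu>"
        using x K_subset_torus \<nu>(1) by (intro Fset_memI) auto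
    qed
  qed
qed

lemma AE_hausdorffT_Fset_pos_lebesgue:
  assumes \<nu>: "2 \<le> \<nu>" and s: "0 < s" "s < 2 / \<nu> + kappa - 1"
  shows "AE Y in Omega PK. 0 < hausdorffT s (Fset Y \<nu> \<inter> K)"
proof -
  have \<nu>0: "0 < \<nu>" using \<nu> by simp
  obtain t where t: "s < t" "t < 2 / \<nu> + kappa - 1" using dense[OF s(2)] by blast
  have "t * \<nu> < 2 - \<nu> * (1 - kappa)"
    using mult_strict_right_mono[OF t(2) \<nu>0] \<nu>0 by (simp add: algebra_simps)
  then obtain a where a: "t * \<nu> < a" "a < 2 - \<nu> * (1 - kappa)" using dense by blast
  have a0: "0 < a" using s(1) t(1) \<nu>0 a(1) mult_pos_pos[of t \<nu>] by linarith
  \<comment> \<open>\<open>a\<close> is the \<kappa>-weighted rate of free digits: above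
    \<open>t * \<nu>\<close> for the dimension, below \<open>2 - \<nu> * (1 - kappa)\<close> for
    hitting.\<close>
  define g where "g j = nat \<lfloor>a * real j / kappa\<rfloor>" for j
  have quot: "0 \<le> a * real j / kappa" for j using a0 kappa_pos by simp
  have g_le: "real (g j) \<le> a * real j / kappa" for j
    using quot[of j] unfolding g_def by linarith
  have g_ge: "a * real j / kappa - 1 \<le> real (g j)" for j
    using quot[of j] unfolding g_def by linarith
  have g_scale: "g j \<le> scale \<nu> j" for j
  proof -
    \<comment> \<open>For \<open>2 \<le> \<nu>\<close> the hitting limit is at most
      \<open>kappa * \<nu>\<close>, so the free part fits below
      \<open>scale \<nu> j\<close>.\<close>
    have "a \<le> kappa * \<nu>" using a(2) \<nu> by (simp add: algebra_simps)
    then have "a * real j / kappa \<le> \<nu> * real j"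
      using kappa_pos mult_right_mono[of a "kappa * \<nu>" "real j"] by (simp add: field_simps)
    then have "real (g j) \<le> real (scale \<nu> j)"
      using g_le[of j] scale_bounds(1)[OF \<nu>0, of j] \<nu>0 by (simp add: algebra_simps)
    then show ?thesis by simp
  qed
  have rate: "\<forall>\<^sub>F j in sequentially. real (g j) * kappa \<le> a * real j"
    using g_le kappa_pos by (intro always_eventually allI) (simp add: field_simps)
  have "\<forall>\<^sub>F j in sequentially. (t * \<nu>) * real j + (t * (\<nu> + 2) + kappa) \<le> a * real j"
    by (rule eventually_affine_le) (rule a)
  then have ratio: "\<forall>\<^sub>F j in sequentially. t * real (scale \<nu> j) \<le> kappa * real (g j)"
  proof eventually_elim
    case (elim j)
    have "t * real (scale \<nu> j) \<le> t * ((real j + 1) * \<nu> + 2)"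
      using scale_bounds[OF \<nu>0] s t by (intro mult_left_mono) auto
    also have "\<dots> \<le> a * real j - kappa" using elim by (simp add: algebra_simps)
    also have "\<dots> = kappa * (a * real j / kappa - 1)" using kappa_pos by (simp add: algebra_simps)
    also have "\<dots> \<le> kappa * real (g j)" using g_ge kappa_pos by (intro mult_left_mono) auto
    finally show ?case .
  qed
  from AE_hit_subtree[OF \<nu>0 g_scale rate a(2)]
  show ?thesis
  proof eventually_elim
    case (elim Y)
    show ?case
    proof (rule hausdorffT_Fset_pos[OF s(1) t(1) \<nu>0 _ g_scale ratio, of UNIV])
      show "\<forall>\<^sub>F j in sequentially. j \<in> UNIV \<longrightarrow> (\<forall>b. \<exists>c. \<exists>i\<in>Pj j. prefix_word (g j) c = prefix_word (g j) b \<and>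
          (\<forall>c'. prefix_word (scale \<nu> j) c' = prefix_word (scale \<nu> j) c \<longrightarrow>
            \<bar>expansion 3 c' - Y i\<bar> \<le> 1 / 3 ^ scale \<nu> j))"
        using elim
      proof eventually_elim
        case (elim j)
        show ?case
        proof (intro impI allI)
          fix b
          define w where "w = prefix_word (g j) b"
          have w: "length w = g j" by (simp add: w_def)
          with elim obtain i where i: "i \<in> Pj j" "Y i \<in> subtree w (scale \<nu> j - g j)" by blast
          then obtain v y where v: "length v = scale \<nu> j - g j" "Y i = branch (w @ v) y" "y \<in> {0..1}"
            by (auto simp: subtree_def)
          define c where "c k \<longleftrightarrow> k < length (w @ v) \<and> (w @ v) ! k" for k
          have len: "length (w @ v) = scale \<nu> j" using v w g_scale[of j] by simp
          have c: "prefix_word (scale \<nu> j) c = w @ v"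
            unfolding c_def len[symmetric] by (rule prefix_word_nth)
          have "prefix_word (g j) c = prefix_word (g j) b"
            unfolding prefix_word_eq_iff
            using w by (auto simp: c_def nth_append w_def prefix_word_def)
          moreover have "\<bar>expansion 3 c' - Y i\<bar> \<le> 1 / 3 ^ scale \<nu> j"
            if "prefix_word (scale \<nu> j) c' = prefix_word (scale \<nu> j) c" for c'
          proof -
            have "expansion 3 c' = branch (w @ v) (expansion 3 (\<lambda>k. c' (k + scale \<nu> j)))"
              using expansion_3_branch[of c' "scale \<nu> j"] that c by simp
            then show ?thesis
              using branch_diff_le[OF expansion_unit v(3), of "w @ v"] v(2) len by simp
          qed
          ultimately show "\<exists>c. \<exists>i\<in>Pj j. prefix_word (g j) c = prefix_word (g j) b \<and>
            (\<forall>c'. prefix_word (scale \<nu> j) c' = prefix_word (scale \<nu> j) c \<longrightarrow>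
              \<bar>expansion 3 c' - Y i\<bar> \<le> 1 / 3 ^ scale \<nu> j)"
            using i(1) by blast
        qed
      qed
    qed simp
  qed
qed

lemma AE_hausdorffT_Fset_pos_K:
  assumes \<nu>: "1 \<le> \<nu>" and s: "0 < s" "s < kappa / \<nu>"
  shows "AE Y in Omega PK. 0 < hausdorffT s (Fset Y \<nu> \<inter> K)"
proof -
  have \<nu>0: "0 < \<nu>" using \<nu> by simp
  obtain t where t: "s < t" "t < kappa / \<nu>" using dense[OF s(2)] by blast
  have "t * \<nu> < kappa" using t(2) \<nu>0 by (simp add: field_simps)
  then obtain a where a: "t * \<nu> < a" "a < kappa" using dense by blast
  \<comment> \<open>\<open>kappa - \<epsilon>\<close> is the growth rate of the number of centres
    along \<open>J\<close>, and \<open>a\<close> the \<kappa>-weighted rate of \<open>g\<close>;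
    this choice leaves exactly \<epsilon> between them.\<close>
  define \<epsilon> where "\<epsilon> = (kappa - a) / 2"
  have \<epsilon>: "0 < \<epsilon>" using a by (simp add: \<epsilon>_def)
  define J where "J = {j. 3 powr ((kappa - \<epsilon>) * real j) \<le> real (card (PK \<inter> Pj j))}"
  have J: "infinite J" unfolding J_def by (rule sigmaP_infinite_ge[OF sigma \<epsilon>])
  have a0: "0 < a" using s(1) t(1) \<nu>0 a(1) mult_pos_pos[of t \<nu>] by linarith
  define g where "g j = nat \<lfloor>a * real j / kappa\<rfloor>" for j
  have quot: "0 \<le> a * real j / kappa" for j using a0 kappa_pos by simp
  have g_le: "real (g j) \<le> a * real j / kappa" for j
    using quot[of j] unfolding g_def by linarith
  have g_ge: "a * real j / kappa - 1 \<le> real (g j)" for j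
    using quot[of j] unfolding g_def by linarith
  have g_le_j: "real (g j) \<le> 1 * real j" for j
  proof -
    have "a * real j / kappa \<le> real j"
      using a(2) kappa_pos mult_right_mono[of a kappa "real j"] by (simp add: field_simps)
    then show ?thesis using g_le[of j] by simp
  qed
  have g_scale: "g j \<le> scale \<nu> j" for j
  proof -
    have "real j \<le> \<nu> * real j" using mult_right_mono[OF \<nu>, of "real j"] by simp
    then have "real (g j) \<le> real (scale \<nu> j)"
      using g_le_j[of j] scale_bounds(1)[OF \<nu>0, of j] \<nu>0 by (simp add: algebra_simps)
    then show ?thesis by simp
  qed
  have "\<forall>\<^sub>F j in sequentially. (t * \<nu>) * real j + (t * (\<nu> + 2) + kappa) \<le> a * real j"
    by (rule eventually_affine_le) (rule a)
  then have ratio: "\<forall>\<^sub>F j in sequentially. t * real (scale \<nu> j) \<le> kappa * real (g j)"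
  proof eventually_elim
    case (elim j)
    have "t * real (scale \<nu> j) \<le> t * ((real j + 1) * \<nu> + 2)"
      using scale_bounds[OF \<nu>0] s t by (intro mult_left_mono) auto
    also have "\<dots> \<le> a * real j - kappa" using elim by (simp add: algebra_simps)
    also have "\<dots> = kappa * (a * real j / kappa - 1)" using kappa_pos by (simp add: algebra_simps)
    also have "\<dots> \<le> kappa * real (g j)" using g_ge kappa_pos by (intro mult_left_mono) auto
    finally show ?case .
  qed
  have many: "\<forall>\<^sub>F j in sequentially. j \<in> J \<longrightarrow> 3 powr (\<epsilon> * real j) \<le> real (card (PK \<inter> Pj j)) * (1 / 2 ^ g j)"
  proof (intro always_eventually allI impI)
    fix j assume j: "j \<in> J"
    have "kappa * real (g j) \<le> a * real j" using g_le[of j] kappa_pos by (simp add: field_simps)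
    then have "\<epsilon> * real j \<le> (kappa - \<epsilon>) * real j + kappa * - real (g j)"
      by (simp add: \<epsilon>_def field_simps)
    then have "3 powr (\<epsilon> * real j) \<le> 3 powr ((kappa - \<epsilon>) * real j + kappa * - real (g j))"
      by (intro powr_mono) auto
    also have "\<dots> = 3 powr ((kappa - \<epsilon>) * real j) * (1 / 2 ^ g j)"
      unfolding powr_add powr_3_kappa by (simp add: powr_minus_divide powr_realpow)
    also have "\<dots> \<le> real (card (PK \<inter> Pj j)) * (1 / 2 ^ g j)"
      using j by (intro mult_right_mono) (auto simp: J_def)
    finally show "3 powr (\<epsilon> * real j) \<le> real (card (PK \<inter> Pj j)) * (1 / 2 ^ g j)" .
  qed
  have "AE Y in Omega PK. \<forall>\<^sub>F j in sequentially. j \<in> J \<longrightarrow> (\<forall>w. length w = g j \<longrightarrow>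
      (\<exists>i\<in>PK \<inter> Pj j. Y i \<in> branch w ` cantor_set))"
  proof (rule AE_hitting[where p = "\<lambda>j. 1 / 2 ^ g j", OF _ _ sets_branch_cantor_set _ _ \<epsilon> many zero_less_one])
    show "1 / 2 ^ g j \<le> measure (Ydist PK i) (branch w ` cantor_set)"
      if "length w = g j" "i \<in> PK \<inter> Pj j" for j w i
      using that by (simp add: Ydist_def measure_muK_branch)
    show "\<forall>\<^sub>F j in sequentially. real (g j) \<le> 1 * real j"
      using g_le_j by (intro always_eventually allI)
  qed (use PK in auto)
  then show ?thesis
  proof eventually_elim
    case (elim Y)
    show ?case
    proof (rule hausdorffT_Fset_pos[OF s(1) t(1) \<nu>0 J g_scale ratio])
      show "\<forall>\<^sub>F j in sequentially. j \<in> J \<longrightarrow> (\<forall>b. \<exists>c. \<exists>i\<in>Pj j. prefix_word (g j) c = prefix_word (g j) b \<and>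
          (\<forall>c'. prefix_word (scale \<nu> j) c' = prefix_word (scale \<nu> j) c \<longrightarrow>
            \<bar>expansion 3 c' - Y i\<bar> \<le> 1 / 3 ^ scale \<nu> j))"
        using elim
      proof eventually_elim
        case (elim j)
        show ?case
        proof (intro impI allI)
          fix b assume j: "j \<in> J"
          define w where "w = prefix_word (g j) b"
          have w: "length w = g j" by (simp add: w_def)
          with elim j obtain i where i: "i \<in> Pj j" "Y i \<in> branch w ` cantor_set" by blast
          then obtain y where y: "y \<in> cantor_set" "Y i = branch w y" by blast
          \<comment> \<open>The code of the centre itself is the extension: sequences sharing
            \<open>scale \<nu> j\<close> digits with it give points within
            \<open>1 / 3 ^ scale \<nu> j\<close> of the centre.\<close>
          then obtain c where c: "Y i = expansion 3 c"
            using branch_cantor_set[of y w] by (auto simp: cantor_set_eq_range)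
          have "prefix_word (g j) c = w"
          proof (rule ccontr)
            assume "prefix_word (g j) c \<noteq> w"
            then have "1 / 3 ^ length (prefix_word (g j) c)
                \<le> \<bar>branch (prefix_word (g j) c) (expansion 3 (\<lambda>k. c (k + g j))) - branch w y\<bar>"
              using y cantor_set_subset w by (intro branch_separated expansion_unit) auto
            moreover have "0 < 1 / (3::real) ^ length (prefix_word (g j) c)" by simp
            ultimately show False
              using y(2) c expansion_3_branch[of c "g j"] by linarith
          qed
          moreover have "\<bar>expansion 3 c' - Y i\<bar> \<le> 1 / 3 ^ scale \<nu> j"
            if "prefix_word (scale \<nu> j) c' = prefix_word (scale \<nu> j) c" for c'
            unfolding c using that by (intro expansion_diff_le) auto
          ultimately show "\<exists>c. \<exists>i\<in>Pj j. prefix_word (g j) c = prefix_word (g j) b \<and>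
            (\<forall>c'. prefix_word (scale \<nu> j) c' = prefix_word (scale \<nu> j) c \<longrightarrow>
              \<bar>expansion 3 c' - Y i\<bar> \<le> 1 / 3 ^ scale \<nu> j)"
            using i(1) w_def by blast
        qed
      qed
    qed
  qed
qed

end

section \<open>Almost sure upper bound\<close>

text \<open>The three integer shifts account for wrap-around. Adding the complement of
  \<open>torus\<close> makes membership follow for arbitrary values of \<open>Y\<close>, at no cost
  since \<open>lebT\<close> vanishes there.\<close>

definition cantor_neighbourhood :: "nat \<Rightarrow> real set" where
  "cantor_neighbourhood m = (\<Union>w\<in>{w. length w = m}. \<Union>z\<in>{-1..1::int}.
     {branch w 0 - of_int z - 1 / 3 ^ m .. branch w 0 - of_int z + 2 / 3 ^ m}) \<union> - torus"

lemma sets_cantor_neighbourhood [measurable]: "cantor_neighbourhood m \<in> sets borel"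
  unfolding cantor_neighbourhood_def by (intro sets.Un sets.finite_UN) auto

lemma emeasure_cantor_neighbourhood_le:
  "emeasure lebT (cantor_neighbourhood m) \<le> ennreal (9 * 2 ^ m / 3 ^ m)"
proof -
  let ?I = "\<lambda>w z. {branch w 0 - of_int z - 1 / 3 ^ m .. branch w 0 - of_int z + 2 / 3 ^ m} :: real set"
  let ?N = "\<Union>w\<in>{w. length w = m}. \<Union>z\<in>{-1..1::int}. ?I w z"
  have "emeasure lebT (cantor_neighbourhood m) = emeasure lborel (cantor_neighbourhood m \<inter> torus)"
    by (simp add: emeasure_lebT)
  also have "\<dots> \<le> emeasure lborel ?N"
    by (rule emeasure_mono) (auto simp: cantor_neighbourhood_def intro!: sets.finite_UN)
  also have "\<dots> \<le> (\<Sum>w\<in>{w. length w = m}. emeasure lborel (\<Union>z\<in>{-1..1::int}. ?I w z))"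
    by (rule emeasure_subadditive_finite) (auto intro!: sets.finite_UN)
  also have "\<dots> \<le> (\<Sum>w\<in>{w :: bool list. length w = m}. \<Sum>z\<in>{-1..1::int}. emeasure lborel (?I w z))"
    by (intro sum_mono emeasure_subadditive_finite) auto
  also have "\<dots> = (\<Sum>w\<in>{w :: bool list. length w = m}. \<Sum>z\<in>{-1..1::int}. ennreal (3 / 3 ^ m))"
    by (intro sum.cong refl, subst emeasure_lborel_Icc) (auto simp: field_simps)
  also have "\<dots> = (\<Sum>w\<in>{w :: bool list. length w = m}. \<Sum>z\<in>{-1..1::int}. 1) * ennreal (3 / 3 ^ m)"
    by (simp add: sum_distrib_right mult.assoc)
  also have "(\<Sum>w\<in>{w :: bool list. length w = m}. \<Sum>z\<in>{-1..1::int}. 1) = ennreal (real (2 ^ m * 3))"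
    by (simp only: sum_constant card_words ennreal_of_nat_eq_real_of_nat[symmetric]) simp
  also have "ennreal (real (2 ^ m * 3)) * ennreal (3 / 3 ^ m) = ennreal (9 * 2 ^ m / 3 ^ m)"
    by (subst ennreal_mult[symmetric]) (simp_all add: mult.commute)
  finally show ?thesis .
qed

lemma cantor_neighbourhood_memI:
  assumes x: "x \<in> K" and "dT x y < 1 / 3 ^ m"
  shows "y \<in> cantor_neighbourhood m"
proof (cases "y \<in> torus")
  case True
  have "x \<in> {0..1}" "x \<in> cantor_set" using x K_subset_torus by (auto simp: torus_def K_eq)
  moreover have "y \<in> {0..1}" using True by (auto simp: torus_def)
  ultimately obtain z :: int where z: "z \<in> {-1..1}" "\<bar>x - y - of_int z\<bar> < 1 / 3 ^ m"
    using dT_lessE[OF assms(2)] by blast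
  obtain w t where w: "length w = m" "t \<in> cantor_set" "x = branch w t"
    using subsetD[OF equalityD1[OF cantor_set_eq_UN_branch[of m]] \<open>x \<in> cantor_set\<close>] by blast
  have "x \<in> branch w ` {0..1}" using w cantor_set_subset by blast
  then have "branch w 0 \<le> x" "x \<le> branch w 0 + 1 / 3 ^ m"
    unfolding branch_image_unit using w(1) by auto
  then have "y \<in> {branch w 0 - of_int z - 1 / 3 ^ m .. branch w 0 - of_int z + 2 / 3 ^ m}"
    using z(2) by auto
  then show ?thesis unfolding cantor_neighbourhood_def using z(1) w(1) by blast
qed (simp add: cantor_neighbourhood_def)

text \<open>Covers are sequences, while the estimates are by blocks. Counting measure reorders the
  series over encoded pairs, and each reduced pair lies in some \<open>Pj j\<close>.\<close>

lemma suminf_prod_decode_le: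
  fixes h :: "nat \<times> nat \<Rightarrow> ennreal"
  assumes "\<And>i. i \<notin> Ppairs \<Longrightarrow> h i = 0"
  shows "(\<Sum>n. h (prod_decode n)) \<le> (\<Sum>j. \<Sum>i\<in>Pj j. h i)"
proof -
  have le: "h i \<le> (\<Sum>j. h i * indicator (Pj j) i)" for i
  proof (cases "i \<in> Ppairs")
    case True
    then obtain p q where pq: "i = (p, q)" "p < q" by (auto simp: Ppairs_def)
    then obtain j where "3 ^ j \<le> q" "q < 3 ^ (j + 1)"
      using ex_power_ivl1[of 3 q] by auto
    then have "i \<in> Pj j" using True pq by (simp add: Pj_def)
    then have "h i = (\<Sum>j\<in>{j}. h i * indicator (Pj j) i)" by simp
    also have "\<dots> \<le> (\<Sum>j. h i * indicator (Pj j) i)" by (rule sum_le_suminf) auto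
    finally show ?thesis .
  qed (simp add: assms)
  have "(\<Sum>n. h (prod_decode n)) = (\<integral>\<^sup>+ i. h i \<partial>count_space UNIV)"
    using nn_integral_bij_count_space[OF bij_prod_decode, of h] by (simp add: nn_integral_count_space_nat)
  also have "\<dots> \<le> (\<integral>\<^sup>+ i. (\<Sum>j. h i * indicator (Pj j) i) \<partial>count_space UNIV)"
    by (intro nn_integral_mono le)
  also have "\<dots> = (\<Sum>j. \<integral>\<^sup>+ i. h i * indicator (Pj j) i \<partial>count_space UNIV)"
    by (rule nn_integral_suminf) simp
  also have "\<dots> = (\<Sum>j. \<Sum>i\<in>Pj j. h i)"
    by (simp add: nn_integral_count_space_indicator[symmetric] nn_integral_count_space_finite)
  finally show ?thesis .
qed

lemma summable_geometric_powr: "\<delta> < 0 \<Longrightarrow> summable (\<lambda>j. 3 powr (\<delta> * real j))"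
proof -
  assume "\<delta> < 0"
  then have "3 powr \<delta> < 3 powr (0::real)" by (intro powr_less_mono) auto
  then have "summable (\<lambda>j. (3 powr \<delta>) ^ j)" by (intro summable_geometric) simp
  then show ?thesis by (simp add: powr_powr[symmetric] powr_realpow)
qed

lemma two_thirds_power: "(2 / 3) ^ m = 3 powr ((kappa - 1) * real m)"
proof -
  have "3 powr ((kappa - 1) * real m) = 3 powr (kappa * real m) / 3 powr real m"
    by (simp add: left_diff_distrib powr_diff)
  then show ?thesis by (simp only: powr_3_kappa) (simp add: powr_realpow power_divide)
qed

lemma AE_hausdorffT_Fset_eq_0:
  assumes sigma: "sigmaP PK = ereal kappa"
    and \<nu>: "0 < \<nu>" and s: "2 / \<nu> + kappa - 1 < s" "kappa / \<nu> < s"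
  shows "AE Y in Omega PK. hausdorffT s (Fset Y \<nu> \<inter> K) = 0"
proof -
  have s0: "0 < s" using s(2) \<nu> kappa_pos divide_pos_pos[of kappa \<nu>] by linarith
  define m where "m j = nat \<lfloor>real j * \<nu>\<rfloor>" for j
  have m: "real (m j) \<le> real j * \<nu>" "real j * \<nu> - 1 \<le> real (m j)" for j
  proof -
    have "0 \<le> real j * \<nu>" using \<nu> by simp
    then show "real (m j) \<le> real j * \<nu>" "real j * \<nu> - 1 \<le> real (m j)" unfolding m_def by linarith+
  qed
  define r where "r j = (2 * 3 powr (- (real j * \<nu>))) powr s" for j
  define ball where "ball Y i = (case i of (p, q) \<Rightarrow>
    if (p, q) \<in> Ppairs then {x \<in> K. dT x (Y (p, q)) < real q powr (- \<nu>)} else {})"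
    for Y :: "nat \<times> nat \<Rightarrow> real" and i
  \<comment> \<open>A measurable majorant of the ball's contribution, depending on
    \<open>Y i\<close> alone: a ball can meet \<open>K\<close> only if its centre is near
    \<open>K\<close>. For pairs in \<open>PK\<close> that is no restriction, so the factor is 1. The
    bound \<open>r j\<close> comes from twice the largest radius in the block.\<close>
  define f where "f j i Y = (if i \<in> PK then 1 else indicator (cantor_neighbourhood (m j)) (Y i)) * ennreal (r j)"
    for j i and Y :: "nat \<times> nat \<Rightarrow> real"
  have f_measurable: "f j i \<in> borel_measurable (Omega PK)" if "i \<in> Pj j" for i j
  proof -
    have [measurable]: "(\<lambda>Y. Y i) \<in> borel_measurable (Omega PK)"
      using that by (intro measurable_Omega_component) (auto simp: Pj_def)
    show ?thesis unfolding f_def by (cases "i \<in> PK") simp_all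
  qed
  have ball_le: "hcontrib s (ball Y i) \<le> f j i Y" if i: "i \<in> Pj j" for Y i j
  proof -
    obtain p q where pq: "i = (p, q)" "(p, q) \<in> Ppairs" "3 ^ j \<le> q" using i by (auto simp: Pj_def)
    have "real q powr (- \<nu>) \<le> (3 ^ j) powr (- \<nu>)"
    proof (rule powr_mono2')
      have "real (3 ^ j) \<le> real q" using pq(3) by (rule of_nat_mono)
      then show "3 ^ j \<le> real q" by simp
    qed (use \<nu> in auto)
    also have "(3 ^ j) powr (- \<nu>) = 3 powr (- (real j * \<nu>))"
      by (simp add: powr_powr flip: powr_realpow)
    finally have q: "real q powr (- \<nu>) \<le> 3 powr (- (real j * \<nu>))" .
    show ?thesis
    proof (cases "ball Y i = {}")
      case False
      then obtain x where x: "x \<in> K" "dT x (Y i) < real q powr (- \<nu>)"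
        using pq by (auto simp: ball_def)
      have "3 powr (- (real j * \<nu>)) \<le> 3 powr (- real (m j))"
        using m(1) by (intro powr_mono) auto
      also have "\<dots> = 1 / 3 ^ m j" by (simp add: powr_minus_divide powr_realpow)
      finally have "dT x (Y i) < 1 / 3 ^ m j" using x(2) q by linarith
      then have near: "Y i \<in> cantor_neighbourhood (m j)" using x(1) by (rule cantor_neighbourhood_memI[rotated])
      have "diamT (ball Y i) \<le> 2 * 3 powr (- (real j * \<nu>))"
      proof (rule diamT_le)
        fix a b assume "a \<in> ball Y i" "b \<in> ball Y i"
        then have "dT a (Y i) < real q powr (- \<nu>)" "dT b (Y i) < real q powr (- \<nu>)"
          using pq by (auto simp: ball_def)
        then show "dT a b \<le> 2 * 3 powr (- (real j * \<nu>))"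
          using dT_triangle[of a b "Y i"] dT_commute[of "Y i" b] q by linarith
      qed simp
      then have "hcontrib s (ball Y i) \<le> ennreal (r j)"
        unfolding r_def by (rule hcontrib_le[OF s0])
      then show ?thesis using near by (simp add: f_def)
    qed simp
  qed
  have integral_le: "(\<Sum>i\<in>Pj j. \<integral>\<^sup>+ Y. f j i Y \<partial>Omega PK)
      \<le> ennreal ((real (card (PK \<inter> Pj j)) + 9 ^ (j + 1) * (9 * (2 / 3) ^ m j)) * r j)" for j
  proof -
    have one: "(\<integral>\<^sup>+ Y. f j i Y \<partial>Omega PK) \<le> ennreal (((if i \<in> PK then 1 else 0) + 9 * (2 / 3) ^ m j) * r j)"
      if i: "i \<in> Pj j" for i
    proof (cases "i \<in> PK")
      case True
      interpret prob_space "Omega PK" by (rule prob_space_Omega)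
      have "(\<integral>\<^sup>+ Y. f j i Y \<partial>Omega PK) = ennreal (r j)"
        using True by (simp add: f_def emeasure_space_1)
      also have "\<dots> \<le> ennreal ((1 + 9 * (2 / 3) ^ m j) * r j)"
        by (intro ennreal_leI) (simp add: r_def algebra_simps)
      finally show ?thesis using True by simp
    next
      case False
      have iP: "i \<in> Ppairs" using i by (auto simp: Pj_def)
      have [measurable]: "(\<lambda>Y. Y i) \<in> borel_measurable (Omega PK)"
        using iP by (rule measurable_Omega_component)
      have "(\<integral>\<^sup>+ Y. f j i Y \<partial>Omega PK)
          = (\<integral>\<^sup>+ Y. indicator {Y \<in> space (Omega PK). Y i \<in> cantor_neighbourhood (m j)} Y * ennreal (r j) \<partial>Omega PK)"
        using False by (intro nn_integral_cong) (auto simp: f_def indicator_def)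
      also have "\<dots> = emeasure (Omega PK) {Y \<in> space (Omega PK). Y i \<in> cantor_neighbourhood (m j)} * ennreal (r j)"
        by (subst nn_integral_multc) auto
      also have "\<dots> = emeasure lebT (cantor_neighbourhood (m j)) * ennreal (r j)"
        using False by (simp add: emeasure_Omega_component[OF iP] Ydist_def)
      also have "\<dots> \<le> ennreal (9 * 2 ^ m j / 3 ^ m j) * ennreal (r j)"
        by (intro mult_right_mono emeasure_cantor_neighbourhood_le) simp
      also have "\<dots> = ennreal (((if i \<in> PK then 1 else 0) + 9 * (2 / 3) ^ m j) * r j)"
        using False by (subst ennreal_mult[symmetric]) (auto simp: r_def power_divide)
      finally show ?thesis .
    qed
    have "(\<Sum>i\<in>Pj j. \<integral>\<^sup>+ Y. f j i Y \<partial>Omega PK)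
        \<le> (\<Sum>i\<in>Pj j. ennreal (((if i \<in> PK then 1 else 0) + 9 * (2 / 3) ^ m j) * r j))"
      by (rule sum_mono) (rule one)
    also have "\<dots> = ennreal (\<Sum>i\<in>Pj j. ((if i \<in> PK then 1 else 0) + 9 * (2 / 3) ^ m j) * r j)"
      by (rule sum_ennreal) (auto simp: r_def)
    also have "(\<Sum>i\<in>Pj j. ((if i \<in> PK then 1 else 0) + 9 * (2 / 3) ^ m j) * r j)
        = (real (card (PK \<inter> Pj j)) + real (card (Pj j)) * (9 * (2 / 3) ^ m j)) * r j"
      by (simp add: sum_distrib_right[symmetric] sum.distrib sum.If_cases Int_commute)
    also have "\<dots> \<le> (real (card (PK \<inter> Pj j)) + 9 ^ (j + 1) * (9 * (2 / 3) ^ m j)) * r j"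
    proof (intro mult_right_mono add_left_mono)
      show "real (card (Pj j)) \<le> 9 ^ (j + 1)"
        using of_nat_mono[OF card_Pj_le[of j], where 'a = real] by simp
    qed (auto simp: r_def)
    finally show ?thesis by (simp add: ennreal_leI)
  qed
  have finite_integral: "(\<Sum>j. \<Sum>i\<in>Pj j. \<integral>\<^sup>+ Y. f j i Y \<partial>Omega PK) < \<infinity>"
  proof -
    have r: "r j = 2 powr s * 3 powr (- (\<nu> * s) * real j)" for j
      by (simp add: r_def powr_mult powr_powr mult_ac)
    \<comment> \<open>Each hypothesis on \<open>s\<close> becomes a negative exponent:
      \<open>kappa / \<nu> < s\<close> sums the points of \<open>K\<close>, with \<epsilon> to spare
      for their count, and \<open>2 / \<nu> + kappa - 1 < s\<close> sums the Lebesgue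
      points.\<close>
    define \<epsilon> where "\<epsilon> = (\<nu> * s - kappa) / 2"
    have "kappa < \<nu> * s" using s(2) \<nu> by (simp add: field_simps)
    then have \<epsilon>: "0 < \<epsilon>" "kappa + \<epsilon> - \<nu> * s < 0" by (simp_all add: \<epsilon>_def field_simps)
    have "(2 / \<nu> + kappa - 1) * \<nu> < s * \<nu>" using s(1) \<nu> by (rule mult_strict_right_mono)
    then have \<eta>: "2 + (kappa - 1) * \<nu> - \<nu> * s < 0" using \<nu> by (simp add: algebra_simps)
    \<comment> \<open>81 is 9 from \<open>9 ^ (j + 1)\<close> times 9 from the neighbourhood bound;
      \<open>3 powr (1 - kappa)\<close> pays for the floor in \<open>m j\<close>, and
      \<open>2 powr s\<close> for diameter against radius.\<close>
    define C where "C = 81 * 3 powr (1 - kappa) * 2 powr s"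
    let ?a = "\<lambda>j. (real (card (PK \<inter> Pj j)) + 9 ^ (j + 1) * (9 * (2 / 3) ^ m j)) * r j"
    let ?b = "\<lambda>j. 2 powr s * 3 powr ((kappa + \<epsilon> - \<nu> * s) * real j)
      + C * 3 powr ((2 + (kappa - 1) * \<nu> - \<nu> * s) * real j)"
    have "\<forall>\<^sub>F j in sequentially. norm (?a j) \<le> ?b j"
      using sigmaP_eventually_le[OF sigma \<epsilon>(1)]
    proof eventually_elim
      case (elim j)
      have "real (card (PK \<inter> Pj j)) * r j \<le> 3 powr ((kappa + \<epsilon>) * real j) * r j"
        using elim by (intro mult_right_mono) (auto simp: r_def)
      also have "\<dots> = 2 powr s * 3 powr ((kappa + \<epsilon> - \<nu> * s) * real j)"
        unfolding r by (simp add: powr_add[symmetric] algebra_simps)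
      finally have 1: "real (card (PK \<inter> Pj j)) * r j \<le> 2 powr s * 3 powr ((kappa + \<epsilon> - \<nu> * s) * real j)" .
      have "(kappa - 1) * real (m j) \<le> (kappa - 1) * (real j * \<nu> - 1)"
        using m(2)[of j] kappa_less_1 by (intro mult_left_mono_neg) auto
      then have "(2 / 3) ^ m j \<le> 3 powr ((kappa - 1) * (real j * \<nu> - 1))"
        unfolding two_thirds_power by (intro powr_mono) auto
      then have "9 ^ (j + 1) * (9 * (2 / 3) ^ m j) * r j
          \<le> 9 ^ (j + 1) * (9 * 3 powr ((kappa - 1) * (real j * \<nu> - 1))) * r j"
        by (intro mult_right_mono mult_left_mono) (auto simp: r_def)
      also have "\<dots> = C * 3 powr ((2 + (kappa - 1) * \<nu> - \<nu> * s) * real j)"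
      proof -
        have nine: "9 ^ (j + 1) = 9 * (3 powr (2 * real j) :: real)"
          by (simp add: powr_powr[symmetric] powr_realpow)
        show ?thesis
          unfolding nine r C_def by (simp add: powr_add[symmetric] algebra_simps)
      qed
      finally have 2: "9 ^ (j + 1) * (9 * (2 / 3) ^ m j) * r j
          \<le> C * 3 powr ((2 + (kappa - 1) * \<nu> - \<nu> * s) * real j)" .
      have "0 \<le> ?a j" by (simp add: r_def)
      then show ?case using 1 2 by (simp add: distrib_right)
    qed
    moreover have "summable ?b"
      using summable_geometric_powr[OF \<epsilon>(2)] summable_geometric_powr[OF \<eta>]
      by (intro summable_add summable_mult)
    ultimately have "summable ?a" by (rule summable_comparison_test_ev)
    then have "(\<Sum>j. ennreal (?a j)) = ennreal (\<Sum>j. ?a j)"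
      by (intro suminf_ennreal2) (auto simp: r_def)
    moreover have "(\<Sum>j. \<Sum>i\<in>Pj j. \<integral>\<^sup>+ Y. f j i Y \<partial>Omega PK) \<le> (\<Sum>j. ennreal (?a j))"
      by (intro suminf_le integral_le) auto
    ultimately show ?thesis by (simp add: order_le_less_trans)
  qed
  have "(\<integral>\<^sup>+ Y. (\<Sum>j. \<Sum>i\<in>Pj j. f j i Y) \<partial>Omega PK) = (\<Sum>j. \<integral>\<^sup>+ Y. (\<Sum>i\<in>Pj j. f j i Y) \<partial>Omega PK)"
    by (intro nn_integral_suminf borel_measurable_sum f_measurable)
  also have "\<dots> = (\<Sum>j. \<Sum>i\<in>Pj j. \<integral>\<^sup>+ Y. f j i Y \<partial>Omega PK)"
    by (intro suminf_cong nn_integral_sum f_measurable)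
  finally have "(\<integral>\<^sup>+ Y. (\<Sum>j. \<Sum>i\<in>Pj j. f j i Y) \<partial>Omega PK) \<noteq> \<infinity>"
    using finite_integral by simp
  then have "AE Y in Omega PK. (\<Sum>j. \<Sum>i\<in>Pj j. f j i Y) \<noteq> \<infinity>"
    by (intro nn_integral_PInf_AE borel_measurable_suminf_order borel_measurable_sum f_measurable)
  then show ?thesis
  proof eventually_elim
    case (elim Y)
    have "(\<Sum>n. hcontrib s (ball Y (prod_decode n))) \<le> (\<Sum>j. \<Sum>i\<in>Pj j. hcontrib s (ball Y i))"
      by (rule suminf_prod_decode_le) (auto simp: ball_def)
    also have "\<dots> \<le> (\<Sum>j. \<Sum>i\<in>Pj j. f j i Y)"
      by (intro suminf_le sum_mono ball_le) auto
    finally have "(\<Sum>n. hcontrib s (ball Y (prod_decode n))) < \<infinity>"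
      using elim by (simp add: less_top order_le_less_trans)
    then show ?case
    proof (rule hausdorffT_limsup_eq_0[OF _ s0])
      fix x assume x: "x \<in> Fset Y \<nu> \<inter> K"
      let ?S = "{(p, q) \<in> Ppairs. dT x (Y (p, q)) < real q powr (- \<nu>)}"
      have "infinite ?S" using x by (simp add: Fset_def)
      moreover have "?S \<subseteq> prod_decode ` {n. x \<in> ball Y (prod_decode n)}"
      proof
        fix i assume i: "i \<in> ?S"
        have "x \<in> ball Y (prod_decode (prod_encode i))" using i x by (auto simp: ball_def)
        then show "i \<in> prod_decode ` {n. x \<in> ball Y (prod_decode n)}"
          by (intro image_eqI[of _ _ "prod_encode i"]) auto
      qed
      ultimately show "infinite {n. x \<in> ball Y (prod_decode n)}"
        using finite_subset finite_imageI by blast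
    qed
  qed
qed

section \<open>Dimension of the limsup sets\<close>

lemma Fset_antimono:
  assumes "\<mu> \<le> \<nu>"
  shows "Fset Y \<nu> \<subseteq> Fset Y \<mu>"
proof
  fix x assume x: "x \<in> Fset Y \<nu>"
  have "{(p, q) \<in> Ppairs. dT x (Y (p, q)) < real q powr (- \<nu>)}
      \<subseteq> {(p, q) \<in> Ppairs. dT x (Y (p, q)) < real q powr (- \<mu>)}"
  proof clarify
    fix p q assume pq: "(p, q) \<in> Ppairs" "dT x (Y (p, q)) < real q powr (- \<nu>)"
    then have "real q powr (- \<nu>) \<le> real q powr (- \<mu>)"
      using assms by (intro powr_mono) (auto simp: Ppairs_def)
    then show "dT x (Y (p, q)) < real q powr (- \<mu>)" using pq(2) by simp
  qed
  then show "x \<in> Fset Y \<mu>"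
    using x infinite_super by (simp add: Fset_def) blast
qed

lemma Fset_subset_M_bullet:
  assumes "0 \<le> \<mu>" "\<mu> \<le> \<nu>"
  shows "Fset Y \<nu> \<subseteq> M_bullet Y \<mu>"
proof
  fix x assume "x \<in> Fset Y \<nu>"
  then have "x \<in> Fset Y \<mu>" using Fset_antimono[OF assms(2)] by blast
  then show "x \<in> M_bullet Y \<mu>"
    using assms(1) by (auto simp: M_bullet_def mu_bullet_def Fset_def intro!: Sup_upper)
qed

text \<open>The supremum in \<open>mu_bullet\<close> need not be attained, so the exponent has to
  drop strictly.\<close>

lemma M_bullet_subset_Fset:
  assumes "\<nu> < \<mu>"
  shows "M_bullet Y \<mu> \<subseteq> Fset Y \<nu>"
proof
  fix x assume "x \<in> M_bullet Y \<mu>"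
  then have "ereal \<mu> \<le> mu_bullet Y x" by (simp add: M_bullet_def)
  then have "ereal \<nu> < mu_bullet Y x" using assms by (meson ereal_less_eq(3) less_ereal.simps(1) order_less_le_trans)
  then obtain \<mu>' where "\<nu> < \<mu>'" "x \<in> Fset Y \<mu>'"
    unfolding mu_bullet_def less_Sup_iff by auto
  then show "x \<in> Fset Y \<nu>" using Fset_antimono[of \<nu> \<mu>' Y] by auto
qed

text \<open>Moving \<mu> to a nearby rational on the required side preserves a strict inequality for
  \<open>D\<close>; this lets countably many almost sure events settle all real \<mu>.\<close>

lemma ex_Rats_near:
  fixes D :: "real \<Rightarrow> real"
  assumes "isCont D \<mu>" "0 < \<mu>"
  shows "D \<mu> < s \<Longrightarrow> \<exists>\<nu>\<in>\<rat>. 0 < \<nu> \<and> \<nu> < \<mu> \<and> D \<nu> < s"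
    and "s < D \<mu> \<Longrightarrow> \<exists>\<nu>\<in>\<rat>. \<mu> < \<nu> \<and> s < D \<nu>"
proof -
  have lim: "(D \<longlongrightarrow> D \<mu>) (nhds \<mu>)"
    using assms(1) by (simp add: isCont_def tendsto_at_iff_tendsto_nhds)
  show "\<exists>\<nu>\<in>\<rat>. 0 < \<nu> \<and> \<nu> < \<mu> \<and> D \<nu> < s" if less: "D \<mu> < s"
  proof -
    obtain d where d: "0 < d" "\<And>\<nu>. dist \<nu> \<mu> < d \<Longrightarrow> D \<nu> < s"
      using order_tendstoD(2)[OF lim less] unfolding eventually_nhds_metric by blast
    obtain \<nu> where "\<nu> \<in> \<rat>" "max 0 (\<mu> - d) < \<nu>" "\<nu> < \<mu>"
      using Rats_dense_in_real[of "max 0 (\<mu> - d)" \<mu>] assms(2) d(1) by auto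
    then show ?thesis using d(2)[of \<nu>] by (auto simp: dist_real_def)
  qed
  show "\<exists>\<nu>\<in>\<rat>. \<mu> < \<nu> \<and> s < D \<nu>" if less: "s < D \<mu>"
  proof -
    obtain d where d: "0 < d" "\<And>\<nu>. dist \<nu> \<mu> < d \<Longrightarrow> s < D \<nu>"
      using order_tendstoD(1)[OF lim less] unfolding eventually_nhds_metric by blast
    obtain \<nu> where "\<nu> \<in> \<rat>" "\<mu> < \<nu>" "\<nu> < \<mu> + d"
      using Rats_dense_in_real[of \<mu> "\<mu> + d"] d(1) by auto
    then show ?thesis using d(2)[of \<nu>] by (auto simp: dist_real_def)
  qed
qed

text \<open>\<open>M_bullet Y \<mu>\<close> is squeezed between sets \<open>Fset Y \<nu>\<close>
  with rational \<nu> on either side of \<mu>, and \<open>s\<close> is likewise replaced by a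
  rational. The statement concerns one fixed \<open>Y\<close>, so a single event serves every
  \<mu>.\<close>

lemma dimH_M_bullet_K:
  fixes D :: "real \<Rightarrow> real"
  assumes "0 < \<mu>" "isCont D \<mu>" "0 \<le> D \<mu>"
    and zero: "\<And>\<nu> s. \<nu> \<in> \<rat> \<Longrightarrow> s \<in> \<rat> \<Longrightarrow> 0 < \<nu> \<Longrightarrow> D \<nu> < s \<Longrightarrow> hausdorffT s (Fset Y \<nu> \<inter> K) = 0"
    and pos: "\<And>\<nu> s. \<nu> \<in> \<rat> \<Longrightarrow> s \<in> \<rat> \<Longrightarrow> \<mu> < \<nu> \<Longrightarrow> 0 < s \<Longrightarrow> s < D \<nu> \<Longrightarrow> 0 < hausdorffT s (Fset Y \<nu> \<inter> K)"
  shows "dimH (M_bullet Y \<mu> \<inter> K) = D \<mu>"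
proof (rule dimH_eqI[OF assms(3)])
  fix s assume s: "D \<mu> < s"
  then obtain s' where s': "s' \<in> \<rat>" "D \<mu> < s'" "s' < s" using Rats_dense_in_real by blast
  then obtain \<nu> where \<nu>: "\<nu> \<in> \<rat>" "0 < \<nu>" "\<nu> < \<mu>" "D \<nu> < s'"
    using ex_Rats_near(1)[OF assms(2,1)] by blast
  have "hausdorffT s (M_bullet Y \<mu> \<inter> K) \<le> hausdorffT s (Fset Y \<nu> \<inter> K)"
    using M_bullet_subset_Fset[OF \<nu>(3)] by (intro hausdorffT_mono) blast
  also have "\<dots> \<le> hausdorffT s' (Fset Y \<nu> \<inter> K)"
    using s' assms(3) by (intro hausdorffT_antimono_exponent) auto
  also have "\<dots> = 0" using zero \<nu> s' by blast
  finally show "hausdorffT s (M_bullet Y \<mu> \<inter> K) = 0" by simp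
next
  fix s assume s: "0 \<le> s" "s < D \<mu>"
  then obtain s' where s': "s' \<in> \<rat>" "s < s'" "s' < D \<mu>" using Rats_dense_in_real by blast
  then obtain \<nu> where \<nu>: "\<nu> \<in> \<rat>" "\<mu> < \<nu>" "s' < D \<nu>"
    using ex_Rats_near(2)[OF assms(2,1)] by blast
  have "0 < hausdorffT s' (Fset Y \<nu> \<inter> K)" using pos \<nu> s' s by simp
  also have "\<dots> \<le> hausdorffT s (Fset Y \<nu> \<inter> K)"
    using s s' by (intro hausdorffT_antimono_exponent) auto
  also have "\<dots> \<le> hausdorffT s (M_bullet Y \<mu> \<inter> K)"
    using Fset_subset_M_bullet[of \<mu> \<nu> Y] assms(1) \<nu>(2) by (intro hausdorffT_mono) auto
  finally show "0 < hausdorffT s (M_bullet Y \<mu> \<inter> K)" .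
qed

lemma mu_bullet_ge_2:
  assumes "\<And>\<nu>. \<nu> \<in> \<rat> \<Longrightarrow> 0 < \<nu> \<Longrightarrow> \<nu> < 2 \<Longrightarrow> x \<in> Fset Y \<nu>"
  shows "2 \<le> mu_bullet Y x"
proof (rule dense_le_bounded)
  show "(0::ereal) < 2" by simp
  fix z :: ereal assume z: "0 < z" "z < 2"
  then obtain r where r: "z = ereal r" "0 < r" "r < 2" by (cases z) auto
  then obtain \<nu> where \<nu>: "\<nu> \<in> \<rat>" "r < \<nu>" "\<nu> < 2" using Rats_dense_in_real by blast
  then have "x \<in> Fset Y \<nu>" using assms r by simp
  then have "ereal \<nu> \<le> mu_bullet Y x"
    unfolding mu_bullet_def using r \<nu> by (intro Sup_upper) auto
  then show "z \<le> mu_bullet Y x" using r(1) \<nu>(2) by (meson ereal_less_eq(3) less_imp_le order_trans)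
qed

theorem theorem2p4:
  fixes PK :: "(nat \<times> nat) set"
  assumes "PK \<subseteq> Ppairs"
    and "sigmaP PK = ereal kappa"
  shows "AE Y in Omega PK.
           (\<forall>\<xi>\<in>K. mu_bullet Y \<xi> \<ge> 2) \<and>
           (\<forall>\<mu>::real. \<mu> \<ge> 2 \<longrightarrow>
              dimH (M_bullet Y \<mu> \<inter> K) = max (2 / \<mu> + kappa - 1) (kappa / \<mu>))"
proof -
  define D where "D \<nu> = max (2 / \<nu> + kappa - 1) (kappa / \<nu>)" for \<nu>
  have "AE Y in Omega PK. \<forall>\<nu>\<in>{\<nu> \<in> \<rat>. 0 < \<nu> \<and> \<nu> < 2}. K \<subseteq> Fset Y \<nu>"
    using AE_K_subset_Fset[OF assms] by (intro AE_ball_countable[THEN iffD2]) (auto intro: countable_subset[OF _ countable_rat])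
  moreover have "AE Y in Omega PK. \<forall>(\<nu>, s)\<in>{(\<nu>, s) \<in> \<rat> \<times> \<rat>. 0 < \<nu> \<and> D \<nu> < s}. hausdorffT s (Fset Y \<nu> \<inter> K) = 0"
    using AE_hausdorffT_Fset_eq_0[OF assms(2)]
    by (intro AE_ball_countable[THEN iffD2])
       (auto simp: D_def intro: countable_subset[OF _ countable_SIGMA[OF countable_rat countable_rat]])
  \<comment> \<open>Being below the maximum \<open>D \<nu>\<close> means being below one of its two
    terms, which decides whether Lebesgue points or points of \<open>K\<close> provide the
    bound.\<close>
  moreover have "AE Y in Omega PK. \<forall>(\<nu>, s)\<in>{(\<nu>, s) \<in> \<rat> \<times> \<rat>. 2 \<le> \<nu> \<and> 0 < s \<and> s < D \<nu>}. 0 < hausdorffT s (Fset Y \<nu> \<inter> K)"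
    using AE_hausdorffT_Fset_pos_lebesgue[OF assms] AE_hausdorffT_Fset_pos_K[OF assms]
    by (intro AE_ball_countable[THEN iffD2])
       (auto simp: D_def less_max_iff_disj intro: countable_subset[OF _ countable_SIGMA[OF countable_rat countable_rat]])
  ultimately show ?thesis
  proof eventually_elim
    case (elim Y)
    have "2 \<le> mu_bullet Y \<xi>" if "\<xi> \<in> K" for \<xi>
      using elim(1) that by (intro mu_bullet_ge_2) auto
    moreover have "dimH (M_bullet Y \<mu> \<inter> K) = D \<mu>" if \<mu>: "2 \<le> \<mu>" for \<mu>
    proof (rule dimH_M_bullet_K)
      show "isCont D \<mu>" unfolding D_def using \<mu> by (intro continuous_intros) auto
      show "0 \<le> D \<mu>" using \<mu> kappa_pos by (auto simp: D_def le_max_iff_disj)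
    qed (use elim(2,3) \<mu> in auto)
    ultimately show ?case by (auto simp: D_def)
  qed
qed

end
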